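(* Let $(X,\omega_X,\mathfrak b)$ be an l.c.s. manifold with $\dim X\ge4$, and let $L:H^1(X,\mathbb R)\to H^3_{\mathfrak b}(X,\mathbb R)$, $[\alpha]\mapsto[\alpha]\wedge[\omega_X]$. If $L$ is injective, then $$\operatorname{Def}(X,\omega_X,\mathfrak b)=(\ker d^{\mathfrak b}\cap\Omega^2(X))/S(\omega_X,\mathfrak b)(Vect(X)\oplus\mathbb R)=H^2_{\mathfrak b}(X)/\langle\omega_X\rangle_{\otimes\mathbb R}.$$ In particular, if $\mathfrak b=0$ (so that $X$ is symplectic), then $\operatorname{Def}(X,\omega_X)=H^2(X,\mathbb R)/\langle\omega_X\rangle_{\otimes\mathbb R}$. If $L$ is not injective, then $$\operatorname{Def}(X,\omega_X,\mathfrak b)=\ker L\oplus(\ker d^{\mathfrak b}\cap\Omega^2(X))/S(\omega_X,\mathfrak b)(Vect(X)\oplus\mathbb R)=\ker L\oplus H^2_{\mathfrak b}(X)/\langle\omega_X\rangle_{\otimes\mathbb R}.$$ In particular, if $\mathfrak b=0$, then $\operatorname{Def}(X,\omega_X)=\ker L\oplus H^2(X,\mathbb R)/\langle\omega_X\rangle_{\otimes\mathbb R}$.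
   Context: An l.c.s. manifold is a triple $(X,\omega_X,\mathfrak b)$ with $\mathfrak b$ a closed one-form and $\omega_X$ a nondegenerate two-form with $d\omega_X+\mathfrak b\wedge\omega_X=0$. Put $d^{\mathfrak b}\alpha=d\alpha+\mathfrak b\wedge\alpha$ and $H^*_{\mathfrak b}(X)=\ker d^{\mathfrak b}/\operatorname{im}d^{\mathfrak b}$. An infinitesimal deformation of $(X,\omega_X,\mathfrak b)$ is a pair $(\kappa,\mathfrak c)\in\Omega^2(X)\times\Omega^1(X)$ with $d^{\mathfrak b}\kappa=-\mathfrak c\wedge\omega_X$ and $d\mathfrak c=0$. Two infinitesimal deformations $(\kappa',\mathfrak c')$, $(\kappa,\mathfrak c)$ are equivalent if there exist a vector field $\xi$ on $X$ and $f\in C^\infty(X)$ with $\kappa'=-f\,\omega_X+\kappa+\mathcal L_\xi\omega_X$ and $\mathfrak c'=\mathfrak c+\mathcal L_\xi\mathfrak b+df$. $\operatorname{Def}(X,\omega_X,\mathfrak b)$ is the set of equivalence classes of infinitesimal deformations. The map $S(\omega_X,\mathfrak b):Vect(X)\oplus\mathbb R\to\ker d^{\mathfrak b}\cap\Omega^2(X)$ is $S(\omega_X,\mathfrak b)(\xi,c)=d^{\mathfrak b}(\xi\rfloor\omega_X)-c\,\omega_X$. $\langle\omega_X\rangle_{\otimes\mathbb R}$ denotes the real span of (the class of) $\omega_X$.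
   Formalization: The manifold X is assumed connected; for disconnected X (for example two disjoint symplectic 4-tori) the claim fails, since locally constant multiples of ω_X, not only real multiples, are then trivial deformations. *)

theory Defs
  imports "HOL-Analysis.Analysis" "HOL-Library.Function_Algebras"
begin

text \<open>
  Conventions.  A manifold is modelled on a Euclidean space \<open>'e\<close>, so its dimension is
  \<open>DIM('e)\<close>; its set of points is a Hausdorff, second countable type \<open>'a\<close>; its smooth structure is
  given by an atlas.  As in Helgason's \<open>Differential Geometry, Lie Groups, and Symmetric Spaces\<close>
  (Chapter I, section 2), vector fields are the derivations of the algebra of smooth functions, and
  differential forms of degree \<open>k\<close> are the alternating, \<open>C\<^sup>\<infinity>\<close>-multilinear maps
  from \<open>k\<close>-tuples of vector fields to smooth functions.  Functions, derivations and forms are added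
  and multiplied pointwise (\<open>Function_Algebras\<close>).
\<close>

section \<open>Real vector spaces on carrier sets\<close>

text \<open>Quotients such as cohomology groups live on sets of cosets, hence the explicit carriers.\<close>

record 'v real_vs =
  vs_carrier :: "'v set"
  vs_zero :: 'v
  vs_add :: "'v \<Rightarrow> 'v \<Rightarrow> 'v"
  vs_scale :: "real \<Rightarrow> 'v \<Rightarrow> 'v"

definition vs_iso :: "'v real_vs \<Rightarrow> 'w real_vs \<Rightarrow> ('v \<Rightarrow> 'w) \<Rightarrow> bool" where
  "vs_iso V W F \<longleftrightarrow>
     bij_betw F (vs_carrier V) (vs_carrier W) \<and>
     (\<forall>u\<in>vs_carrier V. \<forall>v\<in>vs_carrier V. F (vs_add V u v) = vs_add W (F u) (F v)) \<and>
     (\<forall>r. \<forall>v\<in>vs_carrier V. F (vs_scale V r v) = vs_scale W r (F v))"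

definition vs_restrict :: "'v real_vs \<Rightarrow> 'v set \<Rightarrow> 'v real_vs" where
  "vs_restrict V U = V \<lparr>vs_carrier := U\<rparr>"

definition vs_sum :: "'v real_vs \<Rightarrow> 'w real_vs \<Rightarrow> ('v \<times> 'w) real_vs" where
  "vs_sum V W =
     \<lparr>vs_carrier = vs_carrier V \<times> vs_carrier W,
      vs_zero = (vs_zero V, vs_zero W),
      vs_add = (\<lambda>(u, u') (v, v'). (vs_add V u v, vs_add W u' v')),
      vs_scale = (\<lambda>r (v, v'). (vs_scale V r v, vs_scale W r v'))\<rparr>"

text \<open>
  The quotient by an equivalence relation compatible with the operations; the unions lift the
  operations to classes in the manner of \<open>Equiv_Relations\<close>.
\<close>

definition vs_quot_rel :: "'v real_vs \<Rightarrow> ('v \<times> 'v) set \<Rightarrow> 'v set real_vs" where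
  "vs_quot_rel V R =
     \<lparr>vs_carrier = vs_carrier V // R,
      vs_zero = R `` {vs_zero V},
      vs_add = (\<lambda>A B. \<Union>u\<in>A. \<Union>v\<in>B. R `` {vs_add V u v}),
      vs_scale = (\<lambda>r A. \<Union>v\<in>A. R `` {vs_scale V r v})\<rparr>"

definition coset_rel :: "'v real_vs \<Rightarrow> 'v set \<Rightarrow> ('v \<times> 'v) set" where
  "coset_rel V W = {(u, v). u \<in> vs_carrier V \<and> v \<in> vs_carrier V \<and> (\<exists>w\<in>W. v = vs_add V u w)}"

definition vs_coset :: "'v real_vs \<Rightarrow> 'v set \<Rightarrow> 'v \<Rightarrow> 'v set" where
  "vs_coset V W v = coset_rel V W `` {v}"

definition vs_quot :: "'v real_vs \<Rightarrow> 'v set \<Rightarrow> 'v set real_vs" where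
  "vs_quot V W = vs_quot_rel V (coset_rel V W)"

definition vs_line :: "'v real_vs \<Rightarrow> 'v \<Rightarrow> 'v set" where
  "vs_line V v = range (\<lambda>r. vs_scale V r v)"


section \<open>Smooth manifolds\<close>

text \<open>
  For open \<open>S\<close>, \<open>Ck_on k S f\<close> says that \<open>f\<close> is \<open>k\<close> times continuously differentiable on \<open>S\<close>,
  the derivatives of order \<open>k\<close> being taken as iterated directional derivatives.
\<close>

primrec Ck_on :: "nat \<Rightarrow> 'e::euclidean_space set \<Rightarrow> ('e \<Rightarrow> 'b::real_normed_vector) \<Rightarrow> bool" where
  "Ck_on 0 S f \<longleftrightarrow> continuous_on S f"
| "Ck_on (Suc k) S f \<longleftrightarrow>
     (\<forall>x\<in>S. f differentiable (at x)) \<and>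
     (\<forall>v. Ck_on k S (\<lambda>x. frechet_derivative f (at x) v))"

definition smooth_on :: "'e::euclidean_space set \<Rightarrow> ('e \<Rightarrow> 'b::real_normed_vector) \<Rightarrow> bool" where
  "smooth_on S f \<longleftrightarrow> (\<forall>k. Ck_on k S f)"

type_synonym ('a, 'e) atlas = "('a set \<times> ('a \<Rightarrow> 'e)) set"

definition smooth_atlas ::
  "('a::{t2_space,second_countable_topology}, 'e::euclidean_space) atlas \<Rightarrow> bool" where
  "smooth_atlas A \<longleftrightarrow>
     (\<Union>(U, \<phi>)\<in>A. U) = UNIV \<and>
     (\<forall>(U, \<phi>)\<in>A. open U \<and> open (\<phi> ` U) \<and> homeomorphism U (\<phi> ` U) \<phi> (inv_into U \<phi>)) \<and>
     (\<forall>(U, \<phi>)\<in>A. \<forall>(V, \<psi>)\<in>A. smooth_on (\<phi> ` (U \<inter> V)) (\<psi> \<circ> inv_into U \<phi>))"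

definition smooth_functions :: "('a, 'e::euclidean_space) atlas \<Rightarrow> ('a \<Rightarrow> real) set" where
  "smooth_functions A = {f. \<forall>(U, \<phi>)\<in>A. smooth_on (\<phi> ` U) (f \<circ> inv_into U \<phi>)}"


section \<open>Vector fields and differential forms\<close>

text \<open>
  Derivations vanish, by convention, off the smooth functions; likewise a form of degree \<open>k\<close> is
  evaluated on a list of vector fields and vanishes on any other list.  This makes equality of
  derivations and of forms the intended one.
\<close>

type_synonym 'a vfield = "('a \<Rightarrow> real) \<Rightarrow> ('a \<Rightarrow> real)"
type_synonym 'a form = "'a vfield list \<Rightarrow> ('a \<Rightarrow> real)"

definition vector_fields :: "('a, 'e::euclidean_space) atlas \<Rightarrow> 'a vfield set" where
  "vector_fields A =
     {\<xi>. (\<forall>f. f \<notin> smooth_functions A \<longrightarrow> \<xi> f = 0) \<and>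
         (\<forall>f\<in>smooth_functions A. \<xi> f \<in> smooth_functions A) \<and>
         (\<forall>f\<in>smooth_functions A. \<forall>g\<in>smooth_functions A. \<xi> (f + g) = \<xi> f + \<xi> g) \<and>
         (\<forall>r. \<forall>f\<in>smooth_functions A. \<xi> (\<lambda>x. r * f x) = (\<lambda>x. r * \<xi> f x)) \<and>
         (\<forall>f\<in>smooth_functions A. \<forall>g\<in>smooth_functions A. \<xi> (f * g) = \<xi> f * g + f * \<xi> g)}"

definition lie_bracket :: "'a vfield \<Rightarrow> 'a vfield \<Rightarrow> 'a vfield" where
  "lie_bracket \<xi> \<eta> = (\<lambda>f. \<xi> (\<eta> f) - \<eta> (\<xi> f))"

definition vf_mult :: "('a \<Rightarrow> real) \<Rightarrow> 'a vfield \<Rightarrow> 'a vfield" where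
  "vf_mult f \<xi> = (\<lambda>g. f * \<xi> g)"

definition forms :: "('a, 'e::euclidean_space) atlas \<Rightarrow> nat \<Rightarrow> 'a form set" where
  "forms A k =
     {\<alpha>. (\<forall>xs. \<not> (length xs = k \<and> set xs \<subseteq> vector_fields A) \<longrightarrow> \<alpha> xs = 0) \<and>
         (\<forall>xs. length xs = k \<and> set xs \<subseteq> vector_fields A \<longrightarrow>
            \<alpha> xs \<in> smooth_functions A \<and>
            (\<forall>i<k. \<forall>\<xi>\<in>vector_fields A. \<forall>\<eta>\<in>vector_fields A.
               \<alpha> (xs[i := \<xi> + \<eta>]) = \<alpha> (xs[i := \<xi>]) + \<alpha> (xs[i := \<eta>])) \<and>
            (\<forall>i<k. \<forall>f\<in>smooth_functions A. \<forall>\<xi>\<in>vector_fields A.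
               \<alpha> (xs[i := vf_mult f \<xi>]) = f * \<alpha> (xs[i := \<xi>])) \<and>
            (\<forall>i<k. \<forall>j<k. i \<noteq> j \<and> xs ! i = xs ! j \<longrightarrow> \<alpha> xs = 0))}"

definition form_mult :: "('a \<Rightarrow> real) \<Rightarrow> 'a form \<Rightarrow> 'a form" where
  "form_mult f \<alpha> = (\<lambda>xs. f * \<alpha> xs)"

definition form_scale :: "real \<Rightarrow> 'a form \<Rightarrow> 'a form" where
  "form_scale r \<alpha> = form_mult (\<lambda>_. r) \<alpha>"

definition form_space :: "('a, 'e::euclidean_space) atlas \<Rightarrow> nat \<Rightarrow> 'a form real_vs" where
  "form_space A k =
     \<lparr>vs_carrier = forms A k, vs_zero = 0, vs_add = (+), vs_scale = form_scale\<rparr>"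

text \<open>A smooth function regarded as a form of degree \<open>0\<close>.\<close>

definition form_of_fun :: "('a \<Rightarrow> real) \<Rightarrow> 'a form" where
  "form_of_fun f = (\<lambda>xs. if xs = [] then f else 0)"

definition drop_nth :: "nat \<Rightarrow> 'b list \<Rightarrow> 'b list" where
  "drop_nth i xs = take i xs @ drop (Suc i) xs"

text \<open>
  The exterior derivative is given by the invariant (Koszul) formula, normalised without the factor
  \<open>1/(k+1)\<close>, and the wedge product accordingly without factorials.
\<close>

definition ext_deriv :: "('a, 'e::euclidean_space) atlas \<Rightarrow> 'a form \<Rightarrow> 'a form" where
  "ext_deriv A \<alpha> = (\<lambda>xs p.
     if set xs \<subseteq> vector_fields A
     then (\<Sum>i<length xs. (-1) ^ i * (xs ! i) (\<alpha> (drop_nth i xs)) p)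
        + (\<Sum>j<length xs. \<Sum>i<j. (-1) ^ (i + j) *
             \<alpha> (lie_bracket (xs ! i) (xs ! j) # drop_nth i (drop_nth j xs)) p)
     else 0)"

text \<open>The wedge product of a form \<open>\<beta>\<close> of degree \<open>1\<close> with a form of arbitrary degree.\<close>

definition wedge1 :: "'a form \<Rightarrow> 'a form \<Rightarrow> 'a form" where
  "wedge1 \<beta> \<alpha> = (\<lambda>xs p. \<Sum>i<length xs. (-1) ^ i * \<beta> [xs ! i] p * \<alpha> (drop_nth i xs) p)"

definition interior :: "'a vfield \<Rightarrow> 'a form \<Rightarrow> 'a form" where
  "interior \<xi> \<alpha> = (\<lambda>xs. \<alpha> (\<xi> # xs))"

definition lie_deriv :: "('a, 'e::euclidean_space) atlas \<Rightarrow> 'a vfield \<Rightarrow> 'a form \<Rightarrow> 'a form" where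
  "lie_deriv A \<xi> \<alpha> = (\<lambda>xs p.
     if set xs \<subseteq> vector_fields A
     then \<xi> (\<alpha> xs) p - (\<Sum>i<length xs. \<alpha> (xs[i := lie_bracket \<xi> (xs ! i)]) p)
     else 0)"

definition twisted_deriv ::
  "('a, 'e::euclidean_space) atlas \<Rightarrow> 'a form \<Rightarrow> 'a form \<Rightarrow> 'a form" where
  "twisted_deriv A b \<alpha> = ext_deriv A \<alpha> + wedge1 b \<alpha>"


section \<open>Cohomology\<close>

text \<open>
  \<open>D\<close> is the differential: \<open>ext_deriv A\<close> for de Rham cohomology, \<open>twisted_deriv A b\<close> for the twisted
  groups \<open>H\<^sub>b\<close>.
\<close>

definition closed_forms ::
  "('a, 'e::euclidean_space) atlas \<Rightarrow> ('a form \<Rightarrow> 'a form) \<Rightarrow> nat \<Rightarrow> 'a form real_vs" where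
  "closed_forms A D k = vs_restrict (form_space A k) {\<alpha> \<in> forms A k. D \<alpha> = 0}"

definition exact_forms ::
  "('a, 'e::euclidean_space) atlas \<Rightarrow> ('a form \<Rightarrow> 'a form) \<Rightarrow> nat \<Rightarrow> 'a form set" where
  "exact_forms A D k = (case k of 0 \<Rightarrow> {0} | Suc j \<Rightarrow> D ` forms A j)"

definition cohomology ::
  "('a, 'e::euclidean_space) atlas \<Rightarrow> ('a form \<Rightarrow> 'a form) \<Rightarrow> nat \<Rightarrow> 'a form set real_vs" where
  "cohomology A D k = vs_quot (closed_forms A D k) (exact_forms A D k)"

definition coh_class ::
  "('a, 'e::euclidean_space) atlas \<Rightarrow> ('a form \<Rightarrow> 'a form) \<Rightarrow> nat \<Rightarrow> 'a form \<Rightarrow> 'a form set" where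
  "coh_class A D k \<alpha> = vs_coset (closed_forms A D k) (exact_forms A D k) \<alpha>"


section \<open>Locally conformally symplectic structures\<close>

text \<open>
  The tangent vectors at \<open>p\<close> are the values \<open>\<xi>\<^sub>p\<close> of vector fields, with
  \<open>\<xi>\<^sub>p = 0\<close> iff \<open>\<xi> f p = 0\<close> for all smooth \<open>f\<close>.  Nondegeneracy is demanded
  on each tangent space.
\<close>

definition nondegenerate :: "('a, 'e::euclidean_space) atlas \<Rightarrow> 'a form \<Rightarrow> bool" where
  "nondegenerate A \<omega> \<longleftrightarrow>
     (\<forall>p. \<forall>\<xi>\<in>vector_fields A. (\<forall>\<eta>\<in>vector_fields A. \<omega> [\<xi>, \<eta>] p = 0) \<longrightarrow>
        (\<forall>f\<in>smooth_functions A. \<xi> f p = 0))"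

definition lcs_structure ::
  "('a, 'e::euclidean_space) atlas \<Rightarrow> 'a form \<Rightarrow> 'a form \<Rightarrow> bool" where
  "lcs_structure A \<omega> b \<longleftrightarrow>
     b \<in> forms A 1 \<and> ext_deriv A b = 0 \<and>
     \<omega> \<in> forms A 2 \<and> nondegenerate A \<omega> \<and> ext_deriv A \<omega> + wedge1 b \<omega> = 0"

definition symplectic_form :: "('a, 'e::euclidean_space) atlas \<Rightarrow> 'a form \<Rightarrow> bool" where
  "symplectic_form A \<omega> \<longleftrightarrow> \<omega> \<in> forms A 2 \<and> nondegenerate A \<omega> \<and> ext_deriv A \<omega> = 0"

definition infinitesimal_deformations ::
  "('a, 'e::euclidean_space) atlas \<Rightarrow> 'a form \<Rightarrow> 'a form \<Rightarrow> ('a form \<times> 'a form) set" where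
  "infinitesimal_deformations A \<omega> b =
     {(\<kappa>, c). \<kappa> \<in> forms A 2 \<and> c \<in> forms A 1 \<and>
        twisted_deriv A b \<kappa> = - wedge1 c \<omega> \<and> ext_deriv A c = 0}"

definition deformation_equiv ::
  "('a, 'e::euclidean_space) atlas \<Rightarrow> 'a form \<Rightarrow> 'a form
     \<Rightarrow> (('a form \<times> 'a form) \<times> ('a form \<times> 'a form)) set" where
  "deformation_equiv A \<omega> b =
     {((\<kappa>', c'), (\<kappa>, c)).
        (\<kappa>', c') \<in> infinitesimal_deformations A \<omega> b \<and>
        (\<kappa>, c) \<in> infinitesimal_deformations A \<omega> b \<and>
        (\<exists>\<xi>\<in>vector_fields A. \<exists>f\<in>smooth_functions A.
           \<kappa>' = - form_mult f \<omega> + \<kappa> + lie_deriv A \<xi> \<omega> \<and>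
           c' = c + lie_deriv A \<xi> b + ext_deriv A (form_of_fun f))}"

text \<open>\<open>Def(X,\<omega>,b)\<close>, with the vector space structure induced by that of \<open>\<Omega>\<^sup>2 \<oplus> \<Omega>\<^sup>1\<close>.\<close>

definition Def_space ::
  "('a, 'e::euclidean_space) atlas \<Rightarrow> 'a form \<Rightarrow> 'a form \<Rightarrow> ('a form \<times> 'a form) set real_vs" where
  "Def_space A \<omega> b =
     vs_quot_rel
       (vs_restrict (vs_sum (form_space A 2) (form_space A 1)) (infinitesimal_deformations A \<omega> b))
       (deformation_equiv A \<omega> b)"

definition Def_class ::
  "('a, 'e::euclidean_space) atlas \<Rightarrow> 'a form \<Rightarrow> 'a form
     \<Rightarrow> 'a form \<times> 'a form \<Rightarrow> ('a form \<times> 'a form) set" where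
  "Def_class A \<omega> b \<delta> = deformation_equiv A \<omega> b `` {\<delta>}"

definition S_map ::
  "('a, 'e::euclidean_space) atlas \<Rightarrow> 'a form \<Rightarrow> 'a form \<Rightarrow> 'a vfield \<times> real \<Rightarrow> 'a form" where
  "S_map A \<omega> b = (\<lambda>(\<xi>, c). twisted_deriv A b (interior \<xi> \<omega>) - form_scale c \<omega>)"

definition S_image ::
  "('a, 'e::euclidean_space) atlas \<Rightarrow> 'a form \<Rightarrow> 'a form \<Rightarrow> 'a form set" where
  "S_image A \<omega> b = S_map A \<omega> b ` (vector_fields A \<times> UNIV)"

text \<open>\<open>(ker d\<^sup>b \<inter> \<Omega>\<^sup>2) / S(Vect(X) \<oplus> \<real>)\<close> and the class of a closed form in it.\<close>

definition closed_mod_S ::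
  "('a, 'e::euclidean_space) atlas \<Rightarrow> 'a form \<Rightarrow> 'a form \<Rightarrow> 'a form set real_vs" where
  "closed_mod_S A \<omega> b = vs_quot (closed_forms A (twisted_deriv A b) 2) (S_image A \<omega> b)"

definition closed_mod_S_class ::
  "('a, 'e::euclidean_space) atlas \<Rightarrow> 'a form \<Rightarrow> 'a form \<Rightarrow> 'a form \<Rightarrow> 'a form set" where
  "closed_mod_S_class A \<omega> b \<kappa> =
     vs_coset (closed_forms A (twisted_deriv A b) 2) (S_image A \<omega> b) \<kappa>"

text \<open>\<open>H\<^sup>2 / \<langle>\<omega>\<rangle>\<close> for the differential \<open>D\<close>, and the class of a \<open>D\<close>-closed form in it.\<close>

definition H2_mod ::
  "('a, 'e::euclidean_space) atlas \<Rightarrow> ('a form \<Rightarrow> 'a form) \<Rightarrow> 'a form \<Rightarrow> 'a form set set real_vs" where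
  "H2_mod A D \<omega> = vs_quot (cohomology A D 2) (vs_line (cohomology A D 2) (coh_class A D 2 \<omega>))"

definition H2_mod_class ::
  "('a, 'e::euclidean_space) atlas \<Rightarrow> ('a form \<Rightarrow> 'a form) \<Rightarrow> 'a form \<Rightarrow> 'a form
     \<Rightarrow> 'a form set set" where
  "H2_mod_class A D \<omega> \<kappa> =
     vs_coset (cohomology A D 2) (vs_line (cohomology A D 2) (coh_class A D 2 \<omega>)) (coh_class A D 2 \<kappa>)"

text \<open>\<open>L : H\<^sup>1 \<rightarrow> H\<^sup>3\<^sub>b\<close>, again lifted to classes by a union over representatives.\<close>

definition L_map ::
  "('a, 'e::euclidean_space) atlas \<Rightarrow> 'a form \<Rightarrow> 'a form \<Rightarrow> 'a form set \<Rightarrow> 'a form set" where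
  "L_map A \<omega> b C = (\<Union>\<alpha>\<in>C. coh_class A (twisted_deriv A b) 3 (wedge1 \<alpha> \<omega>))"

definition L_kernel ::
  "('a, 'e::euclidean_space) atlas \<Rightarrow> 'a form \<Rightarrow> 'a form \<Rightarrow> 'a form set real_vs" where
  "L_kernel A \<omega> b =
     vs_restrict (cohomology A (ext_deriv A) 1)
       {C \<in> vs_carrier (cohomology A (ext_deriv A) 1).
          L_map A \<omega> b C = vs_zero (cohomology A (twisted_deriv A b) 3)}"

end

theory Submission
  imports Defs
begin

text \<open>
  Why the theorem holds. Cartan's formulas rewrite the equivalence of deformations: two of them are
  equivalent iff they differ by a pair \<open>(d\<^sup>b \<alpha> - g \<omega>, dg)\<close>, where \<open>\<alpha>\<close> is the contraction of \<open>\<omega>\<close> with a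
  vector field and \<open>g\<close> is a smooth function. Hence \<open>Def\<close> is the quotient of the space \<open>E\<close> of
  infinitesimal deformations by the subspace \<open>T\<close> of these trivial ones
  (\<open>deformation_equiv_iff\<close>). Nondegeneracy of \<open>\<omega>\<close> makes the contractions of \<open>\<omega>\<close> exhaust all one-forms
  (\<open>interior_onto\<close>), so the image of \<open>S\<close> consists of the forms \<open>d\<^sup>b \<alpha> - r \<omega>\<close> with \<open>\<alpha>\<close> any one-form
  and \<open>r\<close> real, and the quotient of the closed two-forms by it is \<open>H\<^sup>2\<^sub>b\<close> modulo the class of \<open>\<omega>\<close>.

  Project \<open>E\<close> to the second component. The image is the space \<open>K\<close> of closed \<open>c\<close> with \<open>c \<and> \<omega>\<close> exact, the
  kernel is the space of \<open>d\<^sup>b\<close>-closed two-forms. The subspace \<open>T\<close> projects onto the exact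
  one-forms, and meets the kernel in the image of \<open>S\<close>, because on a connected manifold \<open>dg = 0\<close> forces
  \<open>g\<close> to be constant (\<open>T_fst\<close>). So \<open>Def\<close> is an extension of \<open>ker L\<close>, which is \<open>K\<close> modulo exact forms,
  by the cokernel of \<open>S\<close>. If \<open>L\<close> is injective, the quotient term vanishes
  (\<open>Def_iso_injective\<close>); in general a linear splitting gives the direct sum (\<open>Def_iso_splitting\<close>).

  Vector fields being derivations and forms being \<open>C\<^sup>\<infinity>\<close>-multilinear maps, the geometric
  input has to be recovered from the algebra. Bump functions make derivations local, and Hadamard's lemma
  shows that they are combinations of partial derivatives (\<open>frame_exists\<close>). From local frames follow
  that forms depend on vector fields pointwise (\<open>tensorial\<close>), that functions killed by all vector fields are
  constant (\<open>VF_zero_imp_constant\<close>), and that the pointwise inverse of a nondegenerate form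
  is smooth.
\<close>

section \<open>Smooth functions on Euclidean space\<close>

lemma Ck_on_cong:
  assumes "open S" and "\<And>x. x \<in> S \<Longrightarrow> f x = g x"
  shows "Ck_on k S f \<longleftrightarrow> Ck_on k S g"
  using assms(2)
proof (induction k arbitrary: f g)
  case 0
  then show ?case by (auto cong: continuous_on_cong)
next
  case (Suc k)
  have hd: "(f has_derivative D) (at x) \<longleftrightarrow> (g has_derivative D) (at x)" if "x \<in> S" for x D
    using has_derivative_transform_within_open[OF _ assms(1) that] Suc.prems by metis
  then have fd: "frechet_derivative f (at x) = frechet_derivative g (at x)" if "x \<in> S" for x
    using that by (simp add: frechet_derivative_def)
  have "Ck_on k S (\<lambda>x. frechet_derivative f (at x) v)
      \<longleftrightarrow> Ck_on k S (\<lambda>x. frechet_derivative g (at x) v)" for v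
    by (rule Suc.IH) (simp add: fd)
  then show ?case using hd by (auto simp: differentiable_def)
qed

text \<open>
  The derivatives of order one are best exhibited by an explicit formula \<open>D\<close>; uniqueness of
  the derivative then identifies it with \<open>frechet_derivative\<close>.
\<close>

lemma Ck_on_SucI:
  assumes "open S" and D: "\<And>x. x \<in> S \<Longrightarrow> (f has_derivative D x) (at x)"
    and "\<And>v. Ck_on k S (\<lambda>x. D x v)"
  shows "Ck_on (Suc k) S f"
proof -
  have "Ck_on k S (\<lambda>x. frechet_derivative f (at x) v) \<longleftrightarrow> Ck_on k S (\<lambda>x. D x v)" for v
    by (rule Ck_on_cong[OF assms(1)]) (simp add: frechet_derivative_at[OF D, symmetric])
  then show ?thesis using assms by (auto simp: differentiable_def)
qed

lemma Ck_on_SucD: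
  assumes "Ck_on (Suc k) S f"
  shows "x \<in> S \<Longrightarrow> (f has_derivative frechet_derivative f (at x)) (at x)"
    and "Ck_on k S (\<lambda>x. frechet_derivative f (at x) v)"
  using assms by (auto simp: frechet_derivative_works)

lemma Ck_on_lower: "Ck_on (Suc k) S f \<Longrightarrow> Ck_on k S f"
proof (induction k arbitrary: f)
  case 0
  then show ?case
    by (auto intro!: continuous_at_imp_continuous_on differentiable_imp_continuous_within)
next
  case (Suc k)
  from Suc.prems have "f differentiable (at x)" if "x \<in> S" for x using that by simp
  moreover have "Ck_on k S (\<lambda>x. frechet_derivative f (at x) v)" for v
    by (rule Suc.IH) (use Suc.prems in auto)
  ultimately show ?case by simp
qed

lemma Ck_on_subset: "Ck_on k S f \<Longrightarrow> T \<subseteq> S \<Longrightarrow> Ck_on k T f"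
  by (induction k arbitrary: f) (auto intro: continuous_on_subset)

text \<open>
  Continuity and differentiability at \<open>x\<close> depend on values near \<open>x\<close> only. This locality
  is what makes smoothness on a manifold checkable in one chart per point.
\<close>

lemma Ck_on_local:
  assumes "\<And>x. x \<in> S \<Longrightarrow> \<exists>T. open T \<and> x \<in> T \<and> Ck_on k T f"
  shows "Ck_on k S f"
  using assms
proof (induction k arbitrary: f)
  case 0
  show ?case
    unfolding Ck_on.simps
  proof (rule continuous_at_imp_continuous_on, rule ballI)
    fix x assume "x \<in> S"
    with 0 obtain T where "open T" "x \<in> T" "continuous_on T f" by auto
    then show "isCont f x" using continuous_on_eq_continuous_at by blast
  qed
next
  case (Suc k)
  have "f differentiable (at x)" if "x \<in> S" for x using Suc.prems[OF that] by auto
  moreover have "Ck_on k S (\<lambda>x. frechet_derivative f (at x) v)" for v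
    by (rule Suc.IH) (use Suc.prems in fastforce)
  ultimately show ?case by simp
qed

lemma Ck_on_const: "open S \<Longrightarrow> Ck_on k S (\<lambda>x. c)"
proof (induction k arbitrary: c)
  case (Suc k)
  show ?case by (rule Ck_on_SucI[where D = "\<lambda>_ _. 0"]) (use Suc in auto)
qed auto

lemma Ck_on_add:
  assumes "open S"
  shows "Ck_on k S f \<Longrightarrow> Ck_on k S g \<Longrightarrow> Ck_on k S (\<lambda>x. f x + g x)"
proof (induction k arbitrary: f g)
  case 0
  then show ?case by (auto intro: continuous_intros)
next
  case (Suc k)
  note f = Ck_on_SucD[OF Suc.prems(1)] and g = Ck_on_SucD[OF Suc.prems(2)]
  show ?case
    by (rule Ck_on_SucI[OF assms has_derivative_add[OF f(1) g(1)]]) (auto intro: Suc.IH f(2) g(2))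
qed

lemma Ck_on_linear:
  assumes "open S" and "bounded_linear T"
  shows "Ck_on k S f \<Longrightarrow> Ck_on k S (\<lambda>x. T (f x))"
proof (induction k arbitrary: f)
  case 0
  then show ?case by (auto intro: linear_continuous_on_compose bounded_linear.continuous_on assms(2))
next
  case (Suc k)
  note f = Ck_on_SucD[OF Suc.prems(1)]
  show ?case
    by (rule Ck_on_SucI[OF assms(1) bounded_linear.has_derivative[OF assms(2) f(1)]])
      (auto intro: Suc.IH f(2))
qed

lemma Ck_on_scaleR:
  fixes a :: "'e::euclidean_space \<Rightarrow> real"
  assumes "open S"
  shows "Ck_on k S a \<Longrightarrow> Ck_on k S f \<Longrightarrow> Ck_on k S (\<lambda>x. a x *\<^sub>R f x)"
proof (induction k arbitrary: a f)
  case 0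
  then show ?case by (auto intro: continuous_intros)
next
  case (Suc k)
  note a = Ck_on_SucD[OF Suc.prems(1)] and f = Ck_on_SucD[OF Suc.prems(2)]
  show ?case
    by (rule Ck_on_SucI[OF assms has_derivative_scaleR[OF a(1) f(1)]])
      (auto intro!: Ck_on_add[OF assms] Suc.IH f(2) a(2) Ck_on_lower[OF Suc.prems(1)] Ck_on_lower[OF Suc.prems(2)])
qed

lemma Ck_on_sum:
  assumes "open S" and "\<And>i. i \<in> I \<Longrightarrow> Ck_on k S (f i)"
  shows "Ck_on k S (\<lambda>x. \<Sum>i\<in>I. f i x)"
  using assms(2)
  by (induction I rule: infinite_finite_induct) (auto intro: Ck_on_const Ck_on_add assms(1))

text \<open>
  Induction on \<open>k\<close> needs the chain rule in a form that only mentions directional derivatives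
  of \<open>f\<close> in fixed directions: expanding \<open>Dg(x)v\<close> in the basis turns the derivative of \<open>f \<circ> g\<close>
  into a sum of products of \<open>C\<^sup>k\<close> functions with compositions \<open>(\<partial>\<^sub>b f) \<circ> g\<close>, to which the
  induction hypothesis applies.
\<close>

lemma Ck_on_compose:
  fixes g :: "'e::euclidean_space \<Rightarrow> 'f::euclidean_space"
    and f :: "'f \<Rightarrow> 'b::real_normed_vector"
  assumes S: "open S" and gS: "g ` S \<subseteq> T"
  shows "Ck_on k S g \<Longrightarrow> Ck_on k T f \<Longrightarrow> Ck_on k S (\<lambda>x. f (g x))"
proof (induction k arbitrary: f)
  case 0
  then show ?case using gS by (auto intro: continuous_on_compose2)
next
  case (Suc k)
  note g = Ck_on_SucD[OF Suc.prems(1)] and f = Ck_on_SucD[OF Suc.prems(2)]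
  let ?D = "\<lambda>x v. frechet_derivative f (at (g x)) (frechet_derivative g (at x) v)"
  have D: "((\<lambda>x. f (g x)) has_derivative ?D x) (at x)" if "x \<in> S" for x
    using has_derivative_compose[OF g(1)[OF that] f(1)] that gS by auto
  have eq: "?D x v = (\<Sum>b\<in>Basis. (frechet_derivative g (at x) v \<bullet> b) *\<^sub>R
              frechet_derivative f (at (g x)) b)" if "x \<in> S" for x v
  proof -
    have "linear (frechet_derivative f (at (g x)))"
      using f(1)[of "g x"] that gS by (auto intro: has_derivative_linear)
    then have "frechet_derivative f (at (g x)) (\<Sum>b\<in>Basis. (frechet_derivative g (at x) v \<bullet> b) *\<^sub>R b)
        = (\<Sum>b\<in>Basis. (frechet_derivative g (at x) v \<bullet> b) *\<^sub>R frechet_derivative f (at (g x)) b)"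
      by (simp add: linear_sum linear_cmul)
    then show ?thesis by (simp add: euclidean_representation)
  qed
  have "Ck_on k S (\<lambda>x. ?D x v)" for v
    by (subst Ck_on_cong[OF S eq], assumption)
      (intro Ck_on_sum Ck_on_scaleR S Ck_on_linear[OF S bounded_linear_inner_left] g(2) Suc.IH f(2)
        Ck_on_lower[OF Suc.prems(1)])
  from Ck_on_SucI[OF S D this] show ?case .
qed

lemma Ck_on_id: "open S \<Longrightarrow> Ck_on k S (\<lambda>x. x)"
proof (cases k)
  case (Suc n)
  assume "open S"
  then show ?thesis
    unfolding Suc by (intro Ck_on_SucI[where D = "\<lambda>_ v. v"] Ck_on_const has_derivative_ident)
qed (auto intro: continuous_intros)

lemma Ck_on_inverse: "Ck_on k (- {0}) (inverse :: real \<Rightarrow> real)"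
proof (induction k)
  case 0
  then show ?case by (auto intro!: continuous_intros)
next
  case (Suc k)
  have o: "open (- {0::real})" by auto
  show ?case
  proof (rule Ck_on_SucI[OF o, where D = "\<lambda>x v. - v *\<^sub>R (inverse x *\<^sub>R inverse x)"])
    show "(inverse has_derivative (\<lambda>v. - v *\<^sub>R (inverse x *\<^sub>R inverse x))) (at x)" if "x \<in> - {0}" for x :: real
      using has_derivative_inverse'[of x UNIV] that by (simp add: algebra_simps)
  next
    show "Ck_on k (- {0}) (\<lambda>x::real. - v *\<^sub>R (inverse x *\<^sub>R inverse x))" for v
      by (intro Ck_on_scaleR[OF o] Ck_on_const[OF o] Suc)
  qed
qed

lemma smooth_on_cong:
  "open S \<Longrightarrow> (\<And>x. x \<in> S \<Longrightarrow> f x = g x) \<Longrightarrow> smooth_on S f \<longleftrightarrow> smooth_on S g"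
  by (simp add: smooth_on_def Ck_on_cong[of S f g])

lemma smooth_on_subset: "smooth_on S f \<Longrightarrow> T \<subseteq> S \<Longrightarrow> smooth_on T f"
  by (auto simp: smooth_on_def intro: Ck_on_subset)

lemma smooth_on_local:
  "(\<And>x. x \<in> S \<Longrightarrow> \<exists>T. open T \<and> x \<in> T \<and> smooth_on T f) \<Longrightarrow> smooth_on S f"
  unfolding smooth_on_def by (intro allI Ck_on_local) blast

lemma smooth_on_const: "open S \<Longrightarrow> smooth_on S (\<lambda>x. c)"
  unfolding smooth_on_def by (intro allI Ck_on_const)

lemma smooth_on_add:
  "open S \<Longrightarrow> smooth_on S f \<Longrightarrow> smooth_on S g \<Longrightarrow> smooth_on S (\<lambda>x. f x + g x)"
  unfolding smooth_on_def by (intro allI Ck_on_add) auto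

lemma smooth_on_linear:
  "open S \<Longrightarrow> bounded_linear T \<Longrightarrow> smooth_on S f \<Longrightarrow> smooth_on S (\<lambda>x. T (f x))"
  using Ck_on_linear[of S T _ f] by (simp add: smooth_on_def)

lemma smooth_on_mult:
  fixes f g :: "'e::euclidean_space \<Rightarrow> real"
  shows "open S \<Longrightarrow> smooth_on S f \<Longrightarrow> smooth_on S g \<Longrightarrow> smooth_on S (\<lambda>x. f x * g x)"
  using Ck_on_scaleR[of S _ f g] by (simp add: smooth_on_def)

lemma smooth_on_compose:
  fixes g :: "'e::euclidean_space \<Rightarrow> 'f::euclidean_space"
  shows "open S \<Longrightarrow> g ` S \<subseteq> T \<Longrightarrow> smooth_on S g \<Longrightarrow> smooth_on T f \<Longrightarrow> smooth_on S (\<lambda>x. f (g x))"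
  using Ck_on_compose[of S g T _ f] by (simp add: smooth_on_def)

lemma smooth_on_id: "open S \<Longrightarrow> smooth_on S (\<lambda>x. x)"
  unfolding smooth_on_def by (intro allI Ck_on_id)

lemma smooth_on_divide:
  fixes f g :: "'e::euclidean_space \<Rightarrow> real"
  assumes "open S" "smooth_on S f" "smooth_on S g" "\<And>x. x \<in> S \<Longrightarrow> g x \<noteq> 0"
  shows "smooth_on S (\<lambda>x. f x / g x)"
proof -
  have "smooth_on (- {0}) (inverse :: real \<Rightarrow> real)"
    unfolding smooth_on_def by (intro allI Ck_on_inverse)
  then have "smooth_on S (\<lambda>x. inverse (g x))"
    by (rule smooth_on_compose[rotated 3]) (use assms in auto)
  then show ?thesis
    unfolding divide_inverse by (rule smooth_on_mult[OF assms(1,2)])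
qed

lemma smooth_on_frechet_derivative:
  "smooth_on S f \<Longrightarrow> smooth_on S (\<lambda>x. frechet_derivative f (at x) v)"
  by (auto simp: smooth_on_def intro: Ck_on_SucD(2))

lemma smooth_on_has_derivative:
  "smooth_on S f \<Longrightarrow> x \<in> S \<Longrightarrow> (f has_derivative frechet_derivative f (at x)) (at x)"
  by (auto simp: smooth_on_def intro: Ck_on_SucD(1)[of 0])

lemma smooth_on_continuous_on: "smooth_on S f \<Longrightarrow> continuous_on S f"
  using Ck_on.simps(1)[of S f] by (auto simp: smooth_on_def)

section \<open>Bump functions and Hadamard's lemma\<close>

text \<open>
  The functions \<open>t\<^sup>-\<^sup>n exp(-1/t)\<close>, extended by zero to \<open>t \<le> 0\<close>. The family in \<open>n\<close> is
  needed because its span is closed under differentiation, so that smoothness at the origin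
  follows by induction from the single limit \<open>t\<^sup>-\<^sup>n exp(-1/t) \<rightarrow> 0\<close>.
\<close>

definition flat_exp :: "nat \<Rightarrow> real \<Rightarrow> real" where
  "flat_exp n t = (if t > 0 then inverse t ^ n * exp (- inverse t) else 0)"

lemma flat_exp_tendsto_0: "(flat_exp n \<longlongrightarrow> 0) (at_right 0)"
proof -
  have "((\<lambda>t. inverse t ^ n / exp (inverse t)) \<longlongrightarrow> (0::real)) (at_right 0)"
    by (rule filterlim_compose[OF tendsto_power_div_exp_0 filterlim_inverse_at_top_right])
  moreover have "eventually (\<lambda>t. inverse t ^ n / exp (inverse t) = flat_exp n t) (at_right 0)"
    by (auto simp: eventually_at_right_less flat_exp_def exp_minus divide_inverse
        intro!: eventually_mono[OF eventually_at_right_less])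
  ultimately show ?thesis by (rule Lim_transform_eventually)
qed

lemma flat_exp_has_derivative:
  "(flat_exp n has_field_derivative flat_exp (n + 2) t - real n * flat_exp (n + 1) t) (at t)"
proof (cases t "0::real" rule: linorder_cases)
  case less
  have "((\<lambda>_. 0) has_field_derivative 0) (at t)" by simp
  then have "(flat_exp n has_field_derivative 0) (at t)"
    by (rule has_field_derivative_transform_within_open[where S = "{..<0}"])
      (use less in \<open>auto simp: flat_exp_def\<close>)
  then show ?thesis using less by (simp add: flat_exp_def)
next
  case greater
  have "((\<lambda>t. inverse t ^ n * exp (- inverse t)) has_field_derivative
      flat_exp (n + 2) t - real n * flat_exp (n + 1) t) (at t)"
    using greater
    by (cases n)
      (auto intro!: derivative_eq_intros simp: flat_exp_def field_simps power2_eq_square,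
        metis Suc_pred gr0I power_Suc)
  then show ?thesis
    by (rule has_field_derivative_transform_within_open[where S = "{0<..}"])
      (use greater in \<open>auto simp: flat_exp_def\<close>)
next
  case equal
  have "((\<lambda>y. (flat_exp n y - flat_exp n 0) / (y - 0)) \<longlongrightarrow> 0) (at 0)"
  proof (rule filterlim_split_at)
    have "eventually (\<lambda>y::real. y < 0) (at_left 0)" by (simp add: eventually_at_filter)
    then show "((\<lambda>y. (flat_exp n y - flat_exp n 0) / (y - 0)) \<longlongrightarrow> 0) (at_left 0)"
      by (intro tendsto_eventually) (auto elim!: eventually_mono simp: flat_exp_def)
    show "((\<lambda>y. (flat_exp n y - flat_exp n 0) / (y - 0)) \<longlongrightarrow> 0) (at_right 0)"
      by (rule Lim_transform_eventually[OF flat_exp_tendsto_0[of "Suc n"]])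
        (auto simp: flat_exp_def field_simps intro!: eventually_mono[OF eventually_at_right_less])
  qed
  then show ?thesis using equal by (simp add: has_field_derivative_iff flat_exp_def)
qed

lemma Ck_on_flat_exp: "Ck_on k UNIV (flat_exp n)"
proof (induction k arbitrary: n)
  case 0
  then show ?case
    using DERIV_continuous[OF flat_exp_has_derivative]
    by (auto simp: continuous_on_eq_continuous_within)
next
  case (Suc k)
  show ?case
  proof (rule Ck_on_SucI)
    show "(flat_exp n has_derivative
        (\<lambda>v. (flat_exp (n + 2) t + (- real n) *\<^sub>R flat_exp (n + 1) t) *\<^sub>R v)) (at t)" for t
      using flat_exp_has_derivative[of n t] by (simp add: has_field_derivative_def)
    show "Ck_on k UNIV (\<lambda>t. (flat_exp (n + 2) t + (- real n) *\<^sub>R flat_exp (n + 1) t) *\<^sub>R v)" for v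
      by (rule Ck_on_scaleR Ck_on_add Ck_on_const open_UNIV Suc)+
  qed auto
qed

lemma flat_exp_pos: "flat_exp n t > 0 \<longleftrightarrow> t > 0"
  by (simp add: flat_exp_def)

lemma flat_exp_nonneg: "flat_exp n t \<ge> 0"
  by (simp add: flat_exp_def)

lemma smooth_on_norm_squared:
  fixes y :: "'e::euclidean_space"
  shows "smooth_on UNIV (\<lambda>x. (norm (x - y))\<^sup>2)"
proof -
  have c: "smooth_on UNIV (\<lambda>x. (x + (- y)) \<bullet> b)" for b :: 'e
    by (rule smooth_on_linear[OF open_UNIV bounded_linear_inner_left])
      (rule smooth_on_add smooth_on_id smooth_on_const open_UNIV)+
  have "Ck_on k UNIV (\<lambda>x. \<Sum>b\<in>Basis. ((x + (- y)) \<bullet> b) * ((x + (- y)) \<bullet> b))" for k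
    by (rule Ck_on_sum[OF open_UNIV])
      (use smooth_on_mult[OF open_UNIV c c] in \<open>simp add: smooth_on_def\<close>)
  moreover have "(norm (x - y))\<^sup>2 = (\<Sum>b\<in>Basis. ((x + (- y)) \<bullet> b) * ((x + (- y)) \<bullet> b))" for x
    unfolding power2_norm_eq_inner by (subst euclidean_inner) simp
  ultimately show ?thesis by (simp add: smooth_on_def)
qed

text \<open>
  With \<open>e(t) = exp(-1/t)\<close> for positive \<open>t\<close> and zero otherwise, \<open>e(t) / (e(t) + e(1 - t))\<close> is a smooth
  step from \<open>0\<close> (for \<open>t \<le> 0\<close>) to \<open>1\<close> (for \<open>t \<ge> 1\<close>); it is evaluated at an affine function of
  the squared distance from \<open>y\<close>.
\<close>

lemma smooth_bump:
  fixes y :: "'e::euclidean_space"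
  assumes "r > 0"
  obtains \<beta> :: "'e \<Rightarrow> real"
  where "smooth_on UNIV \<beta>" and "\<forall>x\<in>ball y (r / 2). \<beta> x = 1"
    and "\<forall>x. x \<notin> ball y r \<longrightarrow> \<beta> x = 0"
proof -
  define a where "a = (\<lambda>x. 2 + (- 2 / r\<^sup>2) * (norm (x - y))\<^sup>2)"
  let ?e = "flat_exp 0"
  have a: "smooth_on UNIV a"
    unfolding a_def
    by (rule smooth_on_add smooth_on_mult smooth_on_const smooth_on_norm_squared open_UNIV)+
  have a': "smooth_on UNIV (\<lambda>x. 1 + (- 1) * a x)"
    by (rule smooth_on_add smooth_on_mult smooth_on_const a open_UNIV)+
  have e: "smooth_on UNIV ?e" by (simp add: smooth_on_def Ck_on_flat_exp)
  have ea: "smooth_on UNIV (\<lambda>x. ?e (a x))"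
    by (rule smooth_on_compose[OF open_UNIV _ a e]) simp
  have ea': "smooth_on UNIV (\<lambda>x. ?e (1 + (- 1) * a x))"
    by (rule smooth_on_compose[OF open_UNIV _ a' e]) simp
  define \<beta> where "\<beta> = (\<lambda>x. ?e (a x) / (?e (a x) + ?e (1 + (- 1) * a x)))"
  have pos: "?e (a x) + ?e (1 + (- 1) * a x) > 0" for x
    using flat_exp_pos[of 0 "a x"] flat_exp_pos[of 0 "1 + (- 1) * a x"]
      flat_exp_nonneg[of 0 "a x"] flat_exp_nonneg[of 0 "1 + (- 1) * a x"]
    by (cases "a x > 0") (auto intro: add_pos_nonneg add_nonneg_pos)
  have "smooth_on UNIV \<beta>"
    unfolding \<beta>_def
    by (rule smooth_on_divide[OF open_UNIV ea smooth_on_add[OF open_UNIV ea ea']])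
      (use pos in \<open>metis less_irrefl\<close>)
  moreover have "\<beta> x = 1" if "x \<in> ball y (r / 2)" for x
  proof -
    have "(norm (x - y))\<^sup>2 \<le> (r / 2)\<^sup>2"
      using that by (intro power_mono) (auto simp: dist_norm norm_minus_commute)
    then have "2 * (norm (x - y))\<^sup>2 \<le> r\<^sup>2"
      by (simp add: power2_eq_square) (use zero_le_square[of r] in linarith)
    then have "a x \<ge> 1" using assms by (simp add: a_def field_simps)
    then have "?e (1 + (- 1) * a x) = 0" by (simp add: flat_exp_def)
    with pos[of x] show ?thesis by (simp add: \<beta>_def)
  qed
  moreover have "\<beta> x = 0" if "x \<notin> ball y r" for x
  proof -
    have "r\<^sup>2 \<le> (norm (x - y))\<^sup>2"
      using that assms by (intro power_mono) (auto simp: dist_norm norm_minus_commute)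
    then have "a x \<le> 0" using assms by (simp add: a_def field_simps)
    then have "?e (a x) = 0" by (simp add: flat_exp_def)
    then show ?thesis by (simp add: \<beta>_def)
  qed
  ultimately show ?thesis using that by blast
qed

lemma Ck_on_continuous: "Ck_on k S f \<Longrightarrow> continuous_on S f"
  by (induction k) (auto intro: Ck_on_lower simp del: Ck_on.simps(2))

lemma segment_in_ball:
  fixes y0 :: "'e::euclidean_space"
  assumes "y \<in> ball y0 r" "t \<in> cbox 0 (1::real)"
  shows "y0 + t *\<^sub>R (y - y0) \<in> ball y0 r"
proof -
  have "norm (t *\<^sub>R (y - y0)) \<le> norm (y - y0)"
    using assms(2) by (auto simp: mult_left_le_one_le)
  then show ?thesis using assms(1) by (auto simp: dist_norm norm_minus_commute)
qed

lemma continuous_on_segment: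
  fixes y0 :: "'e::euclidean_space"
  assumes "continuous_on (ball y0 r) h"
  shows "continuous_on (ball y0 r \<times> cbox 0 (1::real)) (\<lambda>p. h (y0 + snd p *\<^sub>R (fst p - y0)))"
proof (rule continuous_on_compose2[OF assms])
  show "continuous_on (ball y0 r \<times> cbox 0 (1::real)) (\<lambda>p. y0 + snd p *\<^sub>R (fst p - y0))"
    by (intro continuous_intros)
  show "(\<lambda>p. y0 + snd p *\<^sub>R (fst p - y0)) ` (ball y0 r \<times> cbox 0 (1::real)) \<subseteq> ball y0 r"
    using segment_in_ball by (force simp del: mem_ball)
qed

text \<open>
  Differentiating under the integral sign sends the weight \<open>t\<^sup>m\<close> to \<open>t\<^sup>m\<^sup>+\<^sup>1\<close> and \<open>h\<close> to one of its
  directional derivatives. The weight is present only so that the induction on \<open>k\<close> closes.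
\<close>

lemma Ck_on_radial_average:
  fixes y0 :: "'e::euclidean_space" and h :: "'e \<Rightarrow> real"
  shows "Ck_on k (ball y0 r) h \<Longrightarrow>
    Ck_on k (ball y0 r) (\<lambda>y. integral (cbox 0 1) (\<lambda>t. t ^ m * h (y0 + t *\<^sub>R (y - y0))))"
proof (induction k arbitrary: h m)
  case 0
  have "continuous_on (ball y0 r \<times> cbox 0 1)
      (\<lambda>(y, t). t ^ m * h (y0 + t *\<^sub>R (y - y0)))"
    unfolding split_beta
    by (intro continuous_on_mult continuous_on_power continuous_on_snd continuous_on_id
        continuous_on_segment Ck_on_continuous[OF 0])
  from integral_continuous_on_param[OF this] show ?case by simp
next
  case (Suc k)
  note h = Ck_on_SucD[OF Suc.prems]
  let ?c = "\<lambda>y t::real. y0 + t *\<^sub>R (y - y0)"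
  let ?D = "\<lambda>y. frechet_derivative h (at y)"
  define fx where "fx y t = Blinfun (\<lambda>v. t ^ m * ?D (?c y t) (t *\<^sub>R v))" for y t
  have der: "((\<lambda>y. t ^ m * h (?c y t)) has_derivative (\<lambda>v. t ^ m * ?D (?c y t) (t *\<^sub>R v))) (at y)"
    if "y \<in> ball y0 r" "t \<in> cbox 0 1" for y t
  proof -
    have "((\<lambda>y. ?c y t) has_derivative (\<lambda>v. t *\<^sub>R v)) (at y)"
      by (auto intro!: derivative_eq_intros)
    from has_derivative_compose[OF this h(1)[OF segment_in_ball[OF that]]]
    show ?thesis by (rule has_derivative_mult_right)
  qed
  have fx: "blinfun_apply (fx y t) = (\<lambda>v. t ^ m * ?D (?c y t) (t *\<^sub>R v))"
    if "y \<in> ball y0 r" "t \<in> cbox 0 1" for y t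
    unfolding fx_def by (rule bounded_linear_Blinfun_apply[OF has_derivative_bounded_linear[OF der[OF that]]])
  have fx': "blinfun_apply (fx y t) v = t ^ Suc m * ?D (?c y t) v"
    if "y \<in> ball y0 r" "t \<in> cbox 0 1" for y t v
  proof -
    have "?D (?c y t) (t *\<^sub>R v) = t *\<^sub>R ?D (?c y t) v"
      using has_derivative_linear[OF h(1)[OF segment_in_ball[OF that]]] by (rule linear_cmul)
    then show ?thesis using fx[OF that] by simp
  qed
  have cD: "continuous_on (ball y0 r) (\<lambda>y. ?D y v)" for v
    using Ck_on_continuous[OF h(2)] .
  have cfx: "continuous_on (ball y0 r \<times> cbox 0 1) (\<lambda>(y, t). fx y t)"
  proof (rule continuous_on_blinfun_componentwise)
    fix b :: 'e
    have "continuous_on (ball y0 r \<times> cbox 0 1) (\<lambda>(y, t). t ^ Suc m * ?D (?c y t) b)"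
      unfolding split_beta
      by (intro continuous_on_mult continuous_on_power continuous_on_snd continuous_on_id
          continuous_on_segment cD)
    then show "continuous_on (ball y0 r \<times> cbox 0 1) (\<lambda>p. blinfun_apply (case p of (y, t) \<Rightarrow> fx y t) b)"
      by (rule continuous_on_eq) (auto simp: fx' simp del: mem_ball)
  qed
  have int: "(\<lambda>t. t ^ m * h (?c y t)) integrable_on cbox 0 1" if "y \<in> ball y0 r" for y
  proof (rule integrable_continuous)
    have "continuous_on (cbox 0 1) (\<lambda>t. h (?c y t))"
      by (rule continuous_on_compose2[OF Ck_on_continuous[OF Suc.prems]])
        (use segment_in_ball[OF that] in \<open>auto intro!: continuous_intros simp del: mem_ball\<close>)
    then show "continuous_on (cbox 0 1) (\<lambda>t. t ^ m * h (?c y t))"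
      by (intro continuous_on_mult continuous_on_power continuous_on_id)
  qed
  show ?case
  proof (rule Ck_on_SucI)
    fix y assume y: "y \<in> ball y0 r"
    have "((\<lambda>y. integral (cbox 0 1) (\<lambda>t. t ^ m * h (?c y t))) has_derivative
        blinfun_apply (integral (cbox 0 1) (fx y))) (at y within ball y0 r)"
    proof (rule leibniz_rule[OF _ int cfx y convex_ball])
      show "((\<lambda>y. t ^ m * h (?c y t)) has_derivative blinfun_apply (fx y t)) (at y within ball y0 r)"
        if "y \<in> ball y0 r" "t \<in> cbox 0 1" for y t
        using has_derivative_at_withinI[OF der[OF that]] fx[OF that] by simp
    qed
    moreover have "blinfun_apply (integral (cbox 0 1) (fx y)) =
        (\<lambda>v. integral (cbox 0 1) (\<lambda>t. t ^ Suc m * ?D (?c y t) v))"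
    proof
      fix v
      have "continuous_on (cbox 0 1) (\<lambda>t::real. (y, t))"
        by (rule continuous_on_Pair[OF continuous_on_const continuous_on_id])
      from continuous_on_compose2[OF cfx this] y have "continuous_on (cbox 0 1) (fx y)"
        by (simp add: image_subset_iff)
      then have "blinfun_apply (integral (cbox 0 1) (fx y)) v
          = integral (cbox 0 1) (\<lambda>t. blinfun_apply (fx y t) v)"
        by (intro blinfun_apply_integral integrable_continuous)
      also have "\<dots> = integral (cbox 0 1) (\<lambda>t. t ^ Suc m * ?D (?c y t) v)"
        by (rule integral_cong) (use fx' y in blast)
      finally show "blinfun_apply (integral (cbox 0 1) (fx y)) v
          = integral (cbox 0 1) (\<lambda>t. t ^ Suc m * ?D (?c y t) v)" .
    qed
    ultimately show "((\<lambda>y. integral (cbox 0 1) (\<lambda>t. t ^ m * h (?c y t))) has_derivative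
        (\<lambda>v. integral (cbox 0 1) (\<lambda>t. t ^ Suc m * ?D (?c y t) v))) (at y)"
      using y at_within_open[OF y open_ball] by simp
  next
    show "Ck_on k (ball y0 r) (\<lambda>y. integral (cbox 0 1) (\<lambda>t. t ^ Suc m * ?D (?c y t) v))" for v
      by (rule Suc.IH[OF h(2)])
  qed auto
qed

text \<open>
  Integrating the derivative of \<open>F\<close> along the segment from \<open>y0\<close> to \<open>y\<close> gives the coefficients
  as radial averages of partial derivatives. The point is that they are smooth, so that
  derivations can be applied to the resulting products.
\<close>

lemma hadamard:
  fixes y0 :: "'e::euclidean_space" and F :: "'e \<Rightarrow> real"
  assumes "smooth_on (ball y0 r) F"
  obtains G where "\<And>b. smooth_on (ball y0 r) (G b)"
    and "\<And>y. y \<in> ball y0 r \<Longrightarrow> F y = F y0 + (\<Sum>b\<in>Basis. ((y - y0) \<bullet> b) * G b y)"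
proof -
  let ?D = "\<lambda>y. frechet_derivative F (at y)"
  define G where "G b y = integral (cbox 0 1) (\<lambda>t. t ^ 0 * ?D (y0 + t *\<^sub>R (y - y0)) b)" for b y
  have "smooth_on (ball y0 r) (G b)" for b
    using smooth_on_frechet_derivative[OF assms, of b] Ck_on_radial_average
    unfolding smooth_on_def G_def by blast
  moreover have "F y = F y0 + (\<Sum>b\<in>Basis. ((y - y0) \<bullet> b) * G b y)" if y: "y \<in> ball y0 r" for y
  proof -
    let ?c = "\<lambda>t::real. y0 + t *\<^sub>R (y - y0)"
    have cb: "?c t \<in> ball y0 r" if "t \<in> cbox 0 1" for t
      by (rule segment_in_ball[OF y that])
    have lin: "?D (?c t) (y - y0) = (\<Sum>b\<in>Basis. ((y - y0) \<bullet> b) * (t ^ 0 * ?D (?c t) b))"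
      if "t \<in> cbox 0 1" for t
    proof -
      have "linear (?D (?c t))"
        using has_derivative_linear[OF smooth_on_has_derivative[OF assms cb[OF that]]] .
      then have "?D (?c t) (\<Sum>b\<in>Basis. ((y - y0) \<bullet> b) *\<^sub>R b)
          = (\<Sum>b\<in>Basis. ((y - y0) \<bullet> b) *\<^sub>R ?D (?c t) b)"
        by (simp add: linear_sum linear_cmul)
      then show ?thesis by (simp add: euclidean_representation)
    qed
    have "((\<lambda>t. ?D (?c t) (y - y0)) has_integral F (?c 1) - F (?c 0)) {0..1}"
    proof (rule fundamental_theorem_of_calculus)
      fix t :: real assume t: "t \<in> {0..1}"
      have "(?c has_derivative (\<lambda>s. s *\<^sub>R (y - y0))) (at t)"
        by (auto intro!: derivative_eq_intros)
      from has_derivative_compose[OF this smooth_on_has_derivative[OF assms cb]] t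
      have D: "((\<lambda>t. F (?c t)) has_derivative (\<lambda>s. ?D (?c t) (s *\<^sub>R (y - y0)))) (at t)" by simp
      have "linear (?D (?c t))"
        using has_derivative_linear[OF smooth_on_has_derivative[OF assms cb]] t by simp
      then show "((\<lambda>t. F (?c t)) has_vector_derivative ?D (?c t) (y - y0)) (at t within {0..1})"
        using has_derivative_at_withinI[OF D] by (simp add: has_vector_derivative_def linear_cmul)
    qed simp
    then have "F y - F y0 = integral (cbox 0 1) (\<lambda>t. ?D (?c t) (y - y0))"
      by (simp add: integral_unique)
    also have "\<dots> = integral (cbox 0 1)
        (\<lambda>t. \<Sum>b\<in>Basis. ((y - y0) \<bullet> b) * (t ^ 0 * ?D (?c t) b))"
      by (rule integral_cong) (rule lin)
    also have "\<dots> = (\<Sum>b\<in>Basis. integral (cbox 0 1) (\<lambda>t. ((y - y0) \<bullet> b) * (t ^ 0 * ?D (?c t) b)))"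
    proof (rule integral_sum)
      fix b :: 'e
      show "(\<lambda>t. ((y - y0) \<bullet> b) * (t ^ 0 * ?D (?c t) b)) integrable_on cbox 0 1"
      proof (rule integrable_continuous)
        have "continuous_on (cbox 0 1) (\<lambda>t. ?D (?c t) b)"
          by (rule continuous_on_compose2[OF
                smooth_on_continuous_on[OF smooth_on_frechet_derivative[OF assms, of b]]])
            (use cb in \<open>auto intro!: continuous_intros simp del: mem_ball\<close>)
        then show "continuous_on (cbox 0 1) (\<lambda>t. ((y - y0) \<bullet> b) * (t ^ 0 * ?D (?c t) b))"
          by (intro continuous_on_mult continuous_on_power continuous_on_id continuous_on_const)
      qed
    qed simp
    also have "\<dots> = (\<Sum>b\<in>Basis. ((y - y0) \<bullet> b) * G b y)"
      unfolding G_def by simp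
    finally show ?thesis by simp
  qed
  ultimately show ?thesis using that by blast
qed

section \<open>Smooth functions on a manifold\<close>

lemma sum_fun_apply: "(\<Sum>i\<in>I. f i) x = (\<Sum>i\<in>I. f i x)"
  for f :: "'i \<Rightarrow> 'x \<Rightarrow> 'y::comm_monoid_add"
  by (induction I rule: infinite_finite_induct) auto

locale manifold =
  fixes A :: "('a::{t2_space,second_countable_topology}, 'e::euclidean_space) atlas"
  assumes atlas: "smooth_atlas A"
begin

abbreviation "SF \<equiv> smooth_functions A"
abbreviation "VF \<equiv> vector_fields A"

lemma chart_exists: obtains U \<phi> where "(U, \<phi>) \<in> A" "p \<in> U"
proof -
  have "(\<Union>(U, \<phi>)\<in>A. U) = UNIV" using atlas unfolding smooth_atlas_def by blast
  then have "p \<in> (\<Union>(U, \<phi>)\<in>A. U)" by simp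
  then show ?thesis using that by auto
qed

context
  fixes U \<phi> assumes chart: "(U, \<phi>) \<in> A"
begin

lemma chart_open: "open U" and chart_image_open: "open (\<phi> ` U)"
  and chart_homeo: "homeomorphism U (\<phi> ` U) \<phi> (inv_into U \<phi>)"
  using atlas chart unfolding smooth_atlas_def by blast+

lemma chart_inv [simp]: "x \<in> U \<Longrightarrow> inv_into U \<phi> (\<phi> x) = x"
  using chart_homeo by (simp add: homeomorphism_def)

lemma chart_image_sub: "N \<subseteq> U \<Longrightarrow> open N \<Longrightarrow> open (\<phi> ` N)"
  using homeomorphism_imp_open_map[OF chart_homeo, of N] chart_image_open
  by (auto simp: openin_open_eq chart_open)

lemma chart_preimage_open:
  assumes "open N" "N \<subseteq> U" "open B"
  shows "open {x \<in> N. \<phi> x \<in> B}"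
proof -
  have "continuous_on N \<phi>"
    using chart_homeo assms(2) by (auto simp: homeomorphism_def intro: continuous_on_subset)
  then have "open (\<phi> -` B \<inter> N)"
    using continuous_on_open_vimage[OF assms(1)] assms(3) by blast
  moreover have "\<phi> -` B \<inter> N = {x \<in> N. \<phi> x \<in> B}" by auto
  ultimately show ?thesis by simp
qed

lemma SF_chart: "f \<in> SF \<Longrightarrow> smooth_on (\<phi> ` U) (\<lambda>y. f (inv_into U \<phi> y))"
  using chart by (auto simp: smooth_functions_def o_def)

end

lemma SF_I: "(\<And>U \<phi>. (U, \<phi>) \<in> A \<Longrightarrow> smooth_on (\<phi> ` U) (\<lambda>y. f (inv_into U \<phi> y))) \<Longrightarrow> f \<in> SF"
  by (auto simp: smooth_functions_def o_def)

text \<open>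
  Near a point of another chart \<open>(V, \<psi>)\<close>, the local expression of \<open>f\<close> is its expression in
  \<open>(U, \<phi>)\<close> composed with the smooth transition map.
\<close>

lemma SF_local:
  assumes "\<And>p. \<exists>(U, \<phi>)\<in>A. \<exists>N. open N \<and> p \<in> N \<and> N \<subseteq> U \<and> smooth_on (\<phi> ` N) (\<lambda>y. f (inv_into U \<phi> y))"
  shows "f \<in> SF"
proof (rule SF_I)
  fix V \<psi> assume V: "(V, \<psi>) \<in> A"
  show "smooth_on (\<psi> ` V) (\<lambda>y. f (inv_into V \<psi> y))"
  proof (rule smooth_on_local)
    fix y assume "y \<in> \<psi> ` V"
    then obtain p where p: "p \<in> V" "y = \<psi> p" by auto
    obtain U \<phi> N where U: "(U, \<phi>) \<in> A" and N: "open N" "p \<in> N" "N \<subseteq> U"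
      and s: "smooth_on (\<phi> ` N) (\<lambda>y. f (inv_into U \<phi> y))"
      using assms[of p] by blast
    define T where "T = \<psi> ` (N \<inter> V)"
    have T: "open T" unfolding T_def
      by (rule chart_image_sub[OF V]) (auto intro: N chart_open[OF V])
    have "smooth_on (\<psi> ` (V \<inter> U)) (\<phi> \<circ> inv_into V \<psi>)"
      using atlas U V unfolding smooth_atlas_def by fast
    then have tr: "smooth_on T (\<phi> \<circ> inv_into V \<psi>)"
      by (rule smooth_on_subset) (use N in \<open>auto simp: T_def\<close>)
    have "smooth_on T (\<lambda>y. f (inv_into U \<phi> ((\<phi> \<circ> inv_into V \<psi>) y)))"
      by (rule smooth_on_compose[OF T _ tr s]) (auto simp: T_def chart_inv[OF V])
    then have "smooth_on T (\<lambda>y. f (inv_into V \<psi> y))"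
      by (subst smooth_on_cong[OF T]) (use N(3) in \<open>auto simp: T_def chart_inv[OF V] chart_inv[OF U] subset_iff\<close>)
    then show "\<exists>T. open T \<and> y \<in> T \<and> smooth_on T (\<lambda>y. f (inv_into V \<psi> y))"
      using T p N by (auto simp: T_def)
  qed
qed

lemma SF_const [simp, intro]: "(\<lambda>_. c) \<in> SF"
  by (rule SF_I) (simp add: smooth_on_const chart_image_open)

lemma SF_0 [simp, intro]: "0 \<in> SF"
  using SF_const[of 0] by (simp add: zero_fun_def)

lemma SF_1 [simp, intro]: "1 \<in> SF"
  using SF_const[of 1] by (simp add: one_fun_def)

lemma SF_add [intro]: "f \<in> SF \<Longrightarrow> g \<in> SF \<Longrightarrow> f + g \<in> SF"
  by (rule SF_I) (simp add: smooth_on_add chart_image_open SF_chart)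

lemma SF_mult [intro]: "f \<in> SF \<Longrightarrow> g \<in> SF \<Longrightarrow> f * g \<in> SF"
  by (rule SF_I) (simp add: smooth_on_mult chart_image_open SF_chart)

lemma SF_scale [intro]: "f \<in> SF \<Longrightarrow> (\<lambda>x. c * f x) \<in> SF"
  using SF_mult[OF SF_const[of c], of f] by (simp add: times_fun_def)

lemma SF_uminus [intro]: "f \<in> SF \<Longrightarrow> - f \<in> SF"
  using SF_scale[of f "-1"] by (simp add: fun_Compl_def)

lemma SF_diff [intro]: "f \<in> SF \<Longrightarrow> g \<in> SF \<Longrightarrow> f - g \<in> SF"
  using SF_add[OF _ SF_uminus, of f g] by simp

lemma SF_sum [intro]: "(\<And>i. i \<in> I \<Longrightarrow> f i \<in> SF) \<Longrightarrow> (\<Sum>i\<in>I. f i) \<in> SF"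
  by (induction I rule: infinite_finite_induct) auto

lemma SF_divide_local:
  assumes "\<And>p. \<exists>N g h. open N \<and> p \<in> N \<and> g \<in> SF \<and> h \<in> SF \<and> (\<forall>q\<in>N. h q \<noteq> 0 \<and> f q = g q / h q)"
  shows "f \<in> SF"
proof (rule SF_local)
  fix p
  obtain N g h where N: "open N" "p \<in> N" and gh: "g \<in> SF" "h \<in> SF"
    and eq: "\<And>q. q \<in> N \<Longrightarrow> h q \<noteq> 0 \<and> f q = g q / h q"
    using assms[of p] by blast
  obtain U \<phi> where U: "(U, \<phi>) \<in> A" "p \<in> U" by (rule chart_exists)
  have o: "open (\<phi> ` (N \<inter> U))"
    by (rule chart_image_sub[OF U(1)]) (auto intro: N chart_open[OF U(1)])
  have "smooth_on (\<phi> ` (N \<inter> U)) (\<lambda>y. g (inv_into U \<phi> y) / h (inv_into U \<phi> y))"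
    by (rule smooth_on_divide[OF o])
      (auto intro!: smooth_on_subset[OF SF_chart[OF U(1)]] gh simp: chart_inv[OF U(1)] eq)
  then have "smooth_on (\<phi> ` (N \<inter> U)) (\<lambda>y. f (inv_into U \<phi> y))"
    by (subst smooth_on_cong[OF o]) (auto simp: chart_inv[OF U(1)] eq)
  then show "\<exists>(U, \<phi>)\<in>A. \<exists>N. open N \<and> p \<in> N \<and> N \<subseteq> U \<and> smooth_on (\<phi> ` N) (\<lambda>y. f (inv_into U \<phi> y))"
    using N U chart_open[OF U(1)]
    by (intro bexI[of _ "(U, \<phi>)"]) (auto intro!: exI[of _ "N \<inter> U"])
qed

lemma SF_nonzero_open:
  assumes h: "h \<in> SF" and "h p \<noteq> 0"
  obtains N where "open N" "p \<in> N" "\<And>q. q \<in> N \<Longrightarrow> h q \<noteq> 0"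
proof -
  obtain U \<phi> where U: "(U, \<phi>) \<in> A" "p \<in> U" by (rule chart_exists)
  let ?H = "\<lambda>y. h (inv_into U \<phi> y)"
  have "continuous_on (\<phi> ` U) ?H"
    by (rule smooth_on_continuous_on[OF SF_chart[OF U(1) h]])
  then have "open (?H -` (- {0}) \<inter> \<phi> ` U)"
    using continuous_on_open_vimage[OF chart_image_open[OF U(1)]] by blast
  then have "open {x \<in> U. \<phi> x \<in> ?H -` (- {0}) \<inter> \<phi> ` U}"
    by (intro chart_preimage_open[OF U(1)] chart_open[OF U(1)]) auto
  then show ?thesis
  proof (rule that)
    show "p \<in> {x \<in> U. \<phi> x \<in> ?H -` (- {0}) \<inter> \<phi> ` U}"
      using U assms(2) by (simp add: chart_inv[OF U(1)])
    show "h q \<noteq> 0" if "q \<in> {x \<in> U. \<phi> x \<in> ?H -` (- {0}) \<inter> \<phi> ` U}" for q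
      using that chart_inv[OF U(1), of q] by simp
  qed
qed

text \<open>
  The compact set \<open>\<phi>\<^sup>-\<^sup>1(cball y r)\<close> is closed because the manifold is Hausdorff; hence the zero
  function on its complement and the local expression on \<open>N\<close> live on two open sets
  covering the manifold, and they agree on the overlap.
\<close>

lemma bump_extension:
  assumes U: "(U, \<phi>) \<in> A" and N: "open N" "N \<subseteq> U" and K: "cball y r \<subseteq> \<phi> ` N"
    and \<beta>: "smooth_on UNIV \<beta>" "\<forall>x. x \<notin> ball y r \<longrightarrow> \<beta> x = 0"
    and h: "smooth_on (\<phi> ` N) h"
  shows "(\<lambda>x. if x \<in> N then \<beta> (\<phi> x) * h (\<phi> x) else 0) \<in> SF" (is "?F \<in> SF")
proof (rule SF_local)
  fix p
  have oN: "open (\<phi> ` N)" by (rule chart_image_sub[OF U N(2,1)])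
  have "continuous_on (cball y r) (inv_into U \<phi>)"
  proof (rule continuous_on_subset)
    show "continuous_on (\<phi> ` U) (inv_into U \<phi>)"
      using chart_homeo[OF U] by (simp add: homeomorphism_def)
  qed (use K N(2) in blast)
  then have "compact (inv_into U \<phi> ` cball y r)"
    by (intro compact_continuous_image) auto
  then have cl: "closed (inv_into U \<phi> ` cball y r)" (is "closed ?K") by (rule compact_imp_closed)
  show "\<exists>(U, \<phi>)\<in>A. \<exists>M. open M \<and> p \<in> M \<and> M \<subseteq> U \<and> smooth_on (\<phi> ` M) (\<lambda>y. ?F (inv_into U \<phi> y))"
  proof (cases "p \<in> N")
    case True
    have "smooth_on (\<phi> ` N) (\<lambda>y. \<beta> y * h y)"
      by (rule smooth_on_mult[OF oN smooth_on_subset[OF \<beta>(1)] h]) auto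
    then have "smooth_on (\<phi> ` N) (\<lambda>y. ?F (inv_into U \<phi> y))"
      by (subst smooth_on_cong[OF oN]) (use N(2) in \<open>auto simp: chart_inv[OF U] subset_iff\<close>)
    then show ?thesis using U N True by (intro bexI[of _ "(U, \<phi>)"]) auto
  next
    case False
    obtain V \<psi> where V: "(V, \<psi>) \<in> A" "p \<in> V" by (rule chart_exists)
    have KN: "?K \<subseteq> N" using K N(2) chart_inv[OF U] by (fastforce simp: subset_iff)
    have zero: "?F x = 0" if "x \<notin> ?K" for x
    proof (cases "x \<in> N")
      case True
      then have "\<phi> x \<notin> cball y r" using that N(2) chart_inv[OF U, of x] by (metis image_eqI subsetD)
      then show ?thesis using \<beta>(2) by auto
    qed simp
    have o: "open (\<psi> ` (V - ?K))"
      by (rule chart_image_sub[OF V(1)]) (auto intro: open_Diff cl chart_open[OF V(1)])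
    have zero': "?F (inv_into V \<psi> y) = 0" if "y \<in> \<psi> ` (V - ?K)" for y
      by (rule zero) (use that in \<open>auto simp: chart_inv[OF V(1)]\<close>)
    have "smooth_on (\<psi> ` (V - ?K)) (\<lambda>y. ?F (inv_into V \<psi> y))"
      by (rule iffD2[OF smooth_on_cong[OF o zero'] smooth_on_const[OF o]])
    then show ?thesis
      using V KN False cl chart_open[OF V(1)]
      by (intro bexI[of _ "(V, \<psi>)"]) (auto intro!: exI[of _ "V - ?K"] open_Diff)
  qed
qed

lemma chart_cball:
  assumes U: "(U, \<phi>) \<in> A" and N: "open N" "N \<subseteq> U" "p \<in> N"
  obtains r where "r > 0" "cball (\<phi> p) r \<subseteq> \<phi> ` N"
  using open_contains_cball[of "\<phi> ` N"] chart_image_sub[OF U N(2,1)] N(3) by blast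

lemma SF_bump:
  assumes "open W" "p \<in> W"
  obtains \<rho> where "\<rho> \<in> SF" "\<rho> p = 1" "\<forall>x. x \<notin> W \<longrightarrow> \<rho> x = 0"
proof -
  obtain U \<phi> where U: "(U, \<phi>) \<in> A" "p \<in> U" by (rule chart_exists)
  have N: "open (W \<inter> U)" "W \<inter> U \<subseteq> U" using assms chart_open[OF U(1)] by auto
  obtain r where r: "r > 0" "cball (\<phi> p) r \<subseteq> \<phi> ` (W \<inter> U)"
    by (rule chart_cball[OF U(1) N]) (use U assms in auto)
  obtain \<beta> :: "'e \<Rightarrow> real" where \<beta>: "smooth_on UNIV \<beta>" "\<forall>x\<in>ball (\<phi> p) (r / 2). \<beta> x = 1"
    "\<forall>x. x \<notin> ball (\<phi> p) r \<longrightarrow> \<beta> x = 0"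
    by (rule smooth_bump[OF r(1), of "\<phi> p"])
  have "(\<lambda>x. if x \<in> W \<inter> U then \<beta> (\<phi> x) * 1 else 0) \<in> SF"
    by (rule bump_extension[OF U(1) N r(2) \<beta>(1,3)])
      (auto intro!: smooth_on_const chart_image_sub[OF U(1)] N)
  then show ?thesis
    by (rule that) (use r assms U \<beta> in auto)
qed

section \<open>Vector fields\<close>

lemma VF_off: "\<xi> \<in> VF \<Longrightarrow> f \<notin> SF \<Longrightarrow> \<xi> f = 0"
  and VF_SF: "\<xi> \<in> VF \<Longrightarrow> \<xi> f \<in> SF"
  and VF_add: "\<xi> \<in> VF \<Longrightarrow> f \<in> SF \<Longrightarrow> g \<in> SF \<Longrightarrow> \<xi> (f + g) = \<xi> f + \<xi> g"
  and VF_scale: "\<xi> \<in> VF \<Longrightarrow> f \<in> SF \<Longrightarrow> \<xi> (\<lambda>x. r * f x) = (\<lambda>x. r * \<xi> f x)"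
  and VF_mult: "\<xi> \<in> VF \<Longrightarrow> f \<in> SF \<Longrightarrow> g \<in> SF \<Longrightarrow> \<xi> (f * g) = \<xi> f * g + f * \<xi> g"
proof -
  show "\<xi> \<in> VF \<Longrightarrow> \<xi> f \<in> SF"
    by (cases "f \<in> SF") (auto simp: vector_fields_def)
qed (simp_all add: vector_fields_def)

lemma VF_I:
  assumes "\<And>f. f \<notin> SF \<Longrightarrow> \<xi> f = 0" "\<And>f. f \<in> SF \<Longrightarrow> \<xi> f \<in> SF"
    "\<And>f g. f \<in> SF \<Longrightarrow> g \<in> SF \<Longrightarrow> \<xi> (f + g) = \<xi> f + \<xi> g"
    "\<And>r f. f \<in> SF \<Longrightarrow> \<xi> (\<lambda>x. r * f x) = (\<lambda>x. r * \<xi> f x)"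
    "\<And>f g. f \<in> SF \<Longrightarrow> g \<in> SF \<Longrightarrow> \<xi> (f * g) = \<xi> f * g + f * \<xi> g"
  shows "\<xi> \<in> VF"
  using assms by (simp add: vector_fields_def)

context
  fixes \<xi> assumes \<xi>: "\<xi> \<in> VF"
begin

lemma VF_0: "\<xi> 0 = 0"
  using VF_add[OF \<xi> SF_0 SF_0] by simp

lemma VF_const: "\<xi> (\<lambda>_. c) = 0"
proof -
  have "\<xi> 1 = \<xi> 1 + \<xi> 1" using VF_mult[OF \<xi> SF_1 SF_1] by simp
  then have "\<xi> 1 = 0" by simp
  then show ?thesis using VF_scale[OF \<xi> SF_1, of c] by (simp add: zero_fun_def)
qed

lemma VF_uminus: "f \<in> SF \<Longrightarrow> \<xi> (- f) = - \<xi> f"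
  using VF_scale[OF \<xi>, of f "-1"] by (simp add: fun_Compl_def)

lemma VF_diff: "f \<in> SF \<Longrightarrow> g \<in> SF \<Longrightarrow> \<xi> (f - g) = \<xi> f - \<xi> g"
  using VF_add[OF \<xi>, of f "- g"] VF_uminus[of g] SF_uminus[of g] by simp

lemma VF_sum: "(\<And>i. i \<in> I \<Longrightarrow> f i \<in> SF) \<Longrightarrow> \<xi> (\<Sum>i\<in>I. f i) = (\<Sum>i\<in>I. \<xi> (f i))"
  by (induction I rule: infinite_finite_induct) (auto simp: VF_0 VF_add[OF \<xi>] SF_sum)

text \<open>
  If \<open>\<rho>\<close> is a bump function at \<open>p\<close> supported in \<open>N\<close>, then \<open>\<rho> (f - g) = 0\<close>, and the Leibniz rule
  for \<open>\<xi>\<close> on this product, evaluated at \<open>p\<close>, gives \<open>\<xi>(f - g)(p) = 0\<close>.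
\<close>

lemma VF_local:
  assumes "f \<in> SF" "g \<in> SF" "open N" "p \<in> N" and eq: "\<And>q. q \<in> N \<Longrightarrow> f q = g q"
  shows "\<xi> f p = \<xi> g p"
proof -
  obtain \<rho> where \<rho>: "\<rho> \<in> SF" "\<rho> p = 1" "\<forall>x. x \<notin> N \<longrightarrow> \<rho> x = 0"
    by (rule SF_bump[OF assms(3,4)])
  have "\<rho> * (f - g) = 0" using \<rho>(3) eq by (auto simp: fun_eq_iff)
  then have "\<xi> \<rho> * (f - g) + \<rho> * \<xi> (f - g) = 0"
    using VF_mult[OF \<xi> \<rho>(1) SF_diff[OF assms(1,2)]] VF_0 by simp
  from fun_cong[OF this, of p] show ?thesis
    using VF_diff assms(1,2,4) eq \<rho>(2) by simp
qed

end

lemma VF_zero [simp, intro]: "0 \<in> VF"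
  by (rule VF_I) (auto simp: zero_fun_def)

lemma VF_plus [intro]: "\<xi> \<in> VF \<Longrightarrow> \<eta> \<in> VF \<Longrightarrow> \<xi> + \<eta> \<in> VF"
  by (rule VF_I) (auto simp: VF_off VF_SF VF_add VF_scale VF_mult SF_add algebra_simps fun_eq_iff)

lemma VF_vf_mult [intro]: "f \<in> SF \<Longrightarrow> \<xi> \<in> VF \<Longrightarrow> vf_mult f \<xi> \<in> VF"
  by (rule VF_I) (auto simp: vf_mult_def VF_off VF_SF VF_add VF_scale VF_mult SF_mult algebra_simps fun_eq_iff)

lemma VF_finite_sum [intro]: "(\<And>i. i \<in> I \<Longrightarrow> \<xi> i \<in> VF) \<Longrightarrow> (\<Sum>i\<in>I. \<xi> i) \<in> VF"
  by (induction I rule: infinite_finite_induct) auto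

lemma VF_bracket [intro]:
  assumes "\<xi> \<in> VF" "\<eta> \<in> VF"
  shows "lie_bracket \<xi> \<eta> \<in> VF"
proof (rule VF_I)
  note [simp] = lie_bracket_def VF_off[OF assms(1)] VF_off[OF assms(2)] VF_SF[OF assms(1)] VF_SF[OF assms(2)]
    VF_0[OF assms(1)] VF_0[OF assms(2)] VF_add[OF assms(1)] VF_add[OF assms(2)]
    VF_scale[OF assms(1)] VF_scale[OF assms(2)] VF_mult[OF assms(1)] VF_mult[OF assms(2)]
    SF_diff SF_mult
  fix f g r
  show "f \<notin> SF \<Longrightarrow> lie_bracket \<xi> \<eta> f = 0" by simp
  show "f \<in> SF \<Longrightarrow> lie_bracket \<xi> \<eta> f \<in> SF" by simp
  show "f \<in> SF \<Longrightarrow> lie_bracket \<xi> \<eta> (\<lambda>x. r * f x) = (\<lambda>x. r * lie_bracket \<xi> \<eta> f x)"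
    by (simp add: fun_eq_iff algebra_simps)
  show "f \<in> SF \<Longrightarrow> g \<in> SF \<Longrightarrow> lie_bracket \<xi> \<eta> (f + g) = lie_bracket \<xi> \<eta> f + lie_bracket \<xi> \<eta> g"
    by simp
  show "f \<in> SF \<Longrightarrow> g \<in> SF \<Longrightarrow>
      lie_bracket \<xi> \<eta> (f * g) = lie_bracket \<xi> \<eta> f * g + f * lie_bracket \<xi> \<eta> g"
    by (simp add: algebra_simps)
qed

section \<open>Local frames\<close>

text \<open>
  Vector fields \<open>E b\<close> defined on the whole manifold that restrict on \<open>N\<close> to the coordinate fields of the
  coordinates \<open>X b\<close>. The last clause says that derivations are determined on \<open>N\<close> by their values on the
  coordinates, and makes \<open>E\<close> a frame over \<open>N\<close>.
\<close>

definition frame_on :: "'a set \<Rightarrow> ('e \<Rightarrow> 'a vfield) \<Rightarrow> ('e \<Rightarrow> 'a \<Rightarrow> real) \<Rightarrow> bool" where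
  "frame_on N E X \<longleftrightarrow> open N \<and>
     (\<forall>b\<in>Basis. E b \<in> VF \<and> X b \<in> SF) \<and>
     (\<forall>q\<in>N. \<forall>b\<in>Basis. \<forall>c\<in>Basis. E b (X c) q = (if b = c then 1 else 0)) \<and>
     (\<forall>q\<in>N. \<forall>\<xi>\<in>VF. \<forall>f\<in>SF. \<xi> f q = (\<Sum>b\<in>Basis. \<xi> (X b) q * E b f q))"

text \<open>
  The coordinates of a chart and the partial derivatives are cut off by a bump function. That an abstract
  derivation is a combination of partial derivatives is the classical consequence of
  Hadamard's lemma: near \<open>q\<close> one has \<open>f = f(q) + \<Sum>\<^sub>b (X b - X b q) g b\<close> with smooth \<open>g b\<close>,
  so every derivation satisfies \<open>\<xi> f q = \<Sum>\<^sub>b \<xi> (X b) q * g b q\<close>, and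
  taking \<open>\<xi> = E b\<close> identifies \<open>g b q\<close> as \<open>E b f q\<close>. The third conclusion records that the
  \<open>E b\<close> detect nonconstant functions.
\<close>

lemma frame_exists:
  obtains N E X where "frame_on N E X" "p \<in> N"
    "\<forall>f\<in>SF. (\<forall>b\<in>Basis. \<forall>q\<in>N. E b f q = 0) \<longrightarrow> (\<forall>q\<in>N. f q = f p)"
proof -
  obtain U \<phi> where U: "(U, \<phi>) \<in> A" "p \<in> U" by (rule chart_exists)
  note oU = chart_open[OF U(1)] and oI = chart_image_open[OF U(1)]
  note [simp] = chart_inv[OF U(1)]
  obtain r where r: "r > 0" "cball (\<phi> p) r \<subseteq> \<phi> ` U"
    by (rule chart_cball[OF U(1) oU subset_refl U(2)])
  obtain \<beta> :: "'e \<Rightarrow> real" where \<beta>: "smooth_on UNIV \<beta>" "\<forall>x\<in>ball (\<phi> p) (r / 2). \<beta> x = 1"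
    "\<forall>x. x \<notin> ball (\<phi> p) r \<longrightarrow> \<beta> x = 0"
    by (rule smooth_bump[OF r(1), of "\<phi> p"])
  note ext = bump_extension[OF U(1) oU subset_refl r(2) \<beta>(1,3)]
  define X where "X b = (\<lambda>x. if x \<in> U then \<beta> (\<phi> x) * (\<phi> x \<bullet> b) else 0)" for b
  define D where "D f x b = frechet_derivative (\<lambda>y. f (inv_into U \<phi> y)) (at (\<phi> x)) b" for f :: "'a \<Rightarrow> real" and x b
  define E where "E b f = (if f \<in> SF then (\<lambda>x. if x \<in> U then \<beta> (\<phi> x) * D f x b else 0) else 0)" for b f
  define N where "N = {x \<in> U. \<phi> x \<in> ball (\<phi> p) (r / 2)}"
  have N: "open N" "N \<subseteq> U" "p \<in> N"
    unfolding N_def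
    by (rule chart_preimage_open[OF U(1) oU subset_refl open_ball]) (use U r in auto)
  have hd: "((\<lambda>y. f (inv_into U \<phi> y)) has_derivative D f x) (at (\<phi> x))" if "f \<in> SF" "x \<in> U" for f x
    using smooth_on_has_derivative[OF SF_chart[OF U(1) that(1)], of "\<phi> x"] that(2)
    by (simp add: D_def[abs_def])
  have Du: "D f x = D'" if "((\<lambda>y. f (inv_into U \<phi> y)) has_derivative D') (at (\<phi> x))" for f x D'
    using frechet_derivative_at[OF that] by (simp add: D_def[abs_def])
  have X: "X b \<in> SF" for b
    unfolding X_def
    by (rule ext) (intro smooth_on_linear[OF oI bounded_linear_inner_left] smooth_on_id oI)
  have E: "E b \<in> VF" for b
  proof (rule VF_I)
    fix f g :: "'a \<Rightarrow> real" and c :: real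
    assume f: "f \<in> SF"
    have "(\<lambda>x. if x \<in> U then \<beta> (\<phi> x) * frechet_derivative (\<lambda>y. f (inv_into U \<phi> y)) (at (\<phi> x)) b else 0) \<in> SF"
      by (rule ext) (rule smooth_on_frechet_derivative[OF SF_chart[OF U(1) f]])
    then show "E b f \<in> SF" using f by (simp add: E_def D_def cong: if_cong)
    have "D (\<lambda>x. c * f x) x = (\<lambda>v. c * D f x v)" if "x \<in> U" for x
      by (rule Du) (rule has_derivative_mult_right[OF hd[OF f that]])
    then show "E b (\<lambda>x. c * f x) = (\<lambda>x. c * E b f x)"
      using f SF_scale[OF f] by (auto simp: E_def fun_eq_iff)
    assume g: "g \<in> SF"
    have "D (f + g) x = (\<lambda>v. D f x v + D g x v)" if "x \<in> U" for x
      by (rule Du) (use has_derivative_add[OF hd[OF f that] hd[OF g that]] in simp)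
    then show "E b (f + g) = E b f + E b g"
      using f g SF_add[OF f g] by (auto simp: E_def fun_eq_iff algebra_simps)
    have "D (f * g) x = (\<lambda>v. f x * D g x v + D f x v * g x)" if "x \<in> U" for x
      by (rule Du) (use has_derivative_mult[OF hd[OF f that] hd[OF g that]] that in simp)
    then show "E b (f * g) = E b f * g + f * E b g"
      using f g SF_mult[OF f g] by (auto simp: E_def fun_eq_iff algebra_simps)
  qed (simp add: E_def)
  have EN: "E b f q = D f q b" if "f \<in> SF" "q \<in> N" for b f q
    using that \<beta>(2) by (auto simp: E_def N_def)
  have XN: "X b q = \<phi> q \<bullet> b" if "q \<in> N" for b q
    using that \<beta>(2) by (auto simp: X_def N_def)
  have EX: "E b (X c) q = (if b = c then 1 else 0)" if "q \<in> N" "b \<in> Basis" "c \<in> Basis" for b c q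
  proof -
    have "((\<lambda>y. y \<bullet> c) has_derivative (\<lambda>v. v \<bullet> c)) (at (\<phi> q))"
      by (auto intro!: derivative_eq_intros)
    then have "((\<lambda>y. X c (inv_into U \<phi> y)) has_derivative (\<lambda>v. v \<bullet> c)) (at (\<phi> q))"
      by (rule has_derivative_transform_within_open[OF _ chart_image_sub[OF U(1) N(2,1)]])
        (use that(1) N(2) XN in \<open>auto simp: subset_iff\<close>)
    from Du[OF this] show ?thesis using EN[OF X that(1)] that by (simp add: inner_Basis)
  qed
  have expand: "\<exists>\<gamma>. \<forall>\<xi>\<in>VF. \<xi> f q = (\<Sum>b\<in>Basis. \<xi> (X b) q * \<gamma> b)" if q: "q \<in> N" and f: "f \<in> SF" for q f
  proof -
    have qU: "q \<in> U" using q N by auto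
    obtain s where s: "s > 0" "ball (\<phi> q) s \<subseteq> \<phi> ` N"
      using open_contains_ball[of "\<phi> ` N"] chart_image_sub[OF U(1) N(2,1)] q by blast
    have "smooth_on (ball (\<phi> q) s) (\<lambda>y. f (inv_into U \<phi> y))"
      by (rule smooth_on_subset[OF SF_chart[OF U(1) f]]) (use s N(2) in auto)
    then obtain G where G: "\<And>b. smooth_on (ball (\<phi> q) s) (G b)"
      and eq: "\<And>y. y \<in> ball (\<phi> q) s \<Longrightarrow> f (inv_into U \<phi> y) =
        f (inv_into U \<phi> (\<phi> q)) + (\<Sum>b\<in>Basis. ((y - \<phi> q) \<bullet> b) * G b y)"
      by (rule hadamard) blast
    define M where "M = {x \<in> U. \<phi> x \<in> ball (\<phi> q) s}"
    have M: "open M" "M \<subseteq> U"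
      unfolding M_def by (rule chart_preimage_open[OF U(1) oU subset_refl open_ball]) auto
    have imM: "\<phi> ` M = ball (\<phi> q) s"
    proof
      show "ball (\<phi> q) s \<subseteq> \<phi> ` M"
      proof
        fix y assume y: "y \<in> ball (\<phi> q) s"
        then obtain x where "x \<in> N" "y = \<phi> x" using s(2) by blast
        then show "y \<in> \<phi> ` M" using y N(2) unfolding M_def by blast
      qed
    qed (auto simp: M_def)
    obtain \<beta>' :: "'e \<Rightarrow> real" where \<beta>': "smooth_on UNIV \<beta>'" "\<forall>x\<in>ball (\<phi> q) (s / 2 / 2). \<beta>' x = 1"
      "\<forall>x. x \<notin> ball (\<phi> q) (s / 2) \<longrightarrow> \<beta>' x = 0"
      by (rule smooth_bump[of "s / 2" "\<phi> q"]) (use s(1) in simp)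
    define g where "g b = (\<lambda>x. if x \<in> M then \<beta>' (\<phi> x) * G b (\<phi> x) else 0)" for b
    have g: "g b \<in> SF" for b
      unfolding g_def by (rule bump_extension[OF U(1) M _ \<beta>'(1,3)]) (use s(1) G imM in auto)
    define M' where "M' = {x \<in> N. \<phi> x \<in> ball (\<phi> q) (s / 2 / 2)}"
    have M': "open M'" "q \<in> M'"
      unfolding M'_def
      by (rule chart_preimage_open[OF U(1) N(1,2) open_ball]) (use q s(1) in auto)
    define h where "h = (\<lambda>_. f q) + (\<Sum>b\<in>Basis. (X b - (\<lambda>_. X b q)) * g b)"
    have d: "X b - (\<lambda>_. X b q) \<in> SF" for b by (rule SF_diff[OF X SF_const])
    have "f x = h x" if x: "x \<in> M'" for x
    proof -
      have xN: "x \<in> N" "x \<in> U" "\<phi> x \<in> ball (\<phi> q) s" "\<phi> x \<in> ball (\<phi> q) (s / 2 / 2)"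
        using x s(1) N(2) by (auto simp: M'_def)
      then show ?thesis
        using eq[OF xN(3)] qU q bspec[OF \<beta>'(2) xN(4)]
        by (simp add: h_def sum_fun_apply g_def M_def XN inner_diff_left)
    qed
    then have "\<xi> f q = (\<Sum>b\<in>Basis. \<xi> (X b) q * g b q)" if \<xi>: "\<xi> \<in> VF" for \<xi>
    proof -
      have h: "h \<in> SF" unfolding h_def by (intro SF_add SF_const SF_sum SF_mult d g)
      have "\<xi> f q = \<xi> h q"
        by (rule VF_local[OF \<xi> f h M']) fact
      also have "\<xi> h = (\<Sum>b\<in>Basis. \<xi> (X b) * g b + (X b - (\<lambda>_. X b q)) * \<xi> (g b))"
        unfolding h_def
        by (subst VF_add[OF \<xi>])
          (auto simp: VF_const[OF \<xi>] VF_sum[OF \<xi>] VF_mult[OF \<xi>] VF_diff[OF \<xi>] SF_sum SF_mult d g X)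
      finally show ?thesis by (simp add: sum_fun_apply)
    qed
    then show ?thesis by (intro exI[of _ "\<lambda>b. g b q"] ballI)
  qed
  have "frame_on N E X"
    unfolding frame_on_def
  proof (intro conjI ballI N E X)
    fix q \<xi> f assume q: "q \<in> N" "\<xi> \<in> VF" "f \<in> SF"
    obtain \<gamma> where \<gamma>: "\<And>\<xi>. \<xi> \<in> VF \<Longrightarrow> \<xi> f q = (\<Sum>b\<in>Basis. \<xi> (X b) q * \<gamma> b)"
      using expand[OF q(1,3)] by blast
    have "E c f q = \<gamma> c" if "c \<in> Basis" for c
      using \<gamma>[OF E, of c] that q(1) EX by (simp add: if_distrib[of "\<lambda>x. x * _"] cong: if_cong)
    then show "\<xi> f q = (\<Sum>b\<in>Basis. \<xi> (X b) q * E b f q)" using \<gamma>[OF q(2)] by simp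
  qed (rule EX)
  moreover have "f q = f p"
    if f: "f \<in> SF" and z: "\<And>b q. b \<in> Basis \<Longrightarrow> q \<in> N \<Longrightarrow> E b f q = 0" and q: "q \<in> N" for f q
  proof -
    let ?F = "\<lambda>y. f (inv_into U \<phi> y)"
    have "(?F has_derivative (\<lambda>_. 0)) (at y within ball (\<phi> p) (r / 2))" if y: "y \<in> ball (\<phi> p) (r / 2)" for y
    proof -
      have "y \<in> cball (\<phi> p) r" using y r(1) by auto
      then obtain x where x: "x \<in> U" "y = \<phi> x" using r(2) by auto
      have xN: "x \<in> N" using x y by (simp add: N_def)
      have "D f x = (\<lambda>_. 0)"
      proof (rule linear_eq_stdbasis)
        show "linear (D f x)" by (rule has_derivative_linear[OF hd[OF f x(1)]])
        show "D f x b = 0" if "b \<in> Basis" for b using z[OF that xN] EN[OF f xN] by simp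
      qed (simp add: linear_zero)
      then show ?thesis using hd[OF f x(1)] x(2) by (simp add: has_derivative_at_withinI)
    qed
    then obtain c where "\<And>y. y \<in> ball (\<phi> p) (r / 2) \<Longrightarrow> ?F y = c"
      using has_derivative_zero_constant[of "ball (\<phi> p) (r / 2)" ?F] by (metis convex_ball)
    from this[of "\<phi> q"] this[of "\<phi> p"] show ?thesis using q U r(1) by (auto simp: N_def)
  qed
  ultimately show ?thesis using N(3) by (intro that) auto
qed

text \<open>
  A function killed by all derivations is constant near every point, so its level sets are open.
\<close>

lemma VF_zero_imp_constant:
  assumes "connected (UNIV :: 'a set)" and f: "f \<in> SF" and z: "\<And>\<xi>. \<xi> \<in> VF \<Longrightarrow> \<xi> f = 0"
  shows "f = (\<lambda>_. f p)"
proof -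
  have loc: "\<exists>N. open N \<and> q \<in> N \<and> (\<forall>x\<in>N. f x = f q)" for q
  proof -
    obtain N E X where fr: "frame_on N E X" "q \<in> N"
      "\<forall>f\<in>SF. (\<forall>b\<in>Basis. \<forall>q\<in>N. E b f q = 0) \<longrightarrow> (\<forall>x\<in>N. f x = f q)"
      by (rule frame_exists[of q])
    have "\<forall>b\<in>Basis. \<forall>q\<in>N. E b f q = 0"
      using fr(1) z by (simp add: frame_on_def)
    then have "\<forall>x\<in>N. f x = f q" using fr(3) f by blast
    then show ?thesis using fr(1,2) unfolding frame_on_def by blast
  qed
  have op: "open {x. Q (f x)}" for Q
  proof (subst open_subopen, intro ballI)
    fix x assume "x \<in> {x. Q (f x)}"
    moreover obtain N where "open N" "x \<in> N" "\<forall>y\<in>N. f y = f x" using loc[of x] by blast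
    ultimately show "\<exists>T. open T \<and> x \<in> T \<and> T \<subseteq> {x. Q (f x)}"
      by (metis (no_types, lifting) mem_Collect_eq subsetI)
  qed
  have "open {x. f x = f p}" "open {x. f x \<noteq> f p}" by (rule op)+
  moreover have "{x. f x = f p} \<inter> {x. f x \<noteq> f p} = {}" "UNIV \<subseteq> {x. f x = f p} \<union> {x. f x \<noteq> f p}" by auto
  ultimately have "{x. f x \<noteq> f p} = {}"
    using connectedD[OF assms(1), of "{x. f x = f p}" "{x. f x \<noteq> f p}"] by blast
  then show ?thesis by (intro ext) blast
qed

text \<open>
  The value of a \<open>C\<^sup>\<infinity>\<close>-linear map at \<open>q\<close> depends on \<open>\<xi>\<close> at \<open>q\<close> only: after multiplication by a bump
  function supported in \<open>N\<close>, the expansion of \<open>\<xi>\<close> in the frame is an identity of vector fields on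
  the whole manifold, to which linearity over smooth functions applies.
\<close>

lemma tensorial:
  assumes fr: "frame_on N E X"
    and add: "\<And>\<xi> \<eta>. \<xi> \<in> VF \<Longrightarrow> \<eta> \<in> VF \<Longrightarrow> L (\<xi> + \<eta>) = L \<xi> + L \<eta>"
    and mult: "\<And>f \<xi>. f \<in> SF \<Longrightarrow> \<xi> \<in> VF \<Longrightarrow> L (vf_mult f \<xi>) = f * L \<xi>"
    and q: "q \<in> N" and \<xi>: "\<xi> \<in> VF"
  shows "L \<xi> q = (\<Sum>b\<in>Basis. \<xi> (X b) q * L (E b) q)"
proof -
  have N: "open N" and E: "\<And>b. b \<in> Basis \<Longrightarrow> E b \<in> VF" and X: "\<And>b. b \<in> Basis \<Longrightarrow> X b \<in> SF"
    and exp: "\<And>q f. q \<in> N \<Longrightarrow> f \<in> SF \<Longrightarrow> \<xi> f q = (\<Sum>b\<in>Basis. \<xi> (X b) q * E b f q)"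
    using fr \<xi> by (auto simp: frame_on_def)
  obtain \<rho> where \<rho>: "\<rho> \<in> SF" "\<rho> q = 1" "\<forall>x. x \<notin> N \<longrightarrow> \<rho> x = 0"
    by (rule SF_bump[OF N q])
  have "vf_mult \<rho> \<xi> f x = (\<Sum>b\<in>Basis. vf_mult (\<rho> * \<xi> (X b)) (E b)) f x" for f x
  proof (cases "f \<in> SF")
    case True
    show ?thesis
      by (cases "x \<in> N")
        (simp_all add: vf_mult_def sum_fun_apply exp[OF _ True] \<rho>(3) sum_distrib_left mult.assoc)
  next
    case False
    then show ?thesis using E \<xi> by (simp add: vf_mult_def sum_fun_apply VF_off)
  qed
  then have eq: "vf_mult \<rho> \<xi> = (\<Sum>b\<in>Basis. vf_mult (\<rho> * \<xi> (X b)) (E b))" by (intro ext)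
  have L0: "L 0 = 0" using add[of 0 0] by simp
  have Lsum: "L (\<Sum>b\<in>B. \<eta> b) = (\<Sum>b\<in>B. L (\<eta> b))" if "\<And>b. b \<in> B \<Longrightarrow> \<eta> b \<in> VF" for B :: "'e set" and \<eta>
    using that by (induction B rule: infinite_finite_induct) (auto simp: L0 add VF_finite_sum)
  have c: "\<rho> * \<xi> (X b) \<in> SF" for b by (intro SF_mult \<rho> VF_SF \<xi>)
  have "\<rho> * L \<xi> = L (vf_mult \<rho> \<xi>)" by (rule mult[OF \<rho>(1) \<xi>, symmetric])
  also have "\<dots> = (\<Sum>b\<in>Basis. L (vf_mult (\<rho> * \<xi> (X b)) (E b)))"
    unfolding eq by (rule Lsum) (intro VF_vf_mult c E)
  also have "\<dots> = (\<Sum>b\<in>Basis. \<rho> * \<xi> (X b) * L (E b))"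
    by (intro sum.cong refl mult c E)
  finally have "\<rho> q * L \<xi> q = (\<Sum>b\<in>Basis. \<rho> q * \<xi> (X b) q * L (E b) q)"
    by (simp add: fun_eq_iff sum_fun_apply)
  then show ?thesis using \<rho>(2) by simp
qed

text \<open>
  A substitute for Cramer's rule over the ring of smooth functions: a system that can be solved at
  the point \<open>p\<close> can be solved by smooth functions up to a denominator \<open>h\<close> with \<open>h p \<noteq> 0\<close>. The proof is
  Gaussian elimination without division. Solvability at \<open>p\<close> is phrased as surjectivity rather than as
  invertibility, because surjectivity passes to the eliminated system for an arbitrary
  pivot row, without keeping the matrix square.
\<close>

lemma solve_linear_system:
  assumes "finite I" "finite J" and "\<And>i j. m i j \<in> SF" and "\<And>j. a j \<in> SF"
    and "\<And>w :: 'j \<Rightarrow> real. \<exists>v. \<forall>j\<in>J. (\<Sum>i\<in>I. v i * m i j p) = w j"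
  shows "\<exists>u h. (\<forall>i. u i \<in> SF) \<and> h \<in> SF \<and> h p \<noteq> 0 \<and> (\<forall>j\<in>J. (\<Sum>i\<in>I. u i * m i j) = h * a j)"
  using assms(2-5)
proof (induction J arbitrary: m a rule: finite_induct)
  case empty
  show ?case by (intro exI[of _ "\<lambda>_. 0"] exI[of _ 1]) auto
next
  case (insert k J)
  obtain v where "\<forall>j\<in>insert k J. (\<Sum>i\<in>I. v i * m i j p) = (if j = k then 1 else 0)"
    using insert.prems(3)[of "\<lambda>j. if j = k then 1 else 0"] by blast
  then have "(\<Sum>i\<in>I. v i * m i k p) \<noteq> 0" by simp
  then obtain s where s: "s \<in> I" "m s k p \<noteq> 0"
    by (metis (no_types, lifting) mult_zero_right sum.neutral)
  define m' where "m' i j = m s k * m i j - m i k * m s j" for i j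
  define a' where "a' j = m s k * a j - a k * m s j" for j
  have onto: "\<exists>v. \<forall>j\<in>J. (\<Sum>i\<in>I. v i * m' i j p) = w j" for w
  proof -
    obtain v where v: "\<forall>j\<in>insert k J. (\<Sum>i\<in>I. v i * m i j p) = (if j = k then 0 else w j / m s k p)"
      using insert.prems(3)[of "\<lambda>j. if j = k then 0 else w j / m s k p"] by blast
    have "(\<Sum>i\<in>I. v i * m' i j p) = w j" if "j \<in> J" for j
    proof -
      have "(\<Sum>i\<in>I. v i * m' i j p) = m s k p * (\<Sum>i\<in>I. v i * m i j p) - (\<Sum>i\<in>I. v i * m i k p) * m s j p"
        by (simp add: m'_def sum_distrib_left sum_distrib_right sum_subtractf[symmetric] algebra_simps)
      also have "\<dots> = w j" using v that insert.hyps(2) s(2) by auto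
      finally show ?thesis .
    qed
    then show ?thesis by blast
  qed
  have "\<exists>u h. (\<forall>i. u i \<in> SF) \<and> h \<in> SF \<and> h p \<noteq> 0 \<and> (\<forall>j\<in>J. (\<Sum>i\<in>I. u i * m' i j) = h * a' j)"
  proof (rule insert.IH[of m' a'])
    show "m' i j \<in> SF" for i j unfolding m'_def by (intro SF_diff SF_mult insert.prems)
    show "a' j \<in> SF" for j unfolding a'_def by (intro SF_diff SF_mult insert.prems)
  qed (rule onto)
  then obtain u h where uh: "\<And>i. u i \<in> SF" "h \<in> SF" "h p \<noteq> 0"
    and eq: "\<And>j. j \<in> J \<Longrightarrow> (\<Sum>i\<in>I. u i * m' i j) = h * a' j"
    by blast
  \<comment> \<open>The solution of the eliminated system, rescaled by the pivot and corrected in the pivot row so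
  that column \<open>k\<close> is matched as well.\<close>
  define c where "c = h * a k - (\<Sum>i\<in>I. u i * m i k)"
  define u' where "u' i = m s k * u i + (if i = s then c else 0)" for i
  have c: "c \<in> SF" unfolding c_def by (intro SF_diff SF_mult SF_sum uh insert.prems)
  have u'sum: "(\<Sum>i\<in>I. u' i * m i j) = m s k * (\<Sum>i\<in>I. u i * m i j) + c * m s j" for j
  proof -
    have "(\<Sum>i\<in>I. u' i * m i j) = (\<Sum>i\<in>I. m s k * (u i * m i j)) + (\<Sum>i\<in>I. if i = s then c * m s j else 0)"
      unfolding sum.distrib[symmetric] by (rule sum.cong) (auto simp: u'_def algebra_simps)
    then show ?thesis using assms(1) s(1) by (simp add: sum_distrib_left)
  qed
  have "(\<Sum>i\<in>I. u' i * m i j) = h * m s k * a j" if "j \<in> insert k J" for j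
  proof (cases "j = k")
    case True
    then show ?thesis unfolding u'sum by (simp add: c_def algebra_simps)
  next
    case False
    then have j: "j \<in> J" using that by simp
    have "m s k * (\<Sum>i\<in>I. u i * m i j) - (\<Sum>i\<in>I. u i * m i k) * m s j = (\<Sum>i\<in>I. u i * m' i j)"
      by (simp add: m'_def sum_distrib_left sum_distrib_right sum_subtractf[symmetric] algebra_simps)
    also have "\<dots> = h * (m s k * a j - a k * m s j)" using eq[OF j] by (simp add: a'_def)
    finally show ?thesis unfolding u'sum by (simp add: c_def algebra_simps)
  qed
  note solution = this
  have u'SF: "u' i \<in> SF" for i
    unfolding u'_def using c by (auto intro!: SF_add SF_mult uh insert.prems)
  have "(h * m s k) p \<noteq> 0" using uh(3) s(2) by simp
  then show ?case
    using solution u'SF SF_mult[OF uh(2) insert.prems(1)] by blast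
qed

section \<open>Forms of low degree and the contraction isomorphism\<close>

lemma form_off: "\<alpha> \<in> forms A k \<Longrightarrow> \<not> (length xs = k \<and> set xs \<subseteq> VF) \<Longrightarrow> \<alpha> xs = 0"
  by (simp add: forms_def)

lemma form_SF: "\<alpha> \<in> forms A k \<Longrightarrow> \<alpha> xs \<in> SF"
  by (cases "length xs = k \<and> set xs \<subseteq> VF") (auto simp: forms_def)

lemma form_slot:
  assumes "\<alpha> \<in> forms A k" "length xs = k" "set xs \<subseteq> VF" "i < k"
  shows "\<xi> \<in> VF \<Longrightarrow> \<eta> \<in> VF \<Longrightarrow> \<alpha> (xs[i := \<xi> + \<eta>]) = \<alpha> (xs[i := \<xi>]) + \<alpha> (xs[i := \<eta>])"
    and "f \<in> SF \<Longrightarrow> \<xi> \<in> VF \<Longrightarrow> \<alpha> (xs[i := vf_mult f \<xi>]) = f * \<alpha> (xs[i := \<xi>])"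
    and "j < k \<Longrightarrow> i \<noteq> j \<Longrightarrow> xs ! i = xs ! j \<Longrightarrow> \<alpha> xs = 0"
  using assms unfolding forms_def by blast+

lemma form1_add: "\<alpha> \<in> forms A 1 \<Longrightarrow> x \<in> VF \<Longrightarrow> y \<in> VF \<Longrightarrow> \<alpha> [x + y] = \<alpha> [x] + \<alpha> [y]"
  using form_slot(1)[of \<alpha> 1 "[x]" 0 x y] by simp

lemma form1_mult: "\<alpha> \<in> forms A 1 \<Longrightarrow> f \<in> SF \<Longrightarrow> x \<in> VF \<Longrightarrow> \<alpha> [vf_mult f x] = f * \<alpha> [x]"
  using form_slot(2)[of \<alpha> 1 "[x]" 0 f x] by simp

context
  fixes \<omega> assumes \<omega>: "\<omega> \<in> forms A 2"
begin

lemma form2_add1: "x \<in> VF \<Longrightarrow> y \<in> VF \<Longrightarrow> z \<in> VF \<Longrightarrow> \<omega> [x + y, z] = \<omega> [x, z] + \<omega> [y, z]"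
  using form_slot(1)[OF \<omega>, of "[x, z]" 0 x y] by simp

lemma form2_add2: "x \<in> VF \<Longrightarrow> y \<in> VF \<Longrightarrow> z \<in> VF \<Longrightarrow> \<omega> [z, x + y] = \<omega> [z, x] + \<omega> [z, y]"
  using form_slot(1)[OF \<omega>, of "[z, x]" 1 x y] by simp

lemma form2_mult1: "f \<in> SF \<Longrightarrow> x \<in> VF \<Longrightarrow> z \<in> VF \<Longrightarrow> \<omega> [vf_mult f x, z] = f * \<omega> [x, z]"
  using form_slot(2)[OF \<omega>, of "[x, z]" 0 f x] by simp

lemma form2_mult2: "f \<in> SF \<Longrightarrow> x \<in> VF \<Longrightarrow> z \<in> VF \<Longrightarrow> \<omega> [z, vf_mult f x] = f * \<omega> [z, x]"
  using form_slot(2)[OF \<omega>, of "[z, x]" 1 f x] by simp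

lemma form2_alt: "x \<in> VF \<Longrightarrow> \<omega> [x, x] = 0"
  using form_slot(3)[OF \<omega>, of "[x, x]" 0 1] by simp

end

lemma form2_antisym:
  assumes "\<omega> \<in> forms A 2" "x \<in> VF" "y \<in> VF"
  shows "\<omega> [y, x] = - \<omega> [x, y]"
proof -
  have "0 = \<omega> [x + y, x + y]" using form2_alt[OF assms(1), of "x + y"] assms by auto
  also have "\<dots> = \<omega> [x, y] + \<omega> [y, x]"
    using assms by (simp add: form2_add1 form2_add2 form2_alt VF_plus fun_eq_iff)
  finally show ?thesis by (simp add: eq_neg_iff_add_eq_0 add.commute)
qed

lemma fun_eq_uminus_self: "f = - f \<Longrightarrow> f = (0 :: 'a \<Rightarrow> real)"
  by (simp add: fun_eq_iff)

lemma forms1_I: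
  assumes "\<And>xs. \<not> (length xs = 1 \<and> set xs \<subseteq> VF) \<Longrightarrow> \<alpha> xs = 0"
    and "\<And>x. x \<in> VF \<Longrightarrow> \<alpha> [x] \<in> SF"
    and "\<And>x y. x \<in> VF \<Longrightarrow> y \<in> VF \<Longrightarrow> \<alpha> [x + y] = \<alpha> [x] + \<alpha> [y]"
    and "\<And>f x. f \<in> SF \<Longrightarrow> x \<in> VF \<Longrightarrow> \<alpha> [vf_mult f x] = f * \<alpha> [x]"
  shows "\<alpha> \<in> forms A 1"
  unfolding forms_def using assms by (auto simp: length_Suc_conv)

lemma forms2_I:
  assumes off: "\<And>xs. \<not> (length xs = 2 \<and> set xs \<subseteq> VF) \<Longrightarrow> \<alpha> xs = 0"
    and sm: "\<And>x y. x \<in> VF \<Longrightarrow> y \<in> VF \<Longrightarrow> \<alpha> [x, y] \<in> SF"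
    and anti: "\<And>x y. x \<in> VF \<Longrightarrow> y \<in> VF \<Longrightarrow> \<alpha> [y, x] = - \<alpha> [x, y]"
    and add: "\<And>x y z. x \<in> VF \<Longrightarrow> y \<in> VF \<Longrightarrow> z \<in> VF \<Longrightarrow> \<alpha> [x + y, z] = \<alpha> [x, z] + \<alpha> [y, z]"
    and mult: "\<And>f x z. f \<in> SF \<Longrightarrow> x \<in> VF \<Longrightarrow> z \<in> VF \<Longrightarrow> \<alpha> [vf_mult f x, z] = f * \<alpha> [x, z]"
  shows "\<alpha> \<in> forms A 2"
  unfolding forms_def
proof (intro CollectI conjI allI impI)
  fix xs :: "'a vfield list" assume "length xs = 2 \<and> set xs \<subseteq> VF"
  then obtain x y where xs: "xs = [x, y]" "x \<in> VF" "y \<in> VF"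
    by (auto simp: length_Suc_conv numeral_2_eq_2)
  show "\<alpha> xs \<in> SF" using sm xs by simp
  have add2: "\<alpha> [x, \<xi> + \<eta>] = \<alpha> [x, \<xi>] + \<alpha> [x, \<eta>]" if "\<xi> \<in> VF" "\<eta> \<in> VF" for \<xi> \<eta>
    using add[OF that xs(2)] anti[OF _ xs(2)] that VF_plus by simp
  have mult2: "\<alpha> [x, vf_mult f \<xi>] = f * \<alpha> [x, \<xi>]" if "\<xi> \<in> VF" "f \<in> SF" for f \<xi>
    using mult[OF that(2,1) xs(2)] anti[OF _ xs(2)] that VF_vf_mult by simp
  fix i :: nat assume "i < 2"
  then have i: "i = 0 \<or> i = 1" by auto
  show "\<forall>\<xi>\<in>VF. \<forall>\<eta>\<in>VF. \<alpha> (xs[i := \<xi> + \<eta>]) = \<alpha> (xs[i := \<xi>]) + \<alpha> (xs[i := \<eta>])"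
    using i xs add add2 by auto
  show "\<forall>f\<in>SF. \<forall>\<xi>\<in>VF. \<alpha> (xs[i := vf_mult f \<xi>]) = f * \<alpha> (xs[i := \<xi>])"
    using i xs mult mult2 by auto
  fix j :: nat assume j: "j < 2" "i \<noteq> j \<and> xs ! i = xs ! j"
  then have "x = y" using i xs(1) by (auto simp: less_2_cases_iff)
  then show "\<alpha> xs = 0" using anti[OF xs(2) xs(2)] xs(1) fun_eq_uminus_self by simp
qed (use off in blast)

lemma forms3_I:
  assumes off: "\<And>xs. \<not> (length xs = 3 \<and> set xs \<subseteq> VF) \<Longrightarrow> \<alpha> xs = 0"
    and sm: "\<And>x y z. x \<in> VF \<Longrightarrow> y \<in> VF \<Longrightarrow> z \<in> VF \<Longrightarrow> \<alpha> [x, y, z] \<in> SF"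
    and swap1: "\<And>x y z. x \<in> VF \<Longrightarrow> y \<in> VF \<Longrightarrow> z \<in> VF \<Longrightarrow> \<alpha> [y, x, z] = - \<alpha> [x, y, z]"
    and swap2: "\<And>x y z. x \<in> VF \<Longrightarrow> y \<in> VF \<Longrightarrow> z \<in> VF \<Longrightarrow> \<alpha> [x, z, y] = - \<alpha> [x, y, z]"
    and add: "\<And>u x y z. u \<in> VF \<Longrightarrow> x \<in> VF \<Longrightarrow> y \<in> VF \<Longrightarrow> z \<in> VF \<Longrightarrow> \<alpha> [u + x, y, z] = \<alpha> [u, y, z] + \<alpha> [x, y, z]"
    and mult: "\<And>f x y z. f \<in> SF \<Longrightarrow> x \<in> VF \<Longrightarrow> y \<in> VF \<Longrightarrow> z \<in> VF \<Longrightarrow> \<alpha> [vf_mult f x, y, z] = f * \<alpha> [x, y, z]"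
  shows "\<alpha> \<in> forms A 3"
  unfolding forms_def
proof (intro CollectI conjI allI impI)
  fix xs :: "'a vfield list" assume "length xs = 3 \<and> set xs \<subseteq> VF"
  then obtain x y z where xs: "xs = [x, y, z]" and V: "x \<in> VF" "y \<in> VF" "z \<in> VF"
    by (auto simp: length_Suc_conv numeral_3_eq_3)
  show "\<alpha> xs \<in> SF" using sm xs V by simp
  have s2: "\<alpha> [u, v, w] = - \<alpha> [v, u, w]" if "u \<in> VF" "v \<in> VF" "w \<in> VF" for u v w
    using swap1[of u v w] that by simp
  have s3: "\<alpha> [u, v, w] = \<alpha> [w, u, v]" if "u \<in> VF" "v \<in> VF" "w \<in> VF" for u v w
    using swap2[of u w v] swap1[of w u v] that by simp
  fix i :: nat assume "i < 3"
  then have i: "i = 0 \<or> i = 1 \<or> i = 2" by auto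
  have "\<alpha> [x, \<xi> + \<eta>, z] = \<alpha> [x, \<xi>, z] + \<alpha> [x, \<eta>, z]" if "\<xi> \<in> VF" "\<eta> \<in> VF" for \<xi> \<eta>
    using that V VF_plus by (simp add: s2[of x] add)
  moreover have "\<alpha> [x, y, \<xi> + \<eta>] = \<alpha> [x, y, \<xi>] + \<alpha> [x, y, \<eta>]" if "\<xi> \<in> VF" "\<eta> \<in> VF" for \<xi> \<eta>
    using that V VF_plus by (simp add: s3[of x y] add)
  ultimately show "\<forall>\<xi>\<in>VF. \<forall>\<eta>\<in>VF. \<alpha> (xs[i := \<xi> + \<eta>]) = \<alpha> (xs[i := \<xi>]) + \<alpha> (xs[i := \<eta>])"
    using i V unfolding xs by (auto simp: add numeral_2_eq_2)
  have "\<alpha> [x, vf_mult f \<xi>, z] = f * \<alpha> [x, \<xi>, z]" if "f \<in> SF" "\<xi> \<in> VF" for f \<xi>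
    using that V VF_vf_mult by (simp add: s2[of x] mult)
  moreover have "\<alpha> [x, y, vf_mult f \<xi>] = f * \<alpha> [x, y, \<xi>]" if "f \<in> SF" "\<xi> \<in> VF" for f \<xi>
    using that V VF_vf_mult by (simp add: s3[of x y] mult)
  ultimately show "\<forall>f\<in>SF. \<forall>\<xi>\<in>VF. \<alpha> (xs[i := vf_mult f \<xi>]) = f * \<alpha> (xs[i := \<xi>])"
    using i V unfolding xs by (auto simp: mult numeral_2_eq_2)
  fix j :: nat assume j: "j < 3" "i \<noteq> j \<and> xs ! i = xs ! j"
  then have "j = 0 \<or> j = 1 \<or> j = 2" by auto
  then have "x = y \<or> y = z \<or> x = z" using i j xs by auto
  then show "\<alpha> xs = 0"
    using swap1[of x x z] swap2[of x y y] swap1[of z z y] swap2[of z y z] V xs fun_eq_uminus_self by auto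
qed (use off in blast)

text \<open>
  Pointwise, nondegeneracy makes \<open>\<xi> \<mapsto> \<omega>(\<xi>, -)\<close> injective on tangent spaces, hence surjective by
  dimension. The elimination lemma turns this into smooth local solutions \<open>\<zeta> / h\<close>. They glue since, again
  by nondegeneracy, they agree as derivations at each point: the value at \<open>q\<close> may be taken from any of
  them.
\<close>

lemma interior_onto:
  assumes \<omega>: "\<omega> \<in> forms A 2" and nd: "nondegenerate A \<omega>" and \<alpha>: "\<alpha> \<in> forms A 1"
  obtains \<xi> where "\<xi> \<in> VF" "interior \<xi> \<omega> = \<alpha>"
proof -
  have loc: "\<exists>N \<xi> h. open N \<and> p \<in> N \<and> \<xi> \<in> VF \<and> h \<in> SF \<and>
      (\<forall>q\<in>N. h q \<noteq> 0 \<and> (\<forall>\<eta>\<in>VF. \<omega> [\<xi>, \<eta>] q = h q * \<alpha> [\<eta>] q))" for p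
  proof -
    obtain N E X where fr: "frame_on N E X" and p: "p \<in> N"
      by (rule frame_exists[of p])
    have N: "open N" and E: "\<And>b. b \<in> Basis \<Longrightarrow> E b \<in> VF"
      and EX: "\<And>b c. b \<in> Basis \<Longrightarrow> c \<in> Basis \<Longrightarrow> E b (X c) p = (if b = c then 1 else 0)"
      using fr p by (auto simp: frame_on_def)
    have slot2: "\<omega> [\<zeta>, \<eta>] q = (\<Sum>b\<in>Basis. \<eta> (X b) q * \<omega> [\<zeta>, E b] q)"
      if "\<zeta> \<in> VF" "\<eta> \<in> VF" "q \<in> N" for \<zeta> \<eta> q
      by (rule tensorial[OF fr _ _ that(3,2)]) (rule form2_add2[OF \<omega> _ _ that(1)] form2_mult2[OF \<omega> _ _ that(1)]; assumption)+
    have comb: "\<omega> [\<Sum>b\<in>B. vf_mult (u b) (E b), \<eta>] = (\<Sum>b\<in>B. u b * \<omega> [E b, \<eta>])"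
      if "\<And>b. u b \<in> SF" "\<eta> \<in> VF" "B \<subseteq> Basis" for u \<eta> and B :: "'e set"
      using finite_subset[OF that(3) finite_Basis] that(3)
    proof (induction B rule: finite_induct)
      case empty
      have *: "vf_mult 0 (0 :: 'a vfield) = 0" by (simp add: vf_mult_def fun_eq_iff)
      show ?case using form2_mult1[OF \<omega> SF_0 VF_zero that(2)] unfolding * by (simp only: sum.empty mult_zero_left)
    next
      case (insert b B)
      then have b: "E b \<in> VF" and B: "\<And>c. c \<in> B \<Longrightarrow> E c \<in> VF" and "B \<subseteq> Basis" using E by auto
      have V: "vf_mult (u b) (E b) \<in> VF" "(\<Sum>b\<in>B. vf_mult (u b) (E b)) \<in> VF"
        by (intro VF_finite_sum VF_vf_mult that(1) b B; assumption)+
      show ?case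
        unfolding sum.insert[OF insert.hyps(1,2)] form2_add1[OF \<omega> V that(2)]
          form2_mult1[OF \<omega> that(1) b that(2)] insert.IH[OF \<open>B \<subseteq> Basis\<close>] ..
    qed
    have onto: "\<exists>v. \<forall>j\<in>Basis. (\<Sum>i\<in>Basis. v i * \<omega> [E i, E j] p) = w j" for w :: "'e \<Rightarrow> real"
    proof -
      define T where "T v = (\<Sum>j\<in>Basis. (\<Sum>i\<in>Basis. (v \<bullet> i) * \<omega> [E i, E j] p) *\<^sub>R j)" for v :: 'e
      have Tj: "T v \<bullet> j = (\<Sum>i\<in>Basis. (v \<bullet> i) * \<omega> [E i, E j] p)" if "j \<in> Basis" for v j
        using that by (simp add: T_def inner_sum_left inner_Basis if_distrib cong: if_cong)
      have lin: "linear T"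
        by (rule linearI; rule euclidean_eqI)
          (simp_all add: Tj inner_add_left algebra_simps sum.distrib sum_distrib_left)
      have "inj T"
      proof (subst linear_injective_0[OF lin], intro allI impI)
        fix v assume "T v = 0"
        define \<zeta> where "\<zeta> = (\<Sum>b\<in>Basis. vf_mult (\<lambda>_. v \<bullet> b) (E b))"
        have \<zeta>: "\<zeta> \<in> VF" unfolding \<zeta>_def by (intro VF_finite_sum VF_vf_mult E SF_const)
        have "\<omega> [\<zeta>, E j] p = 0" if "j \<in> Basis" for j
          using Tj[OF that, of v] \<open>T v = 0\<close> comb[OF SF_const E[OF that] subset_refl]
          by (simp add: \<zeta>_def sum_fun_apply)
        then have "\<omega> [\<zeta>, \<eta>] p = 0" if "\<eta> \<in> VF" for \<eta> using slot2[OF \<zeta> that p] by simp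
        then have z: "\<zeta> f p = 0" if "f \<in> SF" for f using nd \<zeta> that unfolding nondegenerate_def by blast
        have "v \<bullet> c = 0" if c: "c \<in> Basis" for c
        proof -
          have "\<zeta> (X c) p = (\<Sum>b\<in>Basis. (v \<bullet> b) * E b (X c) p)"
            by (simp add: \<zeta>_def sum_fun_apply vf_mult_def)
          also have "\<dots> = v \<bullet> c" using c by (simp add: EX if_distrib cong: if_cong)
          finally show ?thesis using z[of "X c"] fr c by (auto simp: frame_on_def)
        qed
        then show "v = 0" by (auto simp: euclidean_eq_iff[of v])
      qed
      then have "surj T" by (intro linear_injective_imp_surjective[OF lin] refl)
      then obtain v where v: "T v = (\<Sum>j\<in>Basis. w j *\<^sub>R j)" by (metis surjD)
      have "(\<Sum>i\<in>Basis. (v \<bullet> i) * \<omega> [E i, E j] p) = w j" if "j \<in> Basis" for j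
        using Tj[OF that, of v] that by (simp add: v inner_sum_left inner_Basis if_distrib cong: if_cong)
      then show ?thesis by blast
    qed
    obtain u h where u: "\<And>i. u i \<in> SF" and h: "h \<in> SF" "h p \<noteq> 0"
      and uh: "\<forall>j\<in>Basis. (\<Sum>i\<in>Basis. u i * \<omega> [E i, E j]) = h * \<alpha> [E j]"
      using solve_linear_system[of Basis Basis "\<lambda>i j. \<omega> [E i, E j]" "\<lambda>j. \<alpha> [E j]" p,
          OF finite_Basis finite_Basis form_SF[OF \<omega>] form_SF[OF \<alpha>] onto] by blast
    obtain M where M: "open M" "p \<in> M" "\<forall>q\<in>M. h q \<noteq> 0"
      using SF_nonzero_open[OF h] by metis
    define \<zeta> where "\<zeta> = (\<Sum>b\<in>Basis. vf_mult (u b) (E b))"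
    have \<zeta>: "\<zeta> \<in> VF" unfolding \<zeta>_def by (intro VF_finite_sum VF_vf_mult E u)
    have "\<omega> [\<zeta>, \<eta>] q = h q * \<alpha> [\<eta>] q" if q: "q \<in> N" and \<eta>: "\<eta> \<in> VF" for q \<eta>
    proof -
      have e: "\<omega> [\<zeta>, E j] = h * \<alpha> [E j]" if "j \<in> Basis" for j
        using comb[OF u E[OF that] subset_refl] uh that by (simp add: \<zeta>_def)
      have "\<omega> [\<zeta>, \<eta>] q = (\<Sum>b\<in>Basis. h q * (\<eta> (X b) q * \<alpha> [E b] q))"
        unfolding slot2[OF \<zeta> \<eta> q] by (rule sum.cong) (simp_all add: e)
      moreover have "\<alpha> [\<eta>] q = (\<Sum>b\<in>Basis. \<eta> (X b) q * \<alpha> [E b] q)"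
        by (rule tensorial[OF fr _ _ q \<eta>]) (rule form1_add[OF \<alpha>] form1_mult[OF \<alpha>]; assumption)+
      ultimately show ?thesis by (simp add: sum_distrib_left)
    qed
    then show ?thesis
      using N p M \<zeta> h by (intro exI[of _ "N \<inter> M"] exI[of _ \<zeta>] exI[of _ h]) auto
  qed
  define P where "P p N \<xi> h \<longleftrightarrow> open N \<and> p \<in> N \<and> \<xi> \<in> VF \<and> h \<in> SF \<and>
      (\<forall>q\<in>N. h q \<noteq> 0 \<and> (\<forall>\<eta>\<in>VF. \<omega> [\<xi>, \<eta>] q = h q * \<alpha> [\<eta>] q))" for p N \<xi> h
  obtain N \<zeta> h where "\<And>p. P p (N p) (\<zeta> p) (h p)"
    using loc unfolding P_def[symmetric] by metis
  then have N: "open (N p)" "p \<in> N p" and \<zeta>: "\<zeta> p \<in> VF" and h: "h p \<in> SF"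
    and hq: "q \<in> N p \<Longrightarrow> h p q \<noteq> 0"
    and eq: "q \<in> N p \<Longrightarrow> \<eta> \<in> VF \<Longrightarrow> \<omega> [\<zeta> p, \<eta>] q = h p q * \<alpha> [\<eta>] q" for p q \<eta>
    unfolding P_def by auto
  define \<xi> where "\<xi> f = (if f \<in> SF then (\<lambda>q. \<zeta> q f q / h q q) else 0)" for f
  have unique: "\<xi> f q = \<zeta> p f q / h p q" if q: "q \<in> N p" and f: "f \<in> SF" for p q f
  proof -
    \<comment> \<open>Two solutions cross-multiplied by the values at \<open>q\<close> of their denominators: their
    difference is annihilated by \<open>\<omega>\<close> at \<open>q\<close>.\<close>
    let ?\<theta> = "vf_mult (\<lambda>_. h p q) (\<zeta> q) + vf_mult (\<lambda>_. - h q q) (\<zeta> p)"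
    have \<theta>: "?\<theta> \<in> VF" by (intro VF_plus VF_vf_mult SF_const \<zeta>)
    have "\<omega> [?\<theta>, \<eta>] q = 0" if "\<eta> \<in> VF" for \<eta>
      using that
      by (simp add: form2_add1[OF \<omega>] form2_mult1[OF \<omega>] VF_vf_mult \<zeta> eq[OF q] eq[OF N(2)])
    then have "?\<theta> f q = 0" using nd \<theta> f unfolding nondegenerate_def by blast
    then show ?thesis using hq[OF q] hq[OF N(2)] f
      by (simp add: \<xi>_def vf_mult_def field_simps)
  qed
  have \<xi>: "\<xi> \<in> VF"
  proof (rule VF_I)
    fix f g :: "'a \<Rightarrow> real" and r :: real
    assume f: "f \<in> SF"
    show "\<xi> f \<in> SF"
    proof (rule SF_divide_local)
      fix p
      show "\<exists>N g h. open N \<and> p \<in> N \<and> g \<in> SF \<and> h \<in> SF \<and> (\<forall>q\<in>N. h q \<noteq> 0 \<and> \<xi> f q = g q / h q)"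
        using N[of p] VF_SF[OF \<zeta>[of p], of f] h[of p] hq[of _ p] unique[OF _ f, of _ p]
        by (intro exI[of _ "N p"] exI[of _ "\<zeta> p f"] exI[of _ "h p"]) auto
    qed
    show "\<xi> (\<lambda>x. r * f x) = (\<lambda>x. r * \<xi> f x)"
      using f SF_scale[OF f, of r] by (simp add: \<xi>_def fun_eq_iff VF_scale[OF \<zeta> f])
    assume g: "g \<in> SF"
    show "\<xi> (f + g) = \<xi> f + \<xi> g"
      using f g SF_add[OF f g] by (simp add: \<xi>_def fun_eq_iff VF_add[OF \<zeta> f g] add_divide_distrib)
    show "\<xi> (f * g) = \<xi> f * g + f * \<xi> g"
      using f g SF_mult[OF f g] by (simp add: \<xi>_def fun_eq_iff VF_mult[OF \<zeta> f g] add_divide_distrib)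
  qed (simp add: \<xi>_def)
  have eq': "\<omega> [\<xi>, \<eta>] q = \<alpha> [\<eta>] q" if \<eta>: "\<eta> \<in> VF" for \<eta> q
  proof -
    obtain M E X where fr: "frame_on M E X" and q: "q \<in> M" by (rule frame_exists[of q])
    have "\<omega> [\<theta>, \<eta>] q = (\<Sum>b\<in>Basis. \<theta> (X b) q * \<omega> [E b, \<eta>] q)" if "\<theta> \<in> VF" for \<theta>
      by (rule tensorial[OF fr _ _ q that]) (rule form2_add1[OF \<omega> _ _ \<eta>] form2_mult1[OF \<omega> _ _ \<eta>]; assumption)+
    note slot1 = this
    have "\<omega> [\<xi>, \<eta>] q = (\<Sum>b\<in>Basis. \<zeta> q (X b) q * \<omega> [E b, \<eta>] q / h q q)"
      unfolding slot1[OF \<xi>] using fr by (intro sum.cong) (auto simp: \<xi>_def frame_on_def)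
    also have "\<dots> = \<omega> [\<zeta> q, \<eta>] q / h q q"
      unfolding slot1[OF \<zeta>] by (simp add: sum_divide_distrib)
    also have "\<dots> = \<alpha> [\<eta>] q" using eq[OF N(2) \<eta>] hq[OF N(2)] by simp
    finally show ?thesis .
  qed
  have "\<omega> (\<xi> # xs) = \<alpha> xs" for xs
  proof (cases "length xs = 1 \<and> set xs \<subseteq> VF")
    case True
    then obtain \<eta> where "xs = [\<eta>]" "\<eta> \<in> VF" by (auto simp: length_Suc_conv)
    then show ?thesis using eq' by auto
  next
    case False
    then show ?thesis using form_off[OF \<alpha>] form_off[OF \<omega>, of "\<xi> # xs"] by auto
  qed
  then show ?thesis using that[OF \<xi>] by (simp add: interior_def fun_eq_iff)
qed

section \<open>Explicit formulas for brackets, derivatives and wedge products\<close>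

lemma SF_pointwise:
  shows "f \<in> SF \<Longrightarrow> g \<in> SF \<Longrightarrow> (\<lambda>p. f p + g p) \<in> SF"
    and "f \<in> SF \<Longrightarrow> g \<in> SF \<Longrightarrow> (\<lambda>p. f p - g p) \<in> SF"
    and "f \<in> SF \<Longrightarrow> g \<in> SF \<Longrightarrow> (\<lambda>p. f p * g p) \<in> SF"
    and "f \<in> SF \<Longrightarrow> (\<lambda>p. - f p) \<in> SF"
  using SF_add[of f g] SF_diff[of f g] SF_mult[of f g] SF_uminus[of f]
  by (simp_all add: plus_fun_def fun_diff_def times_fun_def fun_Compl_def)

lemma VF_pointwise:
  assumes "x \<in> VF"
  shows "f \<in> SF \<Longrightarrow> g \<in> SF \<Longrightarrow> x (\<lambda>p. f p + g p) = (\<lambda>p. x f p + x g p)"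
    and "f \<in> SF \<Longrightarrow> g \<in> SF \<Longrightarrow> x (\<lambda>p. f p - g p) = (\<lambda>p. x f p - x g p)"
    and "f \<in> SF \<Longrightarrow> g \<in> SF \<Longrightarrow> x (\<lambda>p. f p * g p) = (\<lambda>p. x f p * g p + f p * x g p)"
    and "f \<in> SF \<Longrightarrow> x (\<lambda>p. - f p) = (\<lambda>p. - x f p)"
  using VF_add[OF assms, of f g] VF_diff[OF assms, of f g] VF_mult[OF assms, of f g] VF_uminus[OF assms, of f]
  by (simp_all add: plus_fun_def fun_diff_def times_fun_def fun_Compl_def)

lemma VF_zero_fun: "x \<in> VF \<Longrightarrow> x (\<lambda>_. 0) = (\<lambda>_. 0)"
  using VF_const[of x 0] by (simp add: zero_fun_def)

lemma vf_eqI: "x \<in> VF \<Longrightarrow> y \<in> VF \<Longrightarrow> (\<And>f p. f \<in> SF \<Longrightarrow> x f p = y f p) \<Longrightarrow> x = y"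
  by (intro ext) (metis VF_off)

lemma lie_apply: "lie_bracket x y f = (\<lambda>p. x (y f) p - y (x f) p)"
  by (simp add: lie_bracket_def fun_diff_def)

lemma lie_bracket_antisym: "lie_bracket y x = vf_mult (\<lambda>_. - 1) (lie_bracket x y)"
  by (simp add: lie_bracket_def vf_mult_def fun_eq_iff)

lemma lie_bracket_add: 
  assumes "x \<in> VF" "x' \<in> VF" "y \<in> VF"
  shows "lie_bracket (x + x') y = lie_bracket x y + lie_bracket x' y"
proof (rule vf_eqI)
  fix f p assume "f \<in> SF"
  show "lie_bracket (x + x') y f p = (lie_bracket x y + lie_bracket x' y) f p"
    unfolding lie_apply plus_fun_def using assms
    by (simp add: lie_apply VF_pointwise[OF assms(3)] VF_SF)
qed (use assms in auto)

lemma lie_bracket_vf_mult: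
  assumes "f \<in> SF" "x \<in> VF" "y \<in> VF"
  shows "lie_bracket (vf_mult f x) y = vf_mult f (lie_bracket x y) + vf_mult (\<lambda>p. - y f p) x"
proof (rule vf_eqI)
  fix g p assume "g \<in> SF"
  show "lie_bracket (vf_mult f x) y g p = (vf_mult f (lie_bracket x y) + vf_mult (\<lambda>p. - y f p) x) g p"
    unfolding lie_apply plus_fun_def vf_mult_def times_fun_def using assms
    by (simp add: VF_pointwise[OF assms(3)] VF_SF algebra_simps lie_apply)
qed (use assms in \<open>auto intro!: SF_pointwise VF_SF\<close>)

lemma jacobi:
  assumes "x \<in> VF" "y \<in> VF" "z \<in> VF"
  shows "lie_bracket (lie_bracket x z) y = lie_bracket (lie_bracket x y) z + lie_bracket (lie_bracket y z) x"
proof (rule vf_eqI)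
  fix g p assume "g \<in> SF"
  show "lie_bracket (lie_bracket x z) y g p = (lie_bracket (lie_bracket x y) z + lie_bracket (lie_bracket y z) x) g p"
    unfolding lie_apply plus_fun_def using assms
    by (simp add: VF_pointwise[OF assms(1)] VF_pointwise[OF assms(2)] VF_pointwise[OF assms(3)] VF_SF lie_apply)
qed (use assms in auto)

lemma form_pointwise1:
  assumes \<alpha>: "\<alpha> \<in> forms A 1" and "x \<in> VF"
  shows "y \<in> VF \<Longrightarrow> \<alpha> [x + y] p = \<alpha> [x] p + \<alpha> [y] p"
    and "f \<in> SF \<Longrightarrow> \<alpha> [vf_mult f x] p = f p * \<alpha> [x] p"
  using form1_add[OF \<alpha>, of x y] form1_mult[OF \<alpha>, of f x] assms(2) by (simp_all add: fun_eq_iff)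

lemma form_pointwise2:
  assumes \<omega>: "\<omega> \<in> forms A 2" and "x \<in> VF" "y \<in> VF"
  shows "z \<in> VF \<Longrightarrow> \<omega> [x + y, z] p = \<omega> [x, z] p + \<omega> [y, z] p"
    and "f \<in> SF \<Longrightarrow> \<omega> [vf_mult f x, y] p = f p * \<omega> [x, y] p"
    and "\<omega> [y, x] = (\<lambda>p. - \<omega> [x, y] p)"
  using form2_add1[OF \<omega>, of x y z] form2_mult1[OF \<omega>, of f x y] form2_antisym[OF \<omega>, of x y] assms(2,3)
  by (simp_all add: fun_eq_iff)

lemma form_lie_antisym: "\<alpha> \<in> forms A 1 \<Longrightarrow> x \<in> VF \<Longrightarrow> y \<in> VF \<Longrightarrow> \<alpha> [lie_bracket y x] p = - \<alpha> [lie_bracket x y] p"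
  by (subst lie_bracket_antisym, subst form_pointwise1(2)) auto

lemma ext_deriv_1: "x \<in> VF \<Longrightarrow> ext_deriv A \<alpha> [x] = (\<lambda>p. x (\<alpha> []) p)"
  by (simp add: ext_deriv_def drop_nth_def fun_eq_iff)

lemma ext_deriv_2: "x \<in> VF \<Longrightarrow> y \<in> VF \<Longrightarrow>
    ext_deriv A \<alpha> [x, y] = (\<lambda>p. x (\<alpha> [y]) p - y (\<alpha> [x]) p - \<alpha> [lie_bracket x y] p)"
  by (simp add: ext_deriv_def drop_nth_def fun_eq_iff lessThan_Suc)

lemma ext_deriv_3: "x \<in> VF \<Longrightarrow> y \<in> VF \<Longrightarrow> z \<in> VF \<Longrightarrow>
    ext_deriv A \<alpha> [x, y, z] = (\<lambda>p. x (\<alpha> [y, z]) p - y (\<alpha> [x, z]) p + z (\<alpha> [x, y]) p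
      - \<alpha> [lie_bracket x y, z] p + \<alpha> [lie_bracket x z, y] p - \<alpha> [lie_bracket y z, x] p)"
  by (simp add: ext_deriv_def drop_nth_def fun_eq_iff lessThan_Suc numeral_2_eq_2 algebra_simps)

lemma ext_deriv_4: "w \<in> VF \<Longrightarrow> x \<in> VF \<Longrightarrow> y \<in> VF \<Longrightarrow> z \<in> VF \<Longrightarrow>
    ext_deriv A \<alpha> [w, x, y, z] = (\<lambda>p. w (\<alpha> [x, y, z]) p - x (\<alpha> [w, y, z]) p + y (\<alpha> [w, x, z]) p - z (\<alpha> [w, x, y]) p
      - \<alpha> [lie_bracket w x, y, z] p + \<alpha> [lie_bracket w y, x, z] p - \<alpha> [lie_bracket w z, x, y] p
      - \<alpha> [lie_bracket x y, w, z] p + \<alpha> [lie_bracket x z, w, y] p - \<alpha> [lie_bracket y z, w, x] p)"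
  by (simp add: ext_deriv_def drop_nth_def fun_eq_iff lessThan_Suc numeral_2_eq_2 numeral_3_eq_3 algebra_simps)

lemma wedge1_2: "wedge1 \<beta> \<alpha> [x, y] = (\<lambda>p. \<beta> [x] p * \<alpha> [y] p - \<beta> [y] p * \<alpha> [x] p)"
  by (simp add: wedge1_def drop_nth_def lessThan_Suc fun_eq_iff)

lemma wedge1_3: "wedge1 \<beta> \<alpha> [x, y, z] =
    (\<lambda>p. \<beta> [x] p * \<alpha> [y, z] p - \<beta> [y] p * \<alpha> [x, z] p + \<beta> [z] p * \<alpha> [x, y] p)"
  by (simp add: wedge1_def drop_nth_def lessThan_Suc fun_eq_iff numeral_2_eq_2)

lemma wedge1_4: "wedge1 \<beta> \<alpha> [w, x, y, z] =
    (\<lambda>p. \<beta> [w] p * \<alpha> [x, y, z] p - \<beta> [x] p * \<alpha> [w, y, z] p + \<beta> [y] p * \<alpha> [w, x, z] p - \<beta> [z] p * \<alpha> [w, x, y] p)"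
  by (simp add: wedge1_def drop_nth_def lessThan_Suc fun_eq_iff numeral_2_eq_2 numeral_3_eq_3)

text \<open>
  The convention that a form of degree \<open>k\<close> vanishes off \<open>k\<close>-tuples of vector fields. It is separated from
  multilinearity since it alone reduces equality of forms to evaluation on vector fields.
\<close>

definition supported :: "nat \<Rightarrow> 'a form \<Rightarrow> bool" where
  "supported k \<alpha> \<longleftrightarrow> (\<forall>xs. \<not> (length xs = k \<and> set xs \<subseteq> VF) \<longrightarrow> \<alpha> xs = 0)"

lemma supported_form: "\<alpha> \<in> forms A k \<Longrightarrow> supported k \<alpha>"
  unfolding supported_def by (blast intro: form_off)

lemma supported_0: "supported k 0"
  by (simp add: supported_def)

lemma supported_add: "supported k \<alpha> \<Longrightarrow> supported k \<beta> \<Longrightarrow> supported k (\<alpha> + \<beta>)"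
  by (simp add: supported_def)

lemma supported_diff: "supported k \<alpha> \<Longrightarrow> supported k \<beta> \<Longrightarrow> supported k (\<alpha> - \<beta>)"
  by (simp add: supported_def)

lemma supported_form_mult: "supported k \<alpha> \<Longrightarrow> supported k (form_mult f \<alpha>)"
  by (simp add: supported_def form_mult_def)

lemma length_drop_nth: "i < length xs \<Longrightarrow> length (drop_nth i xs) = length xs - 1"
  by (simp add: drop_nth_def)

lemma supported_ext_deriv:
  assumes \<alpha>: "supported k \<alpha>"
  shows "supported (Suc k) (ext_deriv A \<alpha>)"
  unfolding supported_def
proof (intro allI impI)
  fix xs :: "'a vfield list" assume xs: "\<not> (length xs = Suc k \<and> set xs \<subseteq> VF)"
  show "ext_deriv A \<alpha> xs = 0"
  proof (cases "set xs \<subseteq> VF")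
    case True
    then have l: "length xs \<noteq> Suc k" using xs by simp
    have 1: "(xs ! i) (\<alpha> (drop_nth i xs)) = 0" if "i < length xs" for i
    proof -
      have "xs ! i \<in> VF" using that True by auto
      moreover have "length (drop_nth i xs) \<noteq> k" using that l by (simp add: length_drop_nth)
      then have "\<alpha> (drop_nth i xs) = 0" using \<alpha> unfolding supported_def by blast
      ultimately show ?thesis using VF_0 by metis
    qed
    have 2: "\<alpha> (u # drop_nth i (drop_nth j xs)) = 0" if "j < length xs" "i < j" for u i j
    proof -
      have "length (u # drop_nth i (drop_nth j xs)) \<noteq> k"
        using that l by (simp add: length_drop_nth)
      then show ?thesis using \<alpha> unfolding supported_def by blast
    qed
    show ?thesis using True by (simp add: ext_deriv_def fun_eq_iff 1 2)
  next
    case False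
    then show ?thesis by (simp add: ext_deriv_def fun_eq_iff)
  qed
qed

lemma supported_wedge1:
  assumes \<alpha>: "supported k \<alpha>" and \<beta>: "supported 1 \<beta>"
  shows "supported (Suc k) (wedge1 \<beta> \<alpha>)"
  unfolding supported_def
proof (intro allI impI)
  fix xs :: "'a vfield list" assume xs: "\<not> (length xs = Suc k \<and> set xs \<subseteq> VF)"
  have "\<beta> [xs ! i] = 0 \<or> \<alpha> (drop_nth i xs) = 0" if i: "i < length xs" for i
  proof (cases "xs ! i \<in> VF \<and> set (drop_nth i xs) \<subseteq> VF")
    case True
    have "set xs \<subseteq> VF"
    proof
      fix v assume "v \<in> set xs"
      then have "v \<in> set (take i xs @ xs ! i # drop (Suc i) xs)"
        using id_take_nth_drop[OF i] by simp
      then show "v \<in> VF" using True by (auto simp: drop_nth_def)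
    qed
    then have "length (drop_nth i xs) \<noteq> k" using xs i by (auto simp: length_drop_nth)
    then show ?thesis using \<alpha> unfolding supported_def by blast
  next
    case False
    then show ?thesis using \<alpha> \<beta> unfolding supported_def by (metis list.simps(15) insert_subset)
  qed
  then have "\<beta> [xs ! i] p * \<alpha> (drop_nth i xs) p = 0" if "i < length xs" for i p
    using that by fastforce
  then have "wedge1 \<beta> \<alpha> xs p = 0" for p
    unfolding wedge1_def mult.assoc by (intro sum.neutral) simp
  then show "wedge1 \<beta> \<alpha> xs = 0" by (simp add: fun_eq_iff)
qed

lemma form_eqI:
  assumes "supported k \<alpha>" "supported k \<beta>"
    and "\<And>xs p. length xs = k \<Longrightarrow> set xs \<subseteq> VF \<Longrightarrow> \<alpha> xs p = \<beta> xs p"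
  shows "\<alpha> = \<beta>"
proof (intro ext)
  fix xs p
  show "\<alpha> xs p = \<beta> xs p"
    by (cases "length xs = k \<and> set xs \<subseteq> VF") (use assms in \<open>auto simp: supported_def\<close>)
qed

lemma form1_eqI:
  assumes "supported 1 \<alpha>" "supported 1 \<beta>" "\<And>x p. x \<in> VF \<Longrightarrow> \<alpha> [x] p = \<beta> [x] p"
  shows "\<alpha> = \<beta>"
  by (rule form_eqI[OF assms(1,2)]) (auto simp: length_Suc_conv assms(3))

lemma form2_eqI:
  assumes "supported 2 \<alpha>" "supported 2 \<beta>"
    and "\<And>x y p. x \<in> VF \<Longrightarrow> y \<in> VF \<Longrightarrow> \<alpha> [x, y] p = \<beta> [x, y] p"
  shows "\<alpha> = \<beta>"
  by (rule form_eqI[OF assms(1,2)]) (auto simp: length_Suc_conv numeral_2_eq_2 assms(3))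

lemma form3_eqI:
  assumes "supported 3 \<alpha>" "supported 3 \<beta>"
    and "\<And>x y z p. x \<in> VF \<Longrightarrow> y \<in> VF \<Longrightarrow> z \<in> VF \<Longrightarrow> \<alpha> [x, y, z] p = \<beta> [x, y, z] p"
  shows "\<alpha> = \<beta>"
  by (rule form_eqI[OF assms(1,2)]) (auto simp: length_Suc_conv numeral_3_eq_3 assms(3))

lemma form4_eqI:
  assumes "supported 4 \<alpha>" "supported 4 \<beta>"
    and "\<And>w x y z p. w \<in> VF \<Longrightarrow> x \<in> VF \<Longrightarrow> y \<in> VF \<Longrightarrow> z \<in> VF \<Longrightarrow>
      \<alpha> [w, x, y, z] p = \<beta> [w, x, y, z] p"
  shows "\<alpha> = \<beta>"
  by (rule form_eqI[OF assms(1,2)]) (auto simp: length_Suc_conv eval_nat_numeral assms(3))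

section \<open>Linearity\<close>

lemma forms_I:
  assumes "supported k \<alpha>"
    and "\<And>xs. length xs = k \<Longrightarrow> set xs \<subseteq> VF \<Longrightarrow> \<alpha> xs \<in> SF"
    and "\<And>xs i \<xi> \<eta>. length xs = k \<Longrightarrow> set xs \<subseteq> VF \<Longrightarrow> i < k \<Longrightarrow> \<xi> \<in> VF \<Longrightarrow> \<eta> \<in> VF \<Longrightarrow>
       \<alpha> (xs[i := \<xi> + \<eta>]) = \<alpha> (xs[i := \<xi>]) + \<alpha> (xs[i := \<eta>])"
    and "\<And>xs i f \<xi>. length xs = k \<Longrightarrow> set xs \<subseteq> VF \<Longrightarrow> i < k \<Longrightarrow> f \<in> SF \<Longrightarrow> \<xi> \<in> VF \<Longrightarrow>
       \<alpha> (xs[i := vf_mult f \<xi>]) = f * \<alpha> (xs[i := \<xi>])"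
    and "\<And>xs i j. length xs = k \<Longrightarrow> set xs \<subseteq> VF \<Longrightarrow> i < k \<Longrightarrow> j < k \<Longrightarrow> i \<noteq> j \<Longrightarrow> xs ! i = xs ! j \<Longrightarrow> \<alpha> xs = 0"
  shows "\<alpha> \<in> forms A k"
  unfolding forms_def using assms by (simp add: supported_def)

lemma forms_add:
  assumes "\<alpha> \<in> forms A k" "\<beta> \<in> forms A k"
  shows "\<alpha> + \<beta> \<in> forms A k"
proof (rule forms_I)
  fix xs :: "'a vfield list" and i j :: nat and \<xi> \<eta> :: "'a vfield" and f :: "'a \<Rightarrow> real"
  assume xs: "length xs = k" "set xs \<subseteq> VF"
  show "(\<alpha> + \<beta>) xs \<in> SF" unfolding plus_fun_apply[of \<alpha> \<beta>] by (intro SF_add form_SF[OF assms(1)] form_SF[OF assms(2)])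
  assume i: "i < k"
  note s1 = form_slot[OF assms(1) xs i] and s2 = form_slot[OF assms(2) xs i]
  { assume "\<xi> \<in> VF" "\<eta> \<in> VF"
    then show "(\<alpha> + \<beta>) (xs[i := \<xi> + \<eta>]) = (\<alpha> + \<beta>) (xs[i := \<xi>]) + (\<alpha> + \<beta>) (xs[i := \<eta>])"
      unfolding plus_fun_apply[of \<alpha> \<beta>] by (simp only: s1(1) s2(1) ac_simps) }
  { assume "f \<in> SF" "\<xi> \<in> VF"
    then show "(\<alpha> + \<beta>) (xs[i := vf_mult f \<xi>]) = f * (\<alpha> + \<beta>) (xs[i := \<xi>])"
      unfolding plus_fun_apply[of \<alpha> \<beta>] by (simp only: s1(2) s2(2) distrib_left) }
  { assume "j < k" "i \<noteq> j" "xs ! i = xs ! j"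
    then show "(\<alpha> + \<beta>) xs = 0"
      unfolding plus_fun_apply[of \<alpha> \<beta>] by (metis s1(3) s2(3) add_0) }
qed (intro supported_add supported_form assms)

lemma forms_mult:
  assumes g: "g \<in> SF" and \<alpha>: "\<alpha> \<in> forms A k"
  shows "form_mult g \<alpha> \<in> forms A k"
proof (rule forms_I)
  fix xs :: "'a vfield list" and i j :: nat and \<xi> \<eta> :: "'a vfield" and f :: "'a \<Rightarrow> real"
  assume xs: "length xs = k" "set xs \<subseteq> VF"
  show "form_mult g \<alpha> xs \<in> SF" unfolding form_mult_def by (intro SF_mult form_SF[OF \<alpha>] g)
  assume i: "i < k"
  note s1 = form_slot[OF \<alpha> xs i]
  { assume "\<xi> \<in> VF" "\<eta> \<in> VF"
    then show "form_mult g \<alpha> (xs[i := \<xi> + \<eta>]) = form_mult g \<alpha> (xs[i := \<xi>]) + form_mult g \<alpha> (xs[i := \<eta>])"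
      unfolding form_mult_def by (simp only: s1(1) distrib_left) }
  { assume "f \<in> SF" "\<xi> \<in> VF"
    then show "form_mult g \<alpha> (xs[i := vf_mult f \<xi>]) = f * form_mult g \<alpha> (xs[i := \<xi>])"
      unfolding form_mult_def by (simp only: s1(2) ac_simps) }
  { assume "j < k" "i \<noteq> j" "xs ! i = xs ! j"
    then show "form_mult g \<alpha> xs = 0"
      unfolding form_mult_def by (metis s1(3) mult_zero_right) }
qed (intro supported_form_mult supported_form \<alpha>)

lemma forms_scale: "\<alpha> \<in> forms A k \<Longrightarrow> form_scale r \<alpha> \<in> forms A k"
  unfolding form_scale_def by (rule forms_mult[OF SF_const])

lemma forms_0: "0 \<in> forms A k"
  by (simp add: forms_def)

lemma ext_deriv_add:
  assumes \<alpha>: "\<alpha> \<in> forms A k" and \<beta>: "\<beta> \<in> forms A k"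
  shows "ext_deriv A (\<alpha> + \<beta>) = ext_deriv A \<alpha> + ext_deriv A \<beta>"
proof (intro ext)
  fix xs p
  show "ext_deriv A (\<alpha> + \<beta>) xs p = (ext_deriv A \<alpha> + ext_deriv A \<beta>) xs p"
  proof (cases "set xs \<subseteq> VF")
    case True
    have "(xs ! i) (\<alpha> ys + \<beta> ys) p = (xs ! i) (\<alpha> ys) p + (xs ! i) (\<beta> ys) p" if "i < length xs" for i ys
      using True that VF_add[of "xs ! i", OF _ form_SF[OF \<alpha>] form_SF[OF \<beta>]] by (auto simp: subset_iff)
    then have "(\<Sum>i<length xs. (-1) ^ i * (xs ! i) (\<alpha> (drop_nth i xs) + \<beta> (drop_nth i xs)) p)
       = (\<Sum>i<length xs. (-1) ^ i * (xs ! i) (\<alpha> (drop_nth i xs)) p)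
         + (\<Sum>i<length xs. (-1) ^ i * (xs ! i) (\<beta> (drop_nth i xs)) p)"
      unfolding sum.distrib[symmetric] by (intro sum.cong) (auto simp: distrib_left)
    then show ?thesis using True
      unfolding ext_deriv_def plus_fun_apply if_P[OF True] by (simp only: distrib_left sum.distrib)
  qed (simp add: ext_deriv_def)
qed

lemma form_scale_apply: "form_scale r \<alpha> xs p = r * \<alpha> xs p"
  by (simp add: form_scale_def form_mult_def)

lemma ext_deriv_scale:
  assumes \<alpha>: "\<alpha> \<in> forms A k"
  shows "ext_deriv A (form_scale r \<alpha>) = form_scale r (ext_deriv A \<alpha>)"
proof (intro ext)
  fix xs p
  show "ext_deriv A (form_scale r \<alpha>) xs p = form_scale r (ext_deriv A \<alpha>) xs p"
  proof (cases "set xs \<subseteq> VF")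
    case True
    have "(xs ! i) (form_scale r \<alpha> ys) p = r * (xs ! i) (\<alpha> ys) p" if "i < length xs" for i ys
    proof -
      have "xs ! i \<in> VF" using True that by auto
      from VF_scale[OF this form_SF[OF \<alpha>], of r ys] show ?thesis
        by (simp add: form_scale_def form_mult_def times_fun_def)
    qed
    then have "(\<Sum>i<length xs. (-1) ^ i * (xs ! i) (form_scale r \<alpha> (drop_nth i xs)) p)
       = r * (\<Sum>i<length xs. (-1) ^ i * (xs ! i) (\<alpha> (drop_nth i xs)) p)"
      unfolding sum_distrib_left by (intro sum.cong) auto
    then show ?thesis using True
      by (simp add: ext_deriv_def form_scale_apply sum_distrib_left algebra_simps)
  qed (simp add: ext_deriv_def form_scale_apply)
qed

lemma wedge1_add_right: "wedge1 \<beta> (\<alpha> + \<alpha>') = wedge1 \<beta> \<alpha> + wedge1 \<beta> \<alpha>'"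
  by (simp add: wedge1_def fun_eq_iff sum.distrib[symmetric] algebra_simps)

lemma wedge1_scale_right: "wedge1 \<beta> (form_scale r \<alpha>) = form_scale r (wedge1 \<beta> \<alpha>)"
  by (simp add: wedge1_def fun_eq_iff form_scale_def form_mult_def sum_distrib_left algebra_simps)

lemma wedge1_add_left: "wedge1 (\<beta> + \<beta>') \<alpha> = wedge1 \<beta> \<alpha> + wedge1 \<beta>' \<alpha>"
  by (simp add: wedge1_def fun_eq_iff sum.distrib[symmetric] algebra_simps)

lemma wedge1_scale_left: "wedge1 (form_scale r \<beta>) \<alpha> = form_scale r (wedge1 \<beta> \<alpha>)"
  by (simp add: wedge1_def fun_eq_iff form_scale_def form_mult_def sum_distrib_left algebra_simps)

lemma form_scale_add: "form_scale r (\<alpha> + \<beta>) = form_scale r \<alpha> + form_scale r \<beta>"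
  by (simp add: form_scale_def form_mult_def fun_eq_iff algebra_simps)

lemma twisted_deriv_add:
  "\<alpha> \<in> forms A k \<Longrightarrow> \<beta> \<in> forms A k \<Longrightarrow>
    twisted_deriv A b (\<alpha> + \<beta>) = twisted_deriv A b \<alpha> + twisted_deriv A b \<beta>"
  unfolding twisted_deriv_def by (simp only: ext_deriv_add wedge1_add_right ac_simps)

lemma twisted_deriv_scale:
  "\<alpha> \<in> forms A k \<Longrightarrow> twisted_deriv A b (form_scale r \<alpha>) = form_scale r (twisted_deriv A b \<alpha>)"
  unfolding twisted_deriv_def by (simp only: ext_deriv_scale wedge1_scale_right form_scale_add)

lemma supported_twisted_deriv:
  "supported k \<alpha> \<Longrightarrow> supported 1 b \<Longrightarrow> supported (Suc k) (twisted_deriv A b \<alpha>)"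
  unfolding twisted_deriv_def by (intro supported_add supported_ext_deriv supported_wedge1)

section \<open>The twisted complex and Cartan's formulas\<close>

text \<open>
  Koszul's formula is \<open>C\<^sup>\<infinity>\<close>-linear because the term \<open>z f \<cdot> \<alpha>(x)\<close> produced by the Leibniz rule cancels
  against the one in \<open>[f x, z] = f [x, z] - (z f) x\<close>.
\<close>

lemma ext_deriv_form1:
  assumes \<alpha>: "\<alpha> \<in> forms A 1"
  shows "ext_deriv A \<alpha> \<in> forms A 2"
proof (rule forms2_I)
  show "ext_deriv A \<alpha> xs = 0" if "\<not> (length xs = 2 \<and> set xs \<subseteq> VF)" for xs
    using supported_ext_deriv[OF supported_form[OF \<alpha>]] that
    unfolding supported_def numeral_2_eq_2 One_nat_def by blast
  fix x y z :: "'a vfield" and f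
  assume V: "x \<in> VF" "y \<in> VF"
  show "ext_deriv A \<alpha> [x, y] \<in> SF"
    unfolding ext_deriv_2[OF V] using V by (intro SF_pointwise VF_SF form_SF[OF \<alpha>])
  show "ext_deriv A \<alpha> [y, x] = - ext_deriv A \<alpha> [x, y]"
    using V by (simp add: ext_deriv_2 fun_eq_iff form_lie_antisym[OF \<alpha>, of x y])
  assume z: "z \<in> VF"
  show "ext_deriv A \<alpha> [x + y, z] = ext_deriv A \<alpha> [x, z] + ext_deriv A \<alpha> [y, z]"
  proof
    fix p
    have "z (\<alpha> [x + y]) p = z (\<alpha> [x]) p + z (\<alpha> [y]) p"
      unfolding form1_add[OF \<alpha> V] VF_add[OF z form_SF[OF \<alpha>] form_SF[OF \<alpha>]] by simp
    moreover have "\<alpha> [lie_bracket (x + y) z] p = \<alpha> [lie_bracket x z] p + \<alpha> [lie_bracket y z] p"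
      unfolding lie_bracket_add[OF V z] by (rule form_pointwise1(1)[OF \<alpha>]) (use V z in auto)
    ultimately show "ext_deriv A \<alpha> [x + y, z] p = (ext_deriv A \<alpha> [x, z] + ext_deriv A \<alpha> [y, z]) p"
      by (simp only: ext_deriv_2[OF VF_plus[OF V] z] ext_deriv_2[OF V(1) z] ext_deriv_2[OF V(2) z] plus_fun_apply)
  qed
  assume f: "f \<in> SF"
  show "ext_deriv A \<alpha> [vf_mult f x, z] = f * ext_deriv A \<alpha> [x, z]"
  proof
    fix p
    have 1: "z (\<alpha> [vf_mult f x]) p = z f p * \<alpha> [x] p + f p * z (\<alpha> [x]) p"
      unfolding form1_mult[OF \<alpha> f V(1)] VF_mult[OF z f form_SF[OF \<alpha>]] by simp
    have g: "(\<lambda>p. - z f p) \<in> SF" using SF_pointwise(4)[OF VF_SF[OF z]] .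
    have 2: "\<alpha> [lie_bracket (vf_mult f x) z] p = f p * \<alpha> [lie_bracket x z] p - z f p * \<alpha> [x] p"
      unfolding lie_bracket_vf_mult[OF f V(1) z]
      by (subst form_pointwise1(1)[OF \<alpha>]) (use V z f g in \<open>auto simp: form_pointwise1(2)[OF \<alpha>] VF_bracket\<close>)
    show "ext_deriv A \<alpha> [vf_mult f x, z] p = (f * ext_deriv A \<alpha> [x, z]) p"
      unfolding ext_deriv_2[OF VF_vf_mult[OF f V(1)] z] ext_deriv_2[OF V(1) z] 1 2
      by (simp add: vf_mult_def algebra_simps)
  qed
qed

lemma wedge1_form1:
  assumes \<alpha>: "\<alpha> \<in> forms A 1" and \<beta>: "\<beta> \<in> forms A 1"
  shows "wedge1 \<beta> \<alpha> \<in> forms A 2"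
proof (rule forms2_I)
  show "wedge1 \<beta> \<alpha> xs = 0" if "\<not> (length xs = 2 \<and> set xs \<subseteq> VF)" for xs
    using supported_wedge1[OF supported_form[OF \<alpha>] supported_form[OF \<beta>]] that
    unfolding supported_def numeral_2_eq_2 One_nat_def by blast
  fix x y z :: "'a vfield" and f
  show "wedge1 \<beta> \<alpha> [x, y] \<in> SF"
    unfolding wedge1_2 by (intro SF_pointwise form_SF[OF \<alpha>] form_SF[OF \<beta>])
  show "wedge1 \<beta> \<alpha> [y, x] = - wedge1 \<beta> \<alpha> [x, y]"
    by (simp add: wedge1_2 fun_eq_iff)
  assume "x \<in> VF" "y \<in> VF"
  then show "wedge1 \<beta> \<alpha> [x + y, z] = wedge1 \<beta> \<alpha> [x, z] + wedge1 \<beta> \<alpha> [y, z]"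
    by (intro ext) (simp only: wedge1_2 form_pointwise1(1)[OF \<alpha>] form_pointwise1(1)[OF \<beta>] plus_fun_apply,
        simp add: algebra_simps)
next
  fix x z :: "'a vfield" and f assume "x \<in> VF" "f \<in> SF"
  then show "wedge1 \<beta> \<alpha> [vf_mult f x, z] = f * wedge1 \<beta> \<alpha> [x, z]"
    by (intro ext) (simp only: wedge1_2 form_pointwise1(2)[OF \<alpha>] form_pointwise1(2)[OF \<beta>] times_fun_apply,
        simp add: algebra_simps)
qed

lemma twisted_deriv_form1:
  "\<alpha> \<in> forms A 1 \<Longrightarrow> b \<in> forms A 1 \<Longrightarrow> twisted_deriv A b \<alpha> \<in> forms A 2"
  unfolding twisted_deriv_def by (intro forms_add ext_deriv_form1 wedge1_form1)

lemma wedge1_form2: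
  assumes \<omega>: "\<omega> \<in> forms A 2" and \<beta>: "\<beta> \<in> forms A 1"
  shows "wedge1 \<beta> \<omega> \<in> forms A 3"
proof (rule forms3_I)
  show "wedge1 \<beta> \<omega> xs = 0" if "\<not> (length xs = 3 \<and> set xs \<subseteq> VF)" for xs
    using supported_wedge1[OF supported_form[OF \<omega>] supported_form[OF \<beta>]] that
    unfolding supported_def numeral_3_eq_3 numeral_2_eq_2 by blast
  fix u x y z :: "'a vfield" and f
  assume V: "x \<in> VF" "y \<in> VF" "z \<in> VF"
  show "wedge1 \<beta> \<omega> [x, y, z] \<in> SF"
    unfolding wedge1_3 by (intro SF_pointwise form_SF[OF \<omega>] form_SF[OF \<beta>])
  show "wedge1 \<beta> \<omega> [y, x, z] = - wedge1 \<beta> \<omega> [x, y, z]"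
    using V by (simp add: wedge1_3 fun_eq_iff form_pointwise2(3)[OF \<omega>, of x y])
  show "wedge1 \<beta> \<omega> [x, z, y] = - wedge1 \<beta> \<omega> [x, y, z]"
    using V by (simp add: wedge1_3 fun_eq_iff form_pointwise2(3)[OF \<omega>, of y z])
  { assume u: "u \<in> VF"
    show "wedge1 \<beta> \<omega> [u + x, y, z] = wedge1 \<beta> \<omega> [u, y, z] + wedge1 \<beta> \<omega> [x, y, z]"
      by (intro ext) (simp only: wedge1_3 form_pointwise2(1)[OF \<omega>] form_pointwise1(1)[OF \<beta>] plus_fun_apply u V,
          simp add: algebra_simps) }
  assume f: "f \<in> SF"
  show "wedge1 \<beta> \<omega> [vf_mult f x, y, z] = f * wedge1 \<beta> \<omega> [x, y, z]"
    by (intro ext) (simp only: wedge1_3 form_pointwise2(2)[OF \<omega>] form_pointwise1(2)[OF \<beta>] times_fun_apply f V,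
        simp add: algebra_simps)
qed

lemma closed_form1_lie:
  assumes \<beta>: "\<beta> \<in> forms A 1" "ext_deriv A \<beta> = 0" and V: "x \<in> VF" "y \<in> VF"
  shows "\<beta> [lie_bracket x y] = (\<lambda>p. x (\<beta> [y]) p - y (\<beta> [x]) p)"
  using fun_cong[OF fun_cong[OF \<beta>(2), of "[x, y]"]] by (simp add: ext_deriv_2[OF V] fun_eq_iff)

text \<open>
  The untwisted part vanishes by the Jacobi identity. The mixed terms add up to \<open>db \<and> \<alpha>\<close>, which vanishes
  since \<open>b\<close> is closed.
\<close>

lemma twisted_deriv_squared:
  assumes b: "b \<in> forms A 1" "ext_deriv A b = 0" and \<alpha>: "\<alpha> \<in> forms A 1"
  shows "twisted_deriv A b (twisted_deriv A b \<alpha>) = 0"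
proof (rule form3_eqI)
  have "supported (Suc 2) (twisted_deriv A b (twisted_deriv A b \<alpha>))"
    by (intro supported_twisted_deriv supported_form twisted_deriv_form1 b \<alpha>)
  then show "supported 3 (twisted_deriv A b (twisted_deriv A b \<alpha>))" by (simp add: numeral_3_eq_3 numeral_2_eq_2)
  fix x y z :: "'a vfield" and p assume V: "x \<in> VF" "y \<in> VF" "z \<in> VF"
  have D: "twisted_deriv A b \<alpha> [u, v] =
      (\<lambda>p. (u (\<alpha> [v]) p - v (\<alpha> [u]) p - \<alpha> [lie_bracket u v] p) + (b [u] p * \<alpha> [v] p - b [v] p * \<alpha> [u] p))"
    if "u \<in> VF" "v \<in> VF" for u v
    unfolding twisted_deriv_def by (simp add: fun_eq_iff ext_deriv_2[OF that] wedge1_2)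
  have jac: "\<alpha> [lie_bracket (lie_bracket x z) y] p =
      \<alpha> [lie_bracket (lie_bracket x y) z] p + \<alpha> [lie_bracket (lie_bracket y z) x] p"
    unfolding jacobi[OF V] by (rule form_pointwise1(1)[OF \<alpha>]) (use V in auto)
  note [simp] = VF_SF form_SF[OF \<alpha>] form_SF[OF b(1)] SF_pointwise VF_bracket
    VF_pointwise[OF V(1)] VF_pointwise[OF V(2)] VF_pointwise[OF V(3)]
  show "twisted_deriv A b (twisted_deriv A b \<alpha>) [x, y, z] p = 0 [x, y, z] p"
    unfolding twisted_deriv_def[of A b "twisted_deriv A b \<alpha>"] plus_fun_apply
      ext_deriv_3[OF V] wedge1_3
    using V jac
    by (simp add: D closed_form1_lie[OF b] lie_apply algebra_simps)
qed (rule supported_0)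

lemma form_of_fun_nil: "form_of_fun f [] = f"
  by (simp add: form_of_fun_def)

lemma supported_form_of_fun: "supported 0 (form_of_fun f)"
  by (simp add: supported_def form_of_fun_def)

lemma forms_0_eq: "forms A 0 = form_of_fun ` SF"
proof (intro equalityI subsetI)
  fix \<alpha> assume \<alpha>: "\<alpha> \<in> forms A 0"
  have "\<alpha> xs = form_of_fun (\<alpha> []) xs" for xs
    using form_off[OF \<alpha>, of xs] by (cases xs) (simp_all add: form_of_fun_def)
  then show "\<alpha> \<in> form_of_fun ` SF" using form_SF[OF \<alpha>] by blast
next
  fix \<alpha> assume "\<alpha> \<in> form_of_fun ` SF"
  then show "\<alpha> \<in> forms A 0" by (auto simp: forms_def form_of_fun_def)
qed

lemma supported_ext_deriv_fun: "supported 1 (ext_deriv A (form_of_fun f))"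
  using supported_ext_deriv[OF supported_form_of_fun] by simp

lemma ext_deriv_fun: "x \<in> VF \<Longrightarrow> ext_deriv A (form_of_fun f) [x] = x f"
  by (simp add: ext_deriv_1 form_of_fun_nil)

lemma ext_deriv_fun_form:
  assumes f: "f \<in> SF"
  shows "ext_deriv A (form_of_fun f) \<in> forms A 1"
proof (rule forms1_I)
  show "ext_deriv A (form_of_fun f) xs = 0" if "\<not> (length xs = 1 \<and> set xs \<subseteq> VF)" for xs
    using supported_ext_deriv_fun that unfolding supported_def by blast
  show "ext_deriv A (form_of_fun f) [x + y] = ext_deriv A (form_of_fun f) [x] + ext_deriv A (form_of_fun f) [y]"
    if "x \<in> VF" "y \<in> VF" for x y
    unfolding ext_deriv_fun[OF VF_plus[OF that]] ext_deriv_fun[OF that(1)] ext_deriv_fun[OF that(2)] by simp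
  show "ext_deriv A (form_of_fun f) [vf_mult g x] = g * ext_deriv A (form_of_fun f) [x]"
    if "g \<in> SF" "x \<in> VF" for g x
    unfolding ext_deriv_fun[OF VF_vf_mult[OF that]] ext_deriv_fun[OF that(2)] by (simp add: vf_mult_def)
qed (simp add: ext_deriv_fun VF_SF)

lemma ext_deriv_fun_closed:
  assumes f: "f \<in> SF"
  shows "ext_deriv A (ext_deriv A (form_of_fun f)) = 0"
proof (rule form2_eqI)
  show "supported 2 (ext_deriv A (ext_deriv A (form_of_fun f)))"
    using supported_ext_deriv[OF supported_ext_deriv_fun] by (simp add: numeral_2_eq_2)
  show "ext_deriv A (ext_deriv A (form_of_fun f)) [x, y] p = 0 [x, y] p" if "x \<in> VF" "y \<in> VF" for x y p
    unfolding ext_deriv_2[OF that] using that by (simp add: ext_deriv_fun VF_bracket lie_apply)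
qed (rule supported_0)

lemma twisted_deriv_form_mult:
  assumes f: "f \<in> SF" and \<omega>: "\<omega> \<in> forms A 2" and b: "b \<in> forms A 1"
  shows "twisted_deriv A b (form_mult f \<omega>) =
    wedge1 (ext_deriv A (form_of_fun f)) \<omega> + form_mult f (twisted_deriv A b \<omega>)"
proof (rule form3_eqI)
  have "supported (Suc 2) (twisted_deriv A b (form_mult f \<omega>))"
    by (intro supported_twisted_deriv supported_form_mult supported_form \<omega> b)
  moreover have "supported (Suc 2) (wedge1 (ext_deriv A (form_of_fun f)) \<omega> + form_mult f (twisted_deriv A b \<omega>))"
    by (intro supported_add supported_wedge1 supported_form_mult supported_twisted_deriv supported_form \<omega> b
        ext_deriv_fun_form f)
  ultimately show "supported 3 (twisted_deriv A b (form_mult f \<omega>))"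
      "supported 3 (wedge1 (ext_deriv A (form_of_fun f)) \<omega> + form_mult f (twisted_deriv A b \<omega>))"
    by (simp_all add: numeral_3_eq_3 numeral_2_eq_2)
  fix x y z :: "'a vfield" and p assume V: "x \<in> VF" "y \<in> VF" "z \<in> VF"
  have m: "form_mult f \<gamma> xs = (\<lambda>p. f p * \<gamma> xs p)" for \<gamma> xs
    by (simp add: form_mult_def fun_eq_iff)
  show "twisted_deriv A b (form_mult f \<omega>) [x, y, z] p =
      (wedge1 (ext_deriv A (form_of_fun f)) \<omega> + form_mult f (twisted_deriv A b \<omega>)) [x, y, z] p"
    unfolding twisted_deriv_def plus_fun_apply m ext_deriv_3[OF V] wedge1_3
    using V f
    by (simp add: m ext_deriv_fun VF_pointwise[OF V(1)] VF_pointwise[OF V(2)] VF_pointwise[OF V(3)] form_SF[OF \<omega>] algebra_simps)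
qed

text \<open>
  For closed \<open>\<alpha>\<close> one has \<open>d\<^sup>b(\<alpha> \<and> \<omega>) = - \<alpha> \<and> d\<^sup>b \<omega>\<close>. The proof verifies this on four vector fields, where \<open>T\<close>
  stands for \<open>d\<^sup>b \<omega>\<close>. It is what makes \<open>L\<close> take values in cohomology classes.
\<close>

lemma twisted_deriv_wedge1:
  assumes b: "b \<in> forms A 1" and \<omega>: "\<omega> \<in> forms A 2" "twisted_deriv A b \<omega> = 0"
    and \<alpha>: "\<alpha> \<in> forms A 1" "ext_deriv A \<alpha> = 0"
  shows "twisted_deriv A b (wedge1 \<alpha> \<omega>) = 0"
proof (rule form4_eqI)
  have "supported (Suc 3) (twisted_deriv A b (wedge1 \<alpha> \<omega>))"
    by (intro supported_twisted_deriv supported_form wedge1_form2 \<omega> \<alpha> b)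
  then show "supported 4 (twisted_deriv A b (wedge1 \<alpha> \<omega>))" by (simp add: eval_nat_numeral)
  fix w x y z :: "'a vfield" and p assume V: "w \<in> VF" "x \<in> VF" "y \<in> VF" "z \<in> VF"
  define T where "T u v t = twisted_deriv A b \<omega> [u, v, t] p" for u v t
  have T0: "T u v t = 0" for u v t by (simp add: T_def \<omega>(2))
  have T: "T u v t = u (\<omega> [v, t]) p - v (\<omega> [u, t]) p + t (\<omega> [u, v]) p
      - \<omega> [lie_bracket u v, t] p + \<omega> [lie_bracket u t, v] p - \<omega> [lie_bracket v t, u] p
      + (b [u] p * \<omega> [v, t] p - b [v] p * \<omega> [u, t] p + b [t] p * \<omega> [u, v] p)"
    if "u \<in> VF" "v \<in> VF" "t \<in> VF" for u v t
    unfolding T_def twisted_deriv_def plus_fun_apply ext_deriv_3[OF that] wedge1_3 ..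
  note [simp] = VF_SF form_SF[OF \<alpha>(1)] form_SF[OF \<omega>(1)] SF_pointwise VF_bracket
    VF_pointwise[OF V(1)] VF_pointwise[OF V(2)] VF_pointwise[OF V(3)] VF_pointwise[OF V(4)]
  have "twisted_deriv A b (wedge1 \<alpha> \<omega>) [w, x, y, z] p =
      - \<alpha> [w] p * T x y z + \<alpha> [x] p * T w y z - \<alpha> [y] p * T w x z + \<alpha> [z] p * T w x y"
    unfolding twisted_deriv_def[of A b "wedge1 \<alpha> \<omega>"] plus_fun_apply ext_deriv_4[OF V] wedge1_4
      T[OF V(2,3,4)] T[OF V(1,3,4)] T[OF V(1,2,4)] T[OF V(1,2,3)]
    using V
    by (simp add: wedge1_3 closed_form1_lie[OF \<alpha>] algebra_simps)
  then show "twisted_deriv A b (wedge1 \<alpha> \<omega>) [w, x, y, z] p = 0 [w, x, y, z] p" by (simp add: T0)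
qed (rule supported_0)

lemma interior_form:
  assumes \<omega>: "\<omega> \<in> forms A 2" and \<xi>: "\<xi> \<in> VF"
  shows "interior \<xi> \<omega> \<in> forms A 1"
proof (rule forms1_I)
  show "interior \<xi> \<omega> xs = 0" if "\<not> (length xs = 1 \<and> set xs \<subseteq> VF)" for xs
    unfolding interior_def by (rule form_off[OF \<omega>]) (use that in auto)
qed (simp_all add: interior_def fun_eq_iff form_SF[OF \<omega>] form2_add2[OF \<omega>] form2_mult2[OF \<omega>] \<xi>)

lemma supported_lie_deriv:
  assumes \<alpha>: "supported k \<alpha>" and \<xi>: "\<xi> \<in> VF"
  shows "supported k (lie_deriv A \<xi> \<alpha>)"
  unfolding supported_def
proof (intro allI impI)
  fix xs :: "'a vfield list" assume xs: "\<not> (length xs = k \<and> set xs \<subseteq> VF)"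
  have "\<alpha> ys = 0" if "length ys = length xs" "set xs \<subseteq> VF" for ys
  proof -
    have "length ys \<noteq> k" using that xs by auto
    then show ?thesis using \<alpha> unfolding supported_def by blast
  qed
  then have *: "set xs \<subseteq> VF \<Longrightarrow> \<alpha> xs = 0" "set xs \<subseteq> VF \<Longrightarrow> \<alpha> (xs[i := u]) = 0" for i u by simp_all
  show "lie_deriv A \<xi> \<alpha> xs = 0"
    by (cases "set xs \<subseteq> VF") (simp_all add: lie_deriv_def fun_eq_iff *[unfolded zero_fun_def] VF_zero_fun[OF \<xi>])
qed

lemma cartan_form1:
  assumes b: "b \<in> forms A 1" "ext_deriv A b = 0" and \<xi>: "\<xi> \<in> VF"
  shows "lie_deriv A \<xi> b = ext_deriv A (form_of_fun (b [\<xi>]))"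
proof (rule form1_eqI)
  show "supported 1 (lie_deriv A \<xi> b)" by (intro supported_lie_deriv supported_form b \<xi>)
  show "lie_deriv A \<xi> b [x] p = ext_deriv A (form_of_fun (b [\<xi>])) [x] p" if x: "x \<in> VF" for x p
    unfolding ext_deriv_fun[OF x]
    using x \<xi> closed_form1_lie[OF b \<xi> x] by (simp add: lie_deriv_def)
qed (rule supported_ext_deriv_fun)

text \<open>
  Cartan's formula \<open>L\<^sub>\<xi> \<omega> = d(\<iota>\<^sub>\<xi> \<omega>) + \<iota>\<^sub>\<xi> d\<omega>\<close> with \<open>d\<omega> = - b \<and> \<omega>\<close> substituted.
\<close>

lemma cartan_form2:
  assumes b: "b \<in> forms A 1" and \<omega>: "\<omega> \<in> forms A 2" "twisted_deriv A b \<omega> = 0" and \<xi>: "\<xi> \<in> VF"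
  shows "lie_deriv A \<xi> \<omega> = twisted_deriv A b (interior \<xi> \<omega>) - form_mult (b [\<xi>]) \<omega>"
proof (rule form2_eqI)
  show "supported 2 (lie_deriv A \<xi> \<omega>)" by (intro supported_lie_deriv supported_form \<omega> \<xi>)
  show "supported 2 (twisted_deriv A b (interior \<xi> \<omega>) - form_mult (b [\<xi>]) \<omega>)"
    by (intro supported_diff supported_form supported_form_mult twisted_deriv_form1 interior_form b \<omega> \<xi>)
  fix x y p assume V: "x \<in> VF" "y \<in> VF"
  have T: "\<xi> (\<omega> [x, y]) p - x (\<omega> [\<xi>, y]) p + y (\<omega> [\<xi>, x]) p
      - \<omega> [lie_bracket \<xi> x, y] p + \<omega> [lie_bracket \<xi> y, x] p - \<omega> [lie_bracket x y, \<xi>] p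
      + (b [\<xi>] p * \<omega> [x, y] p - b [x] p * \<omega> [\<xi>, y] p + b [y] p * \<omega> [\<xi>, x] p) = 0"
    using fun_cong[OF fun_cong[OF \<omega>(2), of "[\<xi>, x, y]"], of p]
    unfolding twisted_deriv_def plus_fun_apply ext_deriv_3[OF \<xi> V] wedge1_3 by simp
  have 1: "\<omega> [lie_bracket \<xi> y, x] p = - \<omega> [x, lie_bracket \<xi> y] p"
    using form_pointwise2(3)[OF \<omega>(1), of x "lie_bracket \<xi> y"] V \<xi> by (simp add: VF_bracket)
  have 2: "\<omega> [lie_bracket x y, \<xi>] p = - \<omega> [\<xi>, lie_bracket x y] p"
    using form_pointwise2(3)[OF \<omega>(1), of \<xi> "lie_bracket x y"] V \<xi> by (simp add: VF_bracket)
  have "lie_deriv A \<xi> \<omega> [x, y] p = \<xi> (\<omega> [x, y]) p - (\<omega> [lie_bracket \<xi> x, y] p + \<omega> [x, lie_bracket \<xi> y] p)"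
    using V by (simp add: lie_deriv_def lessThan_Suc)
  moreover have "(twisted_deriv A b (interior \<xi> \<omega>) - form_mult (b [\<xi>]) \<omega>) [x, y] p =
      x (\<omega> [\<xi>, y]) p - y (\<omega> [\<xi>, x]) p - \<omega> [\<xi>, lie_bracket x y] p
        + (b [x] p * \<omega> [\<xi>, y] p - b [y] p * \<omega> [\<xi>, x] p) - b [\<xi>] p * \<omega> [x, y] p"
    unfolding minus_apply twisted_deriv_def plus_fun_apply ext_deriv_2[OF V] wedge1_2
    by (simp add: interior_def form_mult_def)
  ultimately show "lie_deriv A \<xi> \<omega> [x, y] p =
      (twisted_deriv A b (interior \<xi> \<omega>) - form_mult (b [\<xi>]) \<omega>) [x, y] p"
    using T unfolding 1 2 by simp
qed

end

section \<open>Presentations of quotient spaces\<close>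

locale real_space = vector_space scale for scale :: "real \<Rightarrow> 'x::ab_group_add \<Rightarrow> 'x"
begin

text \<open>
  The quotients in the theorem are towers of cosets of cosets. Instead of working with cosets, each such
  space \<open>V\<close> is described by a linear surjection \<open>q\<close> onto it from a subspace \<open>S\<close> of a fixed ambient
  space. An isomorphism between two such spaces is then the same as
  two surjections from the same \<open>S\<close> with the same fibres.
\<close>

definition presents :: "'x set \<Rightarrow> ('x \<Rightarrow> 'v) \<Rightarrow> 'v real_vs \<Rightarrow> bool" where
  "presents S q V \<longleftrightarrow> subspace S \<and> q ` S = vs_carrier V \<and>
     (\<forall>x\<in>S. \<forall>y\<in>S. q (x + y) = vs_add V (q x) (q y)) \<and>
     (\<forall>r. \<forall>x\<in>S. q (scale r x) = vs_scale V r (q x))"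

lemma presentsD:
  assumes "presents S q V"
  shows "subspace S" "q ` S = vs_carrier V"
    "x \<in> S \<Longrightarrow> y \<in> S \<Longrightarrow> vs_add V (q x) (q y) = q (x + y)"
    "x \<in> S \<Longrightarrow> vs_scale V r (q x) = q (scale r x)"
  using assms by (auto simp: presents_def)

lemma presents_iso:
  assumes V: "presents S q V" and W: "presents S q' W"
    and eq: "\<And>x y. x \<in> S \<Longrightarrow> y \<in> S \<Longrightarrow> q x = q y \<longleftrightarrow> q' x = q' y"
  shows "\<exists>\<Phi>. vs_iso V W \<Phi> \<and> (\<forall>x\<in>S. \<Phi> (q x) = q' x)"
proof -
  define \<Phi> where "\<Phi> v = q' (SOME x. x \<in> S \<and> q x = v)" for v
  note S = presentsD(1)[OF V]
  have \<Phi>: "\<Phi> (q x) = q' x" if "x \<in> S" for x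
  proof -
    have "(SOME y. y \<in> S \<and> q y = q x) \<in> S \<and> q (SOME y. y \<in> S \<and> q y = q x) = q x"
      by (rule someI[of _ x]) (use that in simp)
    then show ?thesis using eq that unfolding \<Phi>_def by blast
  qed
  have "bij_betw \<Phi> (q ` S) (q' ` S)"
  proof (rule bij_betw_imageI)
    show "inj_on \<Phi> (q ` S)" using eq \<Phi> by (auto simp: inj_on_def)
    show "\<Phi> ` q ` S = q' ` S" using \<Phi> by (auto simp: image_image)
  qed
  moreover have "\<Phi> (vs_add V u v) = vs_add W (\<Phi> u) (\<Phi> v)" if uv: "u \<in> q ` S" "v \<in> q ` S" for u v
  proof -
    obtain x y where "x \<in> S" "y \<in> S" "u = q x" "v = q y" using uv by blast
    then show ?thesis using \<Phi> subspace_add[OF S] by (simp add: presentsD(3)[OF V] presentsD(3)[OF W])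
  qed
  moreover have "\<Phi> (vs_scale V r u) = vs_scale W r (\<Phi> u)" if "u \<in> q ` S" for u r
  proof -
    obtain x where "x \<in> S" "u = q x" using \<open>u \<in> q ` S\<close> by blast
    then show ?thesis using \<Phi> subspace_scale[OF S] by (simp add: presentsD(4)[OF V] presentsD(4)[OF W])
  qed
  ultimately have "vs_iso V W \<Phi>" unfolding vs_iso_def presentsD(2)[OF V, symmetric] presentsD(2)[OF W, symmetric] by blast
  then show ?thesis using \<Phi> by blast
qed

lemma presents_subspace:
  assumes V: "presents S q V" and T: "subspace T" "T \<subseteq> S"
  shows "presents T q (vs_restrict V (q ` T))"
  using V T unfolding presents_def vs_restrict_def by (auto simp: subset_iff)

text \<open>
  Presentations pass to quotients by images of subspaces, and can therefore be iterated.
\<close>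

lemma presents_quot:
  assumes V: "presents S q V" and T: "subspace T" "T \<subseteq> S"
  shows "presents S (\<lambda>x. vs_coset V (q ` T) (q x)) (vs_quot V (q ` T))"
    and "x \<in> S \<Longrightarrow> y \<in> S \<Longrightarrow>
      vs_coset V (q ` T) (q x) = vs_coset V (q ` T) (q y) \<longleftrightarrow> (\<exists>t\<in>T. q y = q (x + t))"
proof -
  note S = presentsD(1)[OF V] and add = presentsD(3)[OF V] and scale = presentsD(4)[OF V]
  let ?R = "coset_rel V (q ` T)"
  have R: "(q x, v) \<in> ?R \<longleftrightarrow> (\<exists>t\<in>T. v = q (x + t))" if "x \<in> S" for x v
  proof -
    have c: "vs_carrier V = q ` S" using presentsD(2)[OF V] ..
    have "x + t \<in> S" "vs_add V (q x) (q t) = q (x + t)" if "t \<in> T" for t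
      using subspace_add[OF S \<open>x \<in> S\<close>] add[OF \<open>x \<in> S\<close>] T(2) that by auto
    then show ?thesis using that unfolding coset_rel_def c by auto
  qed
  have Rsub: "?R \<subseteq> q ` S \<times> q ` S" using presentsD(2)[OF V] by (auto simp: coset_rel_def)
  have add3: "q (x + y) = q (x' + y)" if "q x = q x'" "x \<in> S" "x' \<in> S" "y \<in> S" for x x' y
    using add that by metis
  have equiv: "equiv (q ` S) ?R"
  proof (rule equivI)
    show "?R \<subseteq> q ` S \<times> q ` S" by (rule Rsub)
    show "refl_on (q ` S) ?R"
      using subspace_0[OF T(1)] R by (force simp: refl_on_def)
    show "sym ?R"
    proof (rule symI)
      fix u v assume uv: "(u, v) \<in> ?R"
      then obtain x where x: "x \<in> S" "u = q x" using Rsub by blast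
      then obtain t where t: "t \<in> T" "v = q (x + t)" using uv R by blast
      have "(v, q ((x + t) + (- t))) \<in> ?R"
        unfolding t(2) using R[of "x + t" "q ((x + t) + (- t))"] subspace_add[OF S x(1)] T(2) t(1) subspace_neg[OF T(1) t(1)] by blast
      then show "(v, u) \<in> ?R" by (simp add: x(2))
    qed
    show "trans ?R"
    proof (rule transI)
      fix u v w assume uv: "(u, v) \<in> ?R" and vw: "(v, w) \<in> ?R"
      then obtain x where x: "x \<in> S" "u = q x" using Rsub by blast
      then obtain t where t: "t \<in> T" "v = q (x + t)" using uv R by blast
      have xt: "x + t \<in> S" using subspace_add[OF S x(1)] T(2) t(1) by blast
      obtain t' where "t' \<in> T" "w = q (x + t + t')" using vw R[OF xt] t(2) by blast
      then show "(u, w) \<in> ?R"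
        unfolding x(2) R[OF x(1)] using subspace_add[OF T(1) t(1)] by (metis add.assoc)
    qed
  qed
  have c2: "congruent2 ?R ?R (\<lambda>u v. ?R `` {vs_add V u v})"
  proof (rule congruent2I'; rule equiv_class_eq[OF equiv])
    fix u u' v v' assume uu: "(u, u') \<in> ?R" and vv: "(v, v') \<in> ?R"
    obtain x y where xy: "x \<in> S" "u = q x" "y \<in> S" "v = q y" using uu vv Rsub by blast
    obtain s t where st: "s \<in> T" "u' = q (x + s)" "t \<in> T" "v' = q (y + t)"
      using uu vv R xy by blast
    have m: "x + s \<in> S" "y + t \<in> S" "x + y \<in> S"
      using subspace_add[OF S] xy st T(2) by auto
    have "vs_add V u' v' = q ((x + y) + (s + t))"
      unfolding st(2,4) add[OF m(1,2)] by (simp add: ac_simps)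
    then show "(vs_add V u v, vs_add V u' v') \<in> ?R"
      unfolding xy(2,4) add[OF xy(1,3)] using R[OF m(3)] subspace_add[OF T(1) st(1,3)] by blast
  qed
  have c1: "congruent ?R (\<lambda>v. ?R `` {vs_scale V r v})" for r
  proof (rule congruentI; rule equiv_class_eq[OF equiv])
    fix u u' assume uu: "(u, u') \<in> ?R"
    obtain x where x: "x \<in> S" "u = q x" using uu Rsub by blast
    obtain s where s: "s \<in> T" "u' = q (x + s)" using uu R x by blast
    have m: "x + s \<in> S" "scale r x \<in> S" using subspace_add[OF S] subspace_scale[OF S] x s T(2) by auto
    have "vs_scale V r u' = q (scale r x + scale r s)"
      unfolding s(2) scale[OF m(1)] by (simp add: scale_right_distrib)
    then show "(vs_scale V r u, vs_scale V r u') \<in> ?R"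
      unfolding x(2) scale[OF x(1)] using R[OF m(2)] subspace_scale[OF T(1) s(1)] by blast
  qed
  show "presents S (\<lambda>x. vs_coset V (q ` T) (q x)) (vs_quot V (q ` T))"
    unfolding presents_def
  proof (intro conjI ballI allI)
    show "(\<lambda>x. vs_coset V (q ` T) (q x)) ` S = vs_carrier (vs_quot V (q ` T))"
      by (auto simp: vs_coset_def vs_quot_def vs_quot_rel_def quotient_def presentsD(2)[OF V, symmetric])
    fix x assume x: "x \<in> S"
    show "vs_coset V (q ` T) (q (scale r x)) = vs_scale (vs_quot V (q ` T)) r (vs_coset V (q ` T) (q x))" for r
      using UN_equiv_class[OF equiv c1, of "q x" r] x
      by (simp add: vs_coset_def vs_quot_def vs_quot_rel_def scale)
    fix y assume y: "y \<in> S"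
    show "vs_coset V (q ` T) (q (x + y)) =
        vs_add (vs_quot V (q ` T)) (vs_coset V (q ` T) (q x)) (vs_coset V (q ` T) (q y))"
      using UN_equiv_class2[OF equiv equiv c2, of "q x" "q y"] x y
      by (simp add: vs_coset_def vs_quot_def vs_quot_rel_def add)
  qed (rule S)
  show "vs_coset V (q ` T) (q x) = vs_coset V (q ` T) (q y) \<longleftrightarrow> (\<exists>t\<in>T. q y = q (x + t))"
    if "x \<in> S" "y \<in> S" for x y
    unfolding vs_coset_def using eq_equiv_class_iff[OF equiv, of "q x" "q y"] R[OF that(1)] that by auto
qed

lemma presents_quot_id:
  assumes V: "presents S (\<lambda>x. x) V" and T: "subspace T" "T \<subseteq> S"
  shows "presents S (vs_coset V T) (vs_quot V T)"
    and "x \<in> S \<Longrightarrow> y \<in> S \<Longrightarrow> vs_coset V T x = vs_coset V T y \<longleftrightarrow> y - x \<in> T"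
    and "x \<in> S \<Longrightarrow> y \<in> vs_coset V T x \<longleftrightarrow> y \<in> S \<and> y - x \<in> T"
proof -
  show "presents S (vs_coset V T) (vs_quot V T)" using presents_quot(1)[OF V T] by simp
  have e: "(\<exists>t\<in>T. y = x + t) \<longleftrightarrow> y - x \<in> T" for x y by (auto intro: bexI[of _ "y - x"])
  show "x \<in> S \<Longrightarrow> y \<in> S \<Longrightarrow> vs_coset V T x = vs_coset V T y \<longleftrightarrow> y - x \<in> T"
    using presents_quot(2)[OF V T, of x y] e by simp
  show "y \<in> vs_coset V T x \<longleftrightarrow> y \<in> S \<and> y - x \<in> T" if "x \<in> S"
  proof -
    have c: "vs_carrier V = S" using presentsD(2)[OF V] by simp
    have "(\<exists>w\<in>T. y = vs_add V x w) \<longleftrightarrow> (\<exists>t\<in>T. y = x + t)"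
      by (intro bex_cong refl) (use presentsD(3)[OF V that] T(2) in auto)
    then show ?thesis using that e[of y x] by (simp add: vs_coset_def coset_rel_def c)
  qed
qed

text \<open>
  A linear left inverse \<open>g\<close> of the inclusion of \<open>U\<close> exists by extension of bases; \<open>x - g x\<close> is the
  projection along \<open>U\<close>.
\<close>

lemma complement_projection:
  assumes "subspace U"
  obtains P where "Vector_Spaces.linear scale scale P" "\<And>u. u \<in> U \<Longrightarrow> P u = 0" "\<And>x. P x - x \<in> U"
proof -
  interpret vector_space_pair scale scale ..
  have lin: "Vector_Spaces.linear scale scale (\<lambda>x. x)" by (rule linear_ident)
  obtain g where g: "g ` UNIV \<subseteq> U" "Vector_Spaces.linear scale scale g" "\<forall>u\<in>U. g u = u"
    using linear_exists_left_inverse_on[OF lin assms] by auto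
  have "Vector_Spaces.linear scale scale (\<lambda>x. x - g x)"
    by (rule linear_compose_sub[OF lin g(2)])
  moreover have "x - g x - x \<in> U" for x
    using subspace_neg[OF assms, of "g x"] g(1) by auto
  ultimately show ?thesis using that[of "\<lambda>x. x - g x"] g(3) by simp
qed

end

lemma vector_space_pair_scale:
  assumes "vector_space s" "vector_space t"
  shows "vector_space (\<lambda>r (x, y). (s r x, t r y))"
proof -
  interpret s: vector_space s by fact
  interpret t: vector_space t by fact
  show ?thesis
    by unfold_locales (auto simp: s.scale_right_distrib t.scale_right_distrib
        s.scale_left_distrib t.scale_left_distrib)
qed

lemma presents_sum:
  assumes s: "real_space s" and t: "real_space t"
    and V: "real_space.presents s S q V" and W: "real_space.presents t T q' W"
  shows "real_space.presents (\<lambda>r (x, y). (s r x, t r y)) (S \<times> T) (\<lambda>(x, y). (q x, q' y)) (vs_sum V W)"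
proof -
  interpret s: real_space s by fact
  interpret t: real_space t by fact
  have "vector_space (\<lambda>r (x, y). (s r x, t r y))"
    by (rule vector_space_pair_scale) unfold_locales
  then interpret p: real_space "\<lambda>r (x, y). (s r x, t r y)" by (simp add: real_space_def)
  note v = s.presentsD[OF V] and w = t.presentsD[OF W]
  show ?thesis
    unfolding p.presents_def p.subspace_def
    using s.subspace_0[OF v(1)] t.subspace_0[OF w(1)]
    by (auto simp: zero_prod_def vs_sum_def v(2)[symmetric] w(2)[symmetric] v(3,4) w(3,4)
        s.subspace_add[OF v(1)] t.subspace_add[OF w(1)] s.subspace_scale[OF v(1)] t.subspace_scale[OF w(1)]
        image_iff)
qed

section \<open>Cocycles and trivial deformations\<close>

interpretation form_vs: real_space "form_scale :: real \<Rightarrow> 'a form \<Rightarrow> 'a form"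
  by unfold_locales (auto simp: form_scale_def form_mult_def fun_eq_iff algebra_simps)

definition pair_scale :: "real \<Rightarrow> 'a form \<times> 'a form \<Rightarrow> 'a form \<times> 'a form" where
  "pair_scale = (\<lambda>r (\<kappa>, c). (form_scale r \<kappa>, form_scale r c))"

interpretation pair_vs: real_space "pair_scale :: real \<Rightarrow> 'a form \<times> 'a form \<Rightarrow> 'a form \<times> 'a form"
proof -
  have "vector_space (pair_scale :: real \<Rightarrow> 'a form \<times> 'a form \<Rightarrow> _)"
    unfolding pair_scale_def by (rule vector_space_pair_scale) unfold_locales
  then show "real_space (pair_scale :: real \<Rightarrow> 'a form \<times> 'a form \<Rightarrow> _)" by (simp add: real_space_def)
qed

interpretation pair_form: vector_space_pair
  "pair_scale :: real \<Rightarrow> 'a form \<times> 'a form \<Rightarrow> 'a form \<times> 'a form" "form_scale :: real \<Rightarrow> 'a form \<Rightarrow> 'a form" ..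

locale lcs_manifold = manifold A
  for A :: "('a::{t2_space,second_countable_topology}, 'e::euclidean_space) atlas" +
  fixes \<omega> b :: "'a form"
  assumes conn: "connected (UNIV :: 'a set)" and lcs: "lcs_structure A \<omega> b"
begin

abbreviation "D \<equiv> twisted_deriv A b"
abbreviation "df f \<equiv> ext_deriv A (form_of_fun f)"

lemma b: "b \<in> forms A 1" "ext_deriv A b = 0"
  and \<omega>: "\<omega> \<in> forms A 2" and nondeg: "nondegenerate A \<omega>" and D\<omega>: "D \<omega> = 0"
  using lcs unfolding lcs_structure_def twisted_deriv_def by auto

lemma subspace_forms: "form_vs.subspace (forms A k)"
  unfolding form_vs.subspace_def using forms_0 forms_add forms_scale by blast

lemma D_0: "D 0 = 0" and d_0: "ext_deriv A 0 = 0"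
proof -
  show "ext_deriv A 0 = 0"
    using ext_deriv_add[OF forms_0 forms_0] by (simp only: add_0 add_cancel_right_right)
  then show "D 0 = 0" by (simp add: twisted_deriv_def wedge1_def fun_eq_iff)
qed

lemma D_uminus: "\<alpha> \<in> forms A k \<Longrightarrow> D (- \<alpha>) = - D \<alpha>"
  using twisted_deriv_scale[of \<alpha> k b "-1"] by (simp only: form_vs.scale_minus_left form_vs.scale_one)

lemma D_diff: "\<alpha> \<in> forms A k \<Longrightarrow> \<beta> \<in> forms A k \<Longrightarrow> D (\<alpha> - \<beta>) = D \<alpha> - D \<beta>"
  using twisted_deriv_add[of \<alpha> k "- \<beta>" b] form_vs.subspace_neg[OF subspace_forms] D_uminus by simp

lemma df_add: "f \<in> SF \<Longrightarrow> g \<in> SF \<Longrightarrow> df (f + g) = df f + df g"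
  by (rule form1_eqI[OF supported_ext_deriv_fun supported_add[OF supported_ext_deriv_fun supported_ext_deriv_fun]])
    (simp add: ext_deriv_fun VF_add)

lemma df_scale: "f \<in> SF \<Longrightarrow> df (\<lambda>x. r * f x) = form_scale r (df f)"
  unfolding form_scale_def
  by (rule form1_eqI[OF supported_ext_deriv_fun supported_form_mult[OF supported_ext_deriv_fun]])
    (simp add: form_mult_def ext_deriv_fun VF_scale)

lemma df_uminus: "f \<in> SF \<Longrightarrow> df (- f) = - df f"
  using df_scale[of f "-1"] by (simp add: form_vs.scale_minus_left fun_Compl_def)

lemma df_eq_0: 
  assumes "f \<in> SF" "df f = 0"
  obtains c where "f = (\<lambda>_. c)"
proof (rule that)
  fix p
  show "f = (\<lambda>_. f p)"
  proof (rule VF_zero_imp_constant[OF conn assms(1)])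
    fix x assume "x \<in> VF"
    then have "x f = df f [x]" by (simp add: ext_deriv_fun)
    then show "x f = 0" using assms(2) by simp
  qed
qed

lemma df_const: "df (\<lambda>_. c) = 0"
  by (rule form1_eqI[OF supported_ext_deriv_fun supported_0]) (simp add: ext_deriv_fun VF_const)

lemma form_mult_rules:
  "form_mult (f + g) \<alpha> = form_mult f \<alpha> + form_mult g \<alpha>"
  "form_mult (\<lambda>x. r * f x) \<alpha> = form_scale r (form_mult f \<alpha>)"
  "form_mult (- f) \<alpha> = - form_mult f \<alpha>"
  by (auto simp: form_mult_def form_scale_def fun_eq_iff algebra_simps)

text \<open>
  \<open>Z\<close> and \<open>B\<close> denote cocycles and coboundaries: of de Rham cohomology in degree \<open>1\<close>, of twisted cohomology
  in degrees \<open>2\<close> and \<open>3\<close>. \<open>K\<close> consists of the representatives of classes in the kernel of \<open>L\<close>, \<open>E\<close> of the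
  infinitesimal deformations, and \<open>T\<close> of the trivial ones. In \<open>T\<close> the form \<open>\<alpha>\<close> stands for the contraction of
  \<open>\<omega>\<close> with \<open>\<xi>\<close>, and \<open>f\<close> for the sum of the function in the definition of equivalence and \<open>b(\<xi>)\<close>; with
  these parameters \<open>T\<close> is visibly a subspace.
\<close>

definition "Z1 = {\<alpha> \<in> forms A 1. ext_deriv A \<alpha> = 0}"
definition "B1 = df ` SF"
definition "Z2 = {\<kappa> \<in> forms A 2. D \<kappa> = 0}"
definition "B2 = D ` forms A 1"
definition "Z3 = {\<gamma> \<in> forms A 3. D \<gamma> = 0}"
definition "K = {\<alpha> \<in> Z1. \<exists>\<kappa>\<in>forms A 2. D \<kappa> = wedge1 \<alpha> \<omega>}"
definition "E = infinitesimal_deformations A \<omega> b"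
definition "T = {(D \<alpha> - form_mult f \<omega>, df f) | \<alpha> f. \<alpha> \<in> forms A 1 \<and> f \<in> SF}"

lemma interior_image: "forms A 1 = (\<lambda>\<xi>. interior \<xi> \<omega>) ` VF"
proof
  show "(\<lambda>\<xi>. interior \<xi> \<omega>) ` VF \<subseteq> forms A 1" using interior_form[OF \<omega>] by blast
  show "forms A 1 \<subseteq> (\<lambda>\<xi>. interior \<xi> \<omega>) ` VF"
  proof
    fix \<alpha> assume "\<alpha> \<in> forms A 1"
    then obtain \<xi> where "\<xi> \<in> VF" "interior \<xi> \<omega> = \<alpha>" by (rule interior_onto[OF \<omega> nondeg])
    then show "\<alpha> \<in> (\<lambda>\<xi>. interior \<xi> \<omega>) ` VF" by blast
  qed
qed

lemma S_image_iff: "\<kappa> \<in> S_image A \<omega> b \<longleftrightarrow> (\<exists>\<alpha>\<in>forms A 1. \<exists>c. \<kappa> = D \<alpha> - form_scale c \<omega>)"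
  unfolding interior_image by (auto simp: S_image_def S_map_def)

lemma E_iff: "(\<kappa>, c) \<in> E \<longleftrightarrow> \<kappa> \<in> forms A 2 \<and> c \<in> Z1 \<and> D \<kappa> = - wedge1 c \<omega>"
  by (auto simp: E_def infinitesimal_deformations_def Z1_def)

lemma wedge1_0: "wedge1 0 \<omega> = 0"
  by (simp add: wedge1_def fun_eq_iff)

lemma subspace_Z1: "form_vs.subspace Z1"
  unfolding form_vs.subspace_def Z1_def
  by (auto simp: forms_0 d_0 forms_add forms_scale ext_deriv_add ext_deriv_scale)

lemma subspace_Z2: "form_vs.subspace Z2"
  unfolding form_vs.subspace_def Z2_def
  by (auto simp: forms_0 D_0 forms_add forms_scale twisted_deriv_add twisted_deriv_scale)

lemma subspace_Z3: "form_vs.subspace Z3"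
  unfolding form_vs.subspace_def Z3_def
  by (auto simp: forms_0 D_0 forms_add forms_scale twisted_deriv_add twisted_deriv_scale)

lemma subspace_D_image: "form_vs.subspace (D ` forms A k)"
  unfolding form_vs.subspace_def
proof (intro conjI ballI allI)
  show "0 \<in> D ` forms A k" using D_0 forms_0 by (metis imageI)
  show "\<alpha> + \<beta> \<in> D ` forms A k" if ab: "\<alpha> \<in> D ` forms A k" "\<beta> \<in> D ` forms A k" for \<alpha> \<beta>
  proof -
    obtain \<alpha>' \<beta>' where "\<alpha> = D \<alpha>'" "\<alpha>' \<in> forms A k" "\<beta> = D \<beta>'" "\<beta>' \<in> forms A k" using ab by blast
    then show ?thesis using twisted_deriv_add[of \<alpha>' k \<beta>' b] forms_add by (intro image_eqI[of _ _ "\<alpha>' + \<beta>'"]) auto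
  qed
  show "form_scale r \<alpha> \<in> D ` forms A k" if a: "\<alpha> \<in> D ` forms A k" for \<alpha> r
  proof -
    obtain \<alpha>' where "\<alpha> = D \<alpha>'" "\<alpha>' \<in> forms A k" using a by blast
    then show ?thesis
      using twisted_deriv_scale[of \<alpha>' k b r] forms_scale by (intro image_eqI[of _ _ "form_scale r \<alpha>'"]) auto
  qed
qed

lemma subspace_B1: "form_vs.subspace B1"
  unfolding form_vs.subspace_def B1_def
proof (intro conjI ballI allI)
  show "0 \<in> df ` SF" using df_const SF_const by (metis imageI)
  show "\<alpha> + \<beta> \<in> df ` SF" if ab: "\<alpha> \<in> df ` SF" "\<beta> \<in> df ` SF" for \<alpha> \<beta>
  proof -
    obtain f g where fg: "\<alpha> = df f" "f \<in> SF" "\<beta> = df g" "g \<in> SF" using ab by blast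
    then have "\<alpha> + \<beta> = df (f + g)" using df_add by simp
    then show ?thesis using SF_add[OF fg(2,4)] by blast
  qed
  show "form_scale r \<alpha> \<in> df ` SF" if a: "\<alpha> \<in> df ` SF" for \<alpha> r
  proof -
    obtain f where f: "\<alpha> = df f" "f \<in> SF" using a by blast
    then show ?thesis using df_scale[OF f(2), of r] SF_scale[OF f(2), of r] by (metis imageI)
  qed
qed

lemma B1_sub: "B1 \<subseteq> Z1"
  by (auto simp: B1_def Z1_def ext_deriv_fun_form ext_deriv_fun_closed simp del: One_nat_def)

lemma D_form_mult: "f \<in> SF \<Longrightarrow> D (form_mult f \<omega>) = wedge1 (df f) \<omega>"
  using twisted_deriv_form_mult[OF _ \<omega> b(1), of f] D\<omega> by (simp add: form_mult_def[of f 0] fun_eq_iff)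

lemma subspace_K: "form_vs.subspace K"
  unfolding form_vs.subspace_def
proof (intro conjI ballI allI)
  show "0 \<in> K"
    using form_vs.subspace_0[OF subspace_Z1] forms_0 D_0 wedge1_0 by (auto simp: K_def)
  fix \<alpha> \<beta> r assume "\<alpha> \<in> K"
  then obtain \<kappa> where \<alpha>: "\<alpha> \<in> Z1" "\<kappa> \<in> forms A 2" "D \<kappa> = wedge1 \<alpha> \<omega>" by (auto simp: K_def)
  then have "D (form_scale r \<kappa>) = wedge1 (form_scale r \<alpha>) \<omega>"
    by (simp add: twisted_deriv_scale wedge1_scale_left)
  then show "form_scale r \<alpha> \<in> K"
    using \<alpha> forms_scale form_vs.subspace_scale[OF subspace_Z1] unfolding K_def by blast
  assume "\<beta> \<in> K"
  then obtain \<mu> where \<beta>: "\<beta> \<in> Z1" "\<mu> \<in> forms A 2" "D \<mu> = wedge1 \<beta> \<omega>" by (auto simp: K_def)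
  have "D (\<kappa> + \<mu>) = wedge1 (\<alpha> + \<beta>) \<omega>"
    unfolding twisted_deriv_add[OF \<alpha>(2) \<beta>(2)] wedge1_add_left \<alpha>(3) \<beta>(3) ..
  then show "\<alpha> + \<beta> \<in> K"
    using \<alpha> \<beta> forms_add form_vs.subspace_add[OF subspace_Z1] unfolding K_def by blast
qed

lemma B1_sub_K: "B1 \<subseteq> K"
  using B1_sub D_form_mult forms_mult[OF _ \<omega>] unfolding K_def B1_def by blast

lemma K_sub: "K \<subseteq> Z1" by (auto simp: K_def)

text \<open>
  The equation \<open>d\<^sup>b \<kappa> = - c \<and> \<omega>\<close> can be solved for \<open>\<kappa>\<close> exactly if \<open>c \<and> \<omega>\<close> is exact. This is how
  the kernel of \<open>L\<close> enters.
\<close>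

lemma snd_E: "snd ` E = K"
proof
  show "snd ` E \<subseteq> K"
  proof
    fix c assume "c \<in> snd ` E"
    then obtain \<kappa> where \<kappa>: "\<kappa> \<in> forms A 2" "c \<in> Z1" "D \<kappa> = - wedge1 c \<omega>" using E_iff by force
    then have "D (- \<kappa>) = wedge1 c \<omega>" "- \<kappa> \<in> forms A 2"
      using D_uminus form_vs.subspace_neg[OF subspace_forms] by auto
    then show "c \<in> K" using \<kappa>(2) unfolding K_def by blast
  qed
  show "K \<subseteq> snd ` E"
  proof
    fix c assume "c \<in> K"
    then obtain \<kappa> where \<kappa>: "c \<in> Z1" "\<kappa> \<in> forms A 2" "D \<kappa> = wedge1 c \<omega>" by (auto simp: K_def)
    then have "(- \<kappa>, c) \<in> E"
      using D_uminus form_vs.subspace_neg[OF subspace_forms] by (auto simp: E_iff)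
    then show "c \<in> snd ` E" by (rule image_eqI[rotated]) simp
  qed
qed

lemma subspace_E: "pair_vs.subspace E"
  unfolding pair_vs.subspace_def
proof (intro conjI ballI allI)
  show "0 \<in> E"
    using form_vs.subspace_0[OF subspace_Z1] forms_0 D_0 wedge1_0 by (auto simp: zero_prod_def E_iff)
  fix u v r assume u: "u \<in> E"
  obtain \<kappa> c where [simp]: "u = (\<kappa>, c)" by (cases u)
  have \<kappa>: "\<kappa> \<in> forms A 2" using u by (simp add: E_iff)
  show "pair_scale r u \<in> E"
    using u form_vs.subspace_scale[OF subspace_Z1]
    by (simp add: pair_scale_def E_iff forms_scale twisted_deriv_scale[OF \<kappa>] wedge1_scale_left form_vs.scale_minus_right)
  assume v: "v \<in> E"
  obtain \<mu> e where [simp]: "v = (\<mu>, e)" by (cases v)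
  have \<mu>: "\<mu> \<in> forms A 2" using v by (simp add: E_iff)
  show "u + v \<in> E"
    using u v form_vs.subspace_add[OF subspace_Z1]
    by (simp add: E_iff forms_add twisted_deriv_add[OF \<kappa> \<mu>] wedge1_add_left)
qed

lemma T_sub: "T \<subseteq> E"
proof
  fix t assume "t \<in> T"
  then obtain \<alpha> f where t: "t = (D \<alpha> - form_mult f \<omega>, df f)" "\<alpha> \<in> forms A 1" "f \<in> SF"
    unfolding T_def by blast
  have m: "D \<alpha> \<in> forms A 2" "form_mult f \<omega> \<in> forms A 2"
    using twisted_deriv_form1[OF t(2) b(1)] forms_mult[OF t(3) \<omega>] by auto
  have "D (D \<alpha> - form_mult f \<omega>) = - wedge1 (df f) \<omega>"
    unfolding D_diff[OF m] twisted_deriv_squared[OF b t(2)] D_form_mult[OF t(3)] by simp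
  moreover have "df f \<in> Z1" using B1_sub t(3) by (auto simp: B1_def)
  ultimately show "t \<in> E" using form_vs.subspace_diff[OF subspace_forms m] t(1) by (simp add: E_iff)
qed

lemma subspace_T: "pair_vs.subspace T"
  unfolding pair_vs.subspace_def
proof (intro conjI ballI allI)
  have "(0, 0) = (D 0 - form_mult (\<lambda>_. 0) \<omega>, df (\<lambda>_. 0))"
    unfolding df_const D_0 by (simp add: form_mult_def fun_eq_iff)
  then show "0 \<in> T" unfolding T_def zero_prod_def using forms_0 SF_const by blast
  fix u v r assume "u \<in> T"
  then obtain \<alpha> f where u: "u = (D \<alpha> - form_mult f \<omega>, df f)" "\<alpha> \<in> forms A 1" "f \<in> SF"
    unfolding T_def by blast
  have "pair_scale r u = (D (form_scale r \<alpha>) - form_mult (\<lambda>x. r * f x) \<omega>, df (\<lambda>x. r * f x))"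
    unfolding u(1) twisted_deriv_scale[OF u(2)] df_scale[OF u(3)] form_mult_rules
    by (simp add: pair_scale_def form_vs.scale_right_diff_distrib)
  then show "pair_scale r u \<in> T" unfolding T_def using forms_scale[OF u(2)] SF_scale[OF u(3)] by blast
  assume "v \<in> T"
  then obtain \<beta> g where v: "v = (D \<beta> - form_mult g \<omega>, df g)" "\<beta> \<in> forms A 1" "g \<in> SF"
    unfolding T_def by blast
  have "u + v = (D (\<alpha> + \<beta>) - form_mult (f + g) \<omega>, df (f + g))"
    unfolding u(1) v(1) twisted_deriv_add[OF u(2) v(2)] df_add[OF u(3) v(3)] form_mult_rules by simp
  then show "u + v \<in> T" unfolding T_def using forms_add[OF u(2) v(2)] SF_add[OF u(3) v(3)] by blast
qed

text \<open>
  If \<open>df = 0\<close> then \<open>f\<close> is a constant \<open>c\<close>, by connectedness, and \<open>d\<^sup>b \<alpha> - f \<omega> = d\<^sup>b \<alpha> - c \<omega>\<close>. This is where the factor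
  \<open>\<real>\<close> in the domain of \<open>S\<close> comes from.
\<close>

lemma T_fst: "(\<kappa>, 0) \<in> T \<longleftrightarrow> \<kappa> \<in> S_image A \<omega> b"
proof
  assume "(\<kappa>, 0) \<in> T"
  then obtain \<alpha> f where a: "\<kappa> = D \<alpha> - form_mult f \<omega>" "df f = 0" "\<alpha> \<in> forms A 1" "f \<in> SF"
    unfolding T_def by fastforce
  obtain c where "f = (\<lambda>_. c)" using df_eq_0[OF a(4,2)] .
  then show "\<kappa> \<in> S_image A \<omega> b" using a unfolding S_image_iff form_scale_def by blast
next
  assume "\<kappa> \<in> S_image A \<omega> b"
  then obtain \<alpha> c where "\<kappa> = D \<alpha> - form_mult (\<lambda>_. c) \<omega>" "\<alpha> \<in> forms A 1"
    unfolding S_image_iff form_scale_def by blast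
  then show "(\<kappa>, 0) \<in> T" unfolding T_def using df_const[of c] by force
qed

lemma T_snd: "snd ` T = B1"
proof -
  have "df f \<in> snd ` T" if "f \<in> SF" for f
  proof -
    have "(D 0 - form_mult f \<omega>, df f) \<in> T" unfolding T_def using forms_0 that by blast
    then show ?thesis by (rule image_eqI[rotated]) simp
  qed
  then show ?thesis unfolding B1_def by (auto simp: T_def)
qed

lemma T_exact: "f \<in> SF \<Longrightarrow> (form_mult f \<omega>, - df f) \<in> T"
proof -
  assume f: "f \<in> SF"
  have "(form_mult f \<omega>, - df f) = (D 0 - form_mult (- f) \<omega>, df (- f))"
    unfolding df_uminus[OF f] form_mult_rules D_0 by simp
  then show ?thesis unfolding T_def using forms_0 SF_uminus[OF f] by blast
qed

lemma subspace_S_image: "form_vs.subspace (S_image A \<omega> b)"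
  unfolding form_vs.subspace_def T_fst[symmetric]
proof (intro conjI ballI allI)
  show "(0, 0) \<in> T" using pair_vs.subspace_0[OF subspace_T] by (simp add: zero_prod_def)
  fix \<kappa> \<mu> r assume "\<kappa> \<in> S_image A \<omega> b"
  then have \<kappa>: "(\<kappa>, 0) \<in> T" by (simp add: T_fst)
  show "(form_scale r \<kappa>, 0) \<in> T"
    using pair_vs.subspace_scale[OF subspace_T \<kappa>, of r] by (simp add: pair_scale_def form_vs.scale_zero_right)
  assume "\<mu> \<in> S_image A \<omega> b"
  then have "(\<mu>, 0) \<in> T" by (simp add: T_fst)
  from pair_vs.subspace_add[OF subspace_T \<kappa> this] show "(\<kappa> + \<mu>, 0) \<in> T" by simp
qed

lemma E_Z2: "(\<kappa>, 0) \<in> E \<longleftrightarrow> \<kappa> \<in> Z2"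
  using form_vs.subspace_0[OF subspace_Z1] by (auto simp: E_iff Z2_def wedge1_0)

lemma S_image_sub: "S_image A \<omega> b \<subseteq> Z2"
  using T_sub T_fst E_Z2 by blast

lemma closed_forms_presented:
  "form_vs.subspace {\<alpha> \<in> forms A k. \<Delta> \<alpha> = 0} \<Longrightarrow>
    form_vs.presents {\<alpha> \<in> forms A k. \<Delta> \<alpha> = 0} (\<lambda>x. x) (closed_forms A \<Delta> k)"
  by (simp add: form_vs.presents_def closed_forms_def vs_restrict_def form_space_def)

lemma Z1_presented: "form_vs.presents Z1 (\<lambda>x. x) (closed_forms A (ext_deriv A) 1)"
  and Z2_presented: "form_vs.presents Z2 (\<lambda>x. x) (closed_forms A D 2)"
  and Z3_presented: "form_vs.presents Z3 (\<lambda>x. x) (closed_forms A D 3)"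
  using closed_forms_presented subspace_Z1 subspace_Z2 subspace_Z3 unfolding Z1_def Z2_def Z3_def by blast+

text \<open>
  Two spaces in the theorem are quotients of the \<open>d\<^sup>b\<close>-closed two-forms by the image of \<open>S\<close>: the cokernel of \<open>S\<close>
  itself and \<open>H\<^sup>2\<^sub>b\<close> modulo the line of \<open>\<omega>\<close>. Results on the deformation space are proved for both at once.
\<close>

definition presents_H :: "('a form \<Rightarrow> 'v) \<Rightarrow> 'v real_vs \<Rightarrow> bool" where
  "presents_H q V \<longleftrightarrow> form_vs.presents Z2 q V \<and>
     (\<forall>\<kappa>\<in>Z2. \<forall>\<mu>\<in>Z2. q \<kappa> = q \<mu> \<longleftrightarrow> \<mu> - \<kappa> \<in> S_image A \<omega> b)"

lemma closed_mod_S_presented: "presents_H (closed_mod_S_class A \<omega> b) (closed_mod_S A \<omega> b)"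
  unfolding presents_H_def closed_mod_S_def closed_mod_S_class_def[abs_def]
  using form_vs.presents_quot_id[OF Z2_presented subspace_S_image S_image_sub] by auto

lemma exact_1: "exact_forms A (ext_deriv A) 1 = B1"
  by (simp add: exact_forms_def forms_0_eq B1_def image_image)

lemma exact_2: "exact_forms A D 2 = B2"
  by (simp add: exact_forms_def B2_def numeral_2_eq_2)

lemma exact_3: "exact_forms A D 3 = D ` forms A 2"
  by (simp add: exact_forms_def numeral_3_eq_3 numeral_2_eq_2)

lemma B2_sub: "B2 \<subseteq> Z2"
  using twisted_deriv_form1[OF _ b(1)] twisted_deriv_squared[OF b] by (auto simp: B2_def Z2_def)

lemma \<omega>_Z2: "\<omega> \<in> Z2" using \<omega> D\<omega> by (simp add: Z2_def)

text \<open>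
  The form \<open>\<mu> - \<kappa>\<close> is exact up to a multiple of \<open>\<omega>\<close> iff it lies in the image of \<open>S\<close>, since
  every one-form is a contraction of \<open>\<omega>\<close>.
\<close>

lemma H2_mod_presented: "presents_H (H2_mod_class A D \<omega>) (H2_mod A D \<omega>)"
proof -
  let ?q = "coh_class A D 2" and ?H = "cohomology A D 2"
  have sB2: "form_vs.subspace B2" unfolding B2_def by (rule subspace_D_image)
  note q = form_vs.presents_quot_id[OF Z2_presented sB2 B2_sub]
  have qH: "form_vs.presents Z2 ?q ?H"
    using q(1) by (simp add: coh_class_def[abs_def] cohomology_def exact_2)
  have qeq: "?q \<kappa> = ?q \<mu> \<longleftrightarrow> \<mu> - \<kappa> \<in> B2" if "\<kappa> \<in> Z2" "\<mu> \<in> Z2" for \<kappa> \<mu>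
    using q(2)[OF that] by (simp add: coh_class_def exact_2)
  let ?L = "range (\<lambda>r. form_scale r \<omega>)"
  have sL: "form_vs.subspace ?L"
    unfolding form_vs.span_singleton[symmetric] by (rule form_vs.subspace_span)
  have LZ: "?L \<subseteq> Z2" using form_vs.subspace_scale[OF subspace_Z2 \<omega>_Z2] by blast
  have line: "vs_line ?H (?q \<omega>) = ?q ` ?L"
    unfolding vs_line_def image_image form_vs.presentsD(4)[OF qH \<omega>_Z2] ..
  note Q = form_vs.presents_quot[OF qH sL LZ]
  have "H2_mod_class A D \<omega> \<kappa> = H2_mod_class A D \<omega> \<mu> \<longleftrightarrow> \<mu> - \<kappa> \<in> S_image A \<omega> b"
    if \<kappa>: "\<kappa> \<in> Z2" and \<mu>: "\<mu> \<in> Z2" for \<kappa> \<mu>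
  proof -
    have "H2_mod_class A D \<omega> \<kappa> = H2_mod_class A D \<omega> \<mu> \<longleftrightarrow> (\<exists>r. ?q \<mu> = ?q (\<kappa> + form_scale r \<omega>))"
      using Q(2)[OF \<kappa> \<mu>] by (simp add: H2_mod_class_def line)
    also have "\<dots> \<longleftrightarrow> (\<exists>r. ?q (\<kappa> + form_scale r \<omega>) = ?q \<mu>)" by metis
    also have "\<dots> \<longleftrightarrow> (\<exists>r. \<mu> - (\<kappa> + form_scale r \<omega>) \<in> B2)"
      using qeq[OF form_vs.subspace_add[OF subspace_Z2 \<kappa>] \<mu>] LZ by blast
    also have "\<dots> \<longleftrightarrow> (\<exists>r. \<exists>\<alpha>\<in>forms A 1. \<mu> - \<kappa> = D \<alpha> - form_scale (- r) \<omega>)"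
      unfolding B2_def image_iff by (simp add: form_vs.scale_minus_left algebra_simps)
    also have "\<dots> \<longleftrightarrow> \<mu> - \<kappa> \<in> S_image A \<omega> b"
      unfolding S_image_iff by (metis minus_minus)
    finally show ?thesis .
  qed
  moreover have "form_vs.presents Z2 (H2_mod_class A D \<omega>) (H2_mod A D \<omega>)"
    using Q(1) by (simp add: H2_mod_def H2_mod_class_def[abs_def] line)
  ultimately show ?thesis unfolding presents_H_def by blast
qed

section \<open>The deformation space and the kernel of L\<close>

abbreviation "VE \<equiv> vs_restrict (vs_sum (form_space A 2) (form_space A 1)) (infinitesimal_deformations A \<omega> b)"

lemma VE_presented: "pair_vs.presents E (\<lambda>x. x) VE"
proof -
  have "VE = \<lparr>vs_carrier = E, vs_zero = (0, 0), vs_add = (+), vs_scale = pair_scale\<rparr>"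
    by (auto simp: vs_restrict_def vs_sum_def form_space_def E_def pair_scale_def fun_eq_iff)
  then show ?thesis using subspace_E by (simp add: pair_vs.presents_def)
qed

text \<open>
  By Cartan's formulas, \<open>L\<^sub>\<xi> \<omega> - f \<omega> = d\<^sup>b(\<omega>(\<xi>, -)) - (f + b(\<xi>)) \<omega>\<close> and \<open>L\<^sub>\<xi> b + df = d(f + b(\<xi>))\<close>.
\<close>

lemma deformation_equiv_iff:
  "(\<delta>', \<delta>) \<in> deformation_equiv A \<omega> b \<longleftrightarrow> \<delta>' \<in> E \<and> \<delta> \<in> E \<and> \<delta>' - \<delta> \<in> T"
proof -
  obtain \<kappa>' c' \<kappa> c where \<delta>: "\<delta>' = (\<kappa>', c')" "\<delta> = (\<kappa>, c)" by (cases \<delta>'; cases \<delta>)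
  have shift: "\<kappa>' = - form_mult f \<omega> + \<kappa> + lie_deriv A \<xi> \<omega> \<and> c' = c + lie_deriv A \<xi> b + df f \<longleftrightarrow>
      (\<kappa>', c') - (\<kappa>, c) = (D (interior \<xi> \<omega>) - form_mult (f + b [\<xi>]) \<omega>, df (f + b [\<xi>]))"
    if "\<xi> \<in> VF" "f \<in> SF" for \<xi> f
    unfolding cartan_form1[OF b that(1)] cartan_form2[OF b(1) \<omega> D\<omega> that(1)]
      df_add[OF that(2) form_SF[OF b(1)]] form_mult_rules
    by (auto simp: algebra_simps)
  have "(\<exists>\<xi>\<in>VF. \<exists>f\<in>SF. \<kappa>' = - form_mult f \<omega> + \<kappa> + lie_deriv A \<xi> \<omega> \<and> c' = c + lie_deriv A \<xi> b + df f) \<longleftrightarrow>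
      (\<kappa>', c') - (\<kappa>, c) \<in> T" (is "?L \<longleftrightarrow> ?R")
  proof
    assume ?L
    then obtain \<xi> f where f: "\<xi> \<in> VF" "f \<in> SF"
      "(\<kappa>', c') - (\<kappa>, c) = (D (interior \<xi> \<omega>) - form_mult (f + b [\<xi>]) \<omega>, df (f + b [\<xi>]))"
      using shift by blast
    show ?R unfolding f(3) T_def
      using interior_form[OF \<omega> f(1)] SF_add[OF f(2) form_SF[OF b(1)], of "[\<xi>]"] by blast
  next
    assume ?R
    then obtain \<alpha> g where g: "(\<kappa>', c') - (\<kappa>, c) = (D \<alpha> - form_mult g \<omega>, df g)" "\<alpha> \<in> forms A 1" "g \<in> SF"
      unfolding T_def by blast
    obtain \<xi> where \<xi>: "\<xi> \<in> VF" "\<alpha> = interior \<xi> \<omega>" using g(2) unfolding interior_image by blast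
    \<comment> \<open>The vector field comes from nondegeneracy; \<open>f\<close> is then determined by \<open>f + b(\<xi>) = g\<close>.\<close>
    have "g = (g - b [\<xi>]) + b [\<xi>]" by simp
    moreover have m: "g - b [\<xi>] \<in> SF" by (intro SF_diff g(3) form_SF[OF b(1)])
    ultimately show ?L
      using shift[OF \<xi>(1) m] g(1) \<xi> by metis
  qed
  then show ?thesis unfolding \<delta> by (simp add: deformation_equiv_def E_def)
qed

lemma deformation_equiv_eq: "deformation_equiv A \<omega> b = coset_rel VE T"
proof -
  have c: "vs_carrier VE = E" using pair_vs.presentsD(2)[OF VE_presented] by simp
  have "(u, v) \<in> deformation_equiv A \<omega> b \<longleftrightarrow> (u, v) \<in> coset_rel VE T" for u v
  proof (cases "u \<in> E \<and> v \<in> E")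
    case True
    have "u - v \<in> T \<longleftrightarrow> v - u \<in> T"
      using pair_vs.subspace_neg[OF subspace_T, of "u - v"] pair_vs.subspace_neg[OF subspace_T, of "v - u"] by auto
    moreover have "v - u \<in> T \<longleftrightarrow> (\<exists>t\<in>T. v = vs_add VE u t)"
    proof -
      have "vs_add VE u t = u + t" if "t \<in> T" for t
        using pair_vs.presentsD(3)[OF VE_presented] True T_sub that by blast
      then have "(\<exists>t\<in>T. v = vs_add VE u t) \<longleftrightarrow> (\<exists>t\<in>T. v = u + t)" by auto
      then show ?thesis by (auto intro: bexI[of _ "v - u"])
    qed
    ultimately show ?thesis using True by (simp add: deformation_equiv_iff coset_rel_def c del: One_nat_def)
  next
    case False
    then show ?thesis by (auto simp: deformation_equiv_iff coset_rel_def c simp del: One_nat_def)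
  qed
  then show ?thesis by auto
qed

lemma Def_presented: "pair_vs.presents E (Def_class A \<omega> b) (Def_space A \<omega> b)"
  and Def_class_eq: "\<delta> \<in> E \<Longrightarrow> \<delta>' \<in> E \<Longrightarrow> Def_class A \<omega> b \<delta> = Def_class A \<omega> b \<delta>' \<longleftrightarrow> \<delta>' - \<delta> \<in> T"
  and Def_class_mem: "\<delta> \<in> E \<Longrightarrow> \<delta>' \<in> Def_class A \<omega> b \<delta> \<longleftrightarrow> \<delta>' \<in> E \<and> \<delta>' - \<delta> \<in> T"
proof -
  have 1: "Def_class A \<omega> b = vs_coset VE T"
    by (simp add: fun_eq_iff Def_class_def vs_coset_def deformation_equiv_eq)
  have 2: "Def_space A \<omega> b = vs_quot VE T"
    by (simp add: Def_space_def vs_quot_def deformation_equiv_eq)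
  note q = pair_vs.presents_quot_id[OF VE_presented subspace_T T_sub]
  show "pair_vs.presents E (Def_class A \<omega> b) (Def_space A \<omega> b)" unfolding 1 2 by (rule q(1))
  show "\<delta> \<in> E \<Longrightarrow> \<delta>' \<in> E \<Longrightarrow> Def_class A \<omega> b \<delta> = Def_class A \<omega> b \<delta>' \<longleftrightarrow> \<delta>' - \<delta> \<in> T"
    unfolding 1 by (rule q(2))
  show "\<delta> \<in> E \<Longrightarrow> \<delta>' \<in> Def_class A \<omega> b \<delta> \<longleftrightarrow> \<delta>' \<in> E \<and> \<delta>' - \<delta> \<in> T"
    unfolding 1 by (rule q(3))
qed

abbreviation "H1 \<equiv> cohomology A (ext_deriv A) 1"
abbreviation "cls1 \<equiv> coh_class A (ext_deriv A) 1"

lemma H1_presented: "form_vs.presents Z1 cls1 H1"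
  and cls1_eq: "\<alpha> \<in> Z1 \<Longrightarrow> \<beta> \<in> Z1 \<Longrightarrow> cls1 \<alpha> = cls1 \<beta> \<longleftrightarrow> \<beta> - \<alpha> \<in> B1"
  and cls1_mem: "\<alpha> \<in> Z1 \<Longrightarrow> \<beta> \<in> cls1 \<alpha> \<longleftrightarrow> \<beta> \<in> Z1 \<and> \<beta> - \<alpha> \<in> B1"
proof -
  note q = form_vs.presents_quot_id[OF Z1_presented subspace_B1 B1_sub]
  have 1: "cls1 = vs_coset (closed_forms A (ext_deriv A) 1) B1"
    by (simp only: fun_eq_iff coh_class_def exact_1 simp_thms)
  show "form_vs.presents Z1 cls1 H1"
    using q(1) unfolding 1 cohomology_def exact_1 .
  show "\<alpha> \<in> Z1 \<Longrightarrow> \<beta> \<in> Z1 \<Longrightarrow> cls1 \<alpha> = cls1 \<beta> \<longleftrightarrow> \<beta> - \<alpha> \<in> B1" unfolding 1 by (rule q(2))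
  show "\<alpha> \<in> Z1 \<Longrightarrow> \<beta> \<in> cls1 \<alpha> \<longleftrightarrow> \<beta> \<in> Z1 \<and> \<beta> - \<alpha> \<in> B1" unfolding 1 by (rule q(3))
qed

text \<open>
  The relation of cosets only compares elements of the carrier, so the image of \<open>d\<^sup>b\<close>
  may be replaced by its intersection with \<open>Z3\<close>, which is a subspace of the carrier.
\<close>

lemma cls3_eq:
  assumes "\<gamma> \<in> Z3" "\<eta> \<in> Z3"
  shows "coh_class A D 3 \<gamma> = coh_class A D 3 \<eta> \<longleftrightarrow> \<eta> - \<gamma> \<in> D ` forms A 2"
proof -
  let ?V = "closed_forms A D 3" and ?B = "D ` forms A 2 \<inter> Z3"
  have c: "vs_carrier ?V = Z3" and add: "vs_add ?V u v = u + v" for u v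
    by (simp_all add: closed_forms_def vs_restrict_def form_space_def Z3_def)
  have "coset_rel ?V (D ` forms A 2) = coset_rel ?V ?B"
  proof -
    have "w \<in> Z3" if "u \<in> Z3" "u + w \<in> Z3" for u w
      using form_vs.subspace_diff[OF subspace_Z3 that(2,1)] by simp
    then show ?thesis unfolding coset_rel_def c add by blast
  qed
  then have "coh_class A D 3 \<gamma> = vs_coset ?V ?B \<gamma>" for \<gamma>
    by (simp add: coh_class_def exact_3 vs_coset_def)
  moreover have "form_vs.subspace ?B"
    by (intro form_vs.subspace_inter subspace_D_image subspace_Z3)
  ultimately show ?thesis
    using form_vs.presents_quot_id(2)[OF Z3_presented, of ?B] form_vs.subspace_diff[OF subspace_Z3] assms by auto
qed

lemma wedge_Z3: "\<alpha> \<in> Z1 \<Longrightarrow> wedge1 \<alpha> \<omega> \<in> Z3"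
  using wedge1_form2[OF \<omega>] twisted_deriv_wedge1[OF b(1) \<omega> D\<omega>] by (auto simp: Z1_def Z3_def)

lemma L_map_class:
  assumes \<alpha>: "\<alpha> \<in> Z1"
  shows "L_map A \<omega> b (cls1 \<alpha>) = coh_class A D 3 (wedge1 \<alpha> \<omega>)"
proof -
  have "coh_class A D 3 (wedge1 \<beta> \<omega>) = coh_class A D 3 (wedge1 \<alpha> \<omega>)" if \<beta>: "\<beta> \<in> cls1 \<alpha>" for \<beta>
  proof -
    have \<beta>Z: "\<beta> \<in> Z1" and "\<beta> - \<alpha> \<in> B1" using \<beta> cls1_mem[OF \<alpha>] by auto
    then obtain f where f: "f \<in> SF" "\<beta> - \<alpha> = df f" by (auto simp: B1_def)
    have "wedge1 \<beta> \<omega> = wedge1 \<alpha> \<omega> + wedge1 (df f) \<omega>"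
      unfolding wedge1_add_left[symmetric] f(2)[symmetric] by simp
    then have "wedge1 \<beta> \<omega> - wedge1 \<alpha> \<omega> = D (form_mult f \<omega>)" unfolding D_form_mult[OF f(1)] by simp
    then show ?thesis
      using cls3_eq[OF wedge_Z3[OF \<alpha>] wedge_Z3[OF \<beta>Z]] forms_mult[OF f(1) \<omega>] by blast
  qed
  moreover have "\<alpha> \<in> cls1 \<alpha>" using cls1_mem[OF \<alpha>] \<alpha> form_vs.subspace_0[OF subspace_B1] by simp
  ultimately show ?thesis unfolding L_map_def by blast
qed

lemma L_map_zero_iff:
  assumes \<alpha>: "\<alpha> \<in> Z1"
  shows "L_map A \<omega> b (cls1 \<alpha>) = coh_class A D 3 0 \<longleftrightarrow> \<alpha> \<in> K"
proof -
  have "L_map A \<omega> b (cls1 \<alpha>) = coh_class A D 3 0 \<longleftrightarrow> coh_class A D 3 0 = coh_class A D 3 (wedge1 \<alpha> \<omega>)"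
    unfolding L_map_class[OF \<alpha>] by blast
  also have "\<dots> \<longleftrightarrow> wedge1 \<alpha> \<omega> \<in> D ` forms A 2"
    using cls3_eq[OF form_vs.subspace_0[OF subspace_Z3] wedge_Z3[OF \<alpha>]] by simp
  also have "\<dots> \<longleftrightarrow> \<alpha> \<in> K" using \<alpha> by (simp add: K_def image_iff eq_commute)
  finally show ?thesis .
qed

lemma H3_zero: "vs_zero (cohomology A D 3) = coh_class A D 3 0"
  by (simp add: cohomology_def vs_quot_def vs_quot_rel_def coh_class_def vs_coset_def closed_forms_def
      vs_restrict_def form_space_def)

lemma L_kernel_presented: "form_vs.presents K cls1 (L_kernel A \<omega> b)"
proof -
  have "{C \<in> vs_carrier H1. L_map A \<omega> b C = vs_zero (cohomology A D 3)} = cls1 ` K"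
    unfolding form_vs.presentsD(2)[OF H1_presented, symmetric] H3_zero
    using L_map_zero_iff K_sub by blast
  then show ?thesis
    unfolding L_kernel_def using form_vs.presents_subspace[OF H1_presented subspace_K K_sub] by simp
qed

lemma L_kernel_zero: "vs_zero (L_kernel A \<omega> b) = cls1 0"
  by (simp add: L_kernel_def cohomology_def vs_quot_def vs_quot_rel_def coh_class_def vs_coset_def closed_forms_def
      vs_restrict_def form_space_def)

lemma inj_L_K:
  assumes "inj_on (L_map A \<omega> b) (vs_carrier H1)"
  shows "K = B1"
proof
  show "K \<subseteq> B1"
  proof
    fix \<alpha> assume \<alpha>: "\<alpha> \<in> K"
    have Z: "\<alpha> \<in> Z1" "0 \<in> Z1" using \<alpha> K_sub form_vs.subspace_0[OF subspace_Z1] by auto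
    have "L_map A \<omega> b (cls1 \<alpha>) = L_map A \<omega> b (cls1 0)"
      using L_map_zero_iff[OF Z(1)] L_map_zero_iff[OF Z(2)] \<alpha> form_vs.subspace_0[OF subspace_K] by simp
    moreover have "cls1 \<alpha> \<in> vs_carrier H1" "cls1 0 \<in> vs_carrier H1"
      using Z form_vs.presentsD(2)[OF H1_presented] by blast+
    ultimately have "cls1 0 = cls1 \<alpha>" using inj_onD[OF assms] by metis
    then show "\<alpha> \<in> B1" using cls1_eq[OF Z(2,1)] by simp
  qed
qed (rule B1_sub_K)

section \<open>The isomorphisms\<close>

text \<open>
  If \<open>L\<close> is injective, every deformation \<open>(\<kappa>, c)\<close> has \<open>c = df\<close>, and is equivalent to \<open>(\<kappa> + f \<omega>, 0)\<close>.
\<close>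

theorem Def_iso_injective:
  assumes inj: "inj_on (L_map A \<omega> b) (vs_carrier H1)" and q: "presents_H q V"
  shows "\<exists>\<Phi>. vs_iso V (Def_space A \<omega> b) \<Phi> \<and> (\<forall>\<kappa>\<in>Z2. \<Phi> (q \<kappa>) = Def_class A \<omega> b (\<kappa>, 0))"
proof (rule form_vs.presents_iso)
  note DP = pair_vs.presentsD[OF Def_presented]
  show "form_vs.presents Z2 q V" using q by (simp add: presents_H_def)
  show "form_vs.presents Z2 (\<lambda>\<kappa>. Def_class A \<omega> b (\<kappa>, 0)) (Def_space A \<omega> b)"
    unfolding form_vs.presents_def
  proof (intro conjI ballI allI subspace_Z2)
    show "Def_class A \<omega> b (\<kappa> + \<mu>, 0) = vs_add (Def_space A \<omega> b) (Def_class A \<omega> b (\<kappa>, 0)) (Def_class A \<omega> b (\<mu>, 0))"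
      if "\<kappa> \<in> Z2" "\<mu> \<in> Z2" for \<kappa> \<mu>
      using DP(3)[of "(\<kappa>, 0)" "(\<mu>, 0)"] that by (simp add: E_Z2)
    show "Def_class A \<omega> b (form_scale r \<kappa>, 0) = vs_scale (Def_space A \<omega> b) r (Def_class A \<omega> b (\<kappa>, 0))"
      if "\<kappa> \<in> Z2" for r \<kappa>
      using DP(4)[of "(\<kappa>, 0)" r] that by (simp add: E_Z2 pair_scale_def form_vs.scale_zero_right)
    show "(\<lambda>\<kappa>. Def_class A \<omega> b (\<kappa>, 0)) ` Z2 = vs_carrier (Def_space A \<omega> b)"
      unfolding DP(2)[symmetric]
    proof
      show "(\<lambda>\<kappa>. Def_class A \<omega> b (\<kappa>, 0)) ` Z2 \<subseteq> Def_class A \<omega> b ` E" using E_Z2 by blast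
      show "Def_class A \<omega> b ` E \<subseteq> (\<lambda>\<kappa>. Def_class A \<omega> b (\<kappa>, 0)) ` Z2"
      proof
        fix X assume "X \<in> Def_class A \<omega> b ` E"
        then obtain \<kappa> c where X: "X = Def_class A \<omega> b (\<kappa>, c)" and \<delta>: "(\<kappa>, c) \<in> E" by force
        have "c \<in> B1" using \<delta> snd_E inj_L_K[OF inj] by force
        then obtain f where f: "f \<in> SF" "c = df f" by (auto simp: B1_def)
        have t: "(form_mult f \<omega>, - df f) \<in> T" by (rule T_exact[OF f(1)])
        have e: "(\<kappa> + form_mult f \<omega>, 0) = (\<kappa>, c) + (form_mult f \<omega>, - df f)" using f(2) by simp
        have \<delta>': "(\<kappa> + form_mult f \<omega>, 0) \<in> E"
          unfolding e using pair_vs.subspace_add[OF subspace_E \<delta>] t T_sub by blast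
        have "X = Def_class A \<omega> b (\<kappa> + form_mult f \<omega>, 0)"
          unfolding X Def_class_eq[OF \<delta> \<delta>'] unfolding e using t by simp
        then show "X \<in> (\<lambda>\<kappa>. Def_class A \<omega> b (\<kappa>, 0)) ` Z2" using \<delta>' E_Z2 by blast
      qed
    qed
  qed
  show "q \<kappa> = q \<mu> \<longleftrightarrow> Def_class A \<omega> b (\<kappa>, 0) = Def_class A \<omega> b (\<mu>, 0)" if "\<kappa> \<in> Z2" "\<mu> \<in> Z2" for \<kappa> \<mu>
    using q that Def_class_eq[of "(\<kappa>, 0)" "(\<mu>, 0)"] by (simp add: presents_H_def E_Z2 T_fst)
qed

text \<open>
  A linear choice of a deformation for each class in the kernel of \<open>L\<close>. A right inverse of the second
  projection on \<open>E\<close> is precomposed with a projection along the exact one-forms: this makes it depend on the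
  cohomology class of \<open>c\<close> only, and changes \<open>c\<close> by exact forms only.
\<close>

lemma splitting:
  obtains \<sigma> where "Vector_Spaces.linear form_scale pair_scale \<sigma>"
    "\<And>c. c \<in> B1 \<Longrightarrow> \<sigma> c = 0"
    "\<And>c. c \<in> K \<Longrightarrow> \<sigma> c \<in> E \<and> snd (\<sigma> c) - c \<in> B1"
proof -
  have "Vector_Spaces.linear pair_scale form_scale (snd :: 'a form \<times> 'a form \<Rightarrow> 'a form)"
    by unfold_locales (auto simp: pair_scale_def)
  then obtain g where g: "Vector_Spaces.linear form_scale pair_scale g" "g ` UNIV \<subseteq> E"
    "\<forall>c\<in>snd ` E. snd (g c) = c"
    using pair_form.linear_exists_right_inverse_on[OF _ subspace_E] by blast
  obtain P where P: "Vector_Spaces.linear form_scale form_scale P" "\<And>u. u \<in> B1 \<Longrightarrow> P u = 0"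
    "\<And>x. P x - x \<in> B1"
    by (rule form_vs.complement_projection[OF subspace_B1]) blast
  have lin: "Vector_Spaces.linear form_scale pair_scale (\<lambda>c. g (P c))"
    using Vector_Spaces.linear_compose[OF P(1) g(1)] by (simp add: o_def)
  interpret g: Vector_Spaces.linear form_scale pair_scale g by (rule g(1))
  note lin
  moreover have "g (P c) = 0" if "c \<in> B1" for c
    using P(2)[OF that] g.zero by simp
  moreover have "g (P c) \<in> E \<and> snd (g (P c)) - c \<in> B1" if "c \<in> K" for c
  proof -
    have "P c - c + c \<in> K" using form_vs.subspace_add[OF subspace_K _ that] P(3) B1_sub_K by blast
    then have "snd (g (P c)) = P c" using g(3) snd_E by simp
    then show ?thesis using g(2) P(3) by auto
  qed
  ultimately show ?thesis using that by blast
qed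

lemma sum_presented:
  assumes "presents_H q V"
  shows "pair_vs.presents (K \<times> Z2) (\<lambda>(c, \<kappa>). (cls1 c, q \<kappa>)) (vs_sum (L_kernel A \<omega> b) V)"
  using presents_sum[OF form_vs.real_space_axioms form_vs.real_space_axioms L_kernel_presented, of Z2 q V] assms
  by (simp add: presents_H_def pair_scale_def)

text \<open>
  With \<open>\<sigma>\<close> from the splitting, \<open>(c, \<kappa>) \<mapsto> \<sigma> c + (\<kappa>, 0)\<close> induces the isomorphism. If the difference of two values is
  trivial, its second component shows that the two \<open>c\<close> are cohomologous; then \<open>\<sigma>\<close> cancels and the
  two-forms differ by an element of the image of \<open>S\<close>.
\<close>

theorem Def_iso_splitting:
  assumes q: "presents_H q V"
  shows "\<exists>\<Phi>. vs_iso (vs_sum (L_kernel A \<omega> b) V) (Def_space A \<omega> b) \<Phi> \<and>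
    (\<forall>\<kappa>\<in>Z2. \<Phi> (vs_zero (L_kernel A \<omega> b), q \<kappa>) = Def_class A \<omega> b (\<kappa>, 0)) \<and>
    (\<forall>C\<in>vs_carrier (L_kernel A \<omega> b). \<forall>Q\<in>vs_carrier V. \<forall>(\<kappa>, c)\<in>\<Phi> (C, Q). c \<in> C)"
proof -
  obtain \<sigma> where lin: "Vector_Spaces.linear form_scale pair_scale \<sigma>"
    and \<sigma>0: "\<And>c. c \<in> B1 \<Longrightarrow> \<sigma> c = 0" and \<sigma>K: "\<And>c. c \<in> K \<Longrightarrow> \<sigma> c \<in> E \<and> snd (\<sigma> c) - c \<in> B1"
    using splitting by metis
  interpret \<sigma>: Vector_Spaces.linear form_scale pair_scale \<sigma> by (rule lin)
  note DP = pair_vs.presentsD[OF Def_presented]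
  define G where "G = (\<lambda>(c, \<kappa>). \<sigma> c + (\<kappa>, 0))"
  have G_E: "G u \<in> E" if "u \<in> K \<times> Z2" for u
    using that pair_vs.subspace_add[OF subspace_E, of "\<sigma> (fst u)" "(snd u, 0)"] \<sigma>K[of "fst u"]
    by (auto simp: G_def E_Z2)
  have G_add: "G (u + v) = G u + G v" for u v
    by (cases u; cases v) (simp add: G_def \<sigma>.add ac_simps)
  have G_scale: "G (pair_scale r u) = pair_scale r (G u)" for r u
  proof (cases u)
    case (Pair c \<kappa>)
    have p: "pair_scale r (\<mu>, e) = (form_scale r \<mu>, form_scale r e)" for \<mu> e :: "'a form"
      by (simp add: pair_scale_def)
    show ?thesis
      by (simp add: Pair G_def p \<sigma>.scale pair_vs.scale_right_distrib form_vs.scale_zero_right)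
  qed
  have "pair_vs.presents (K \<times> Z2) (\<lambda>u. Def_class A \<omega> b (G u)) (Def_space A \<omega> b)"
    unfolding pair_vs.presents_def
  proof (intro conjI ballI allI)
    show "pair_vs.subspace (K \<times> Z2)" by (rule pair_vs.presentsD(1)[OF sum_presented[OF q]])
    show "Def_class A \<omega> b (G (u + v)) = vs_add (Def_space A \<omega> b) (Def_class A \<omega> b (G u)) (Def_class A \<omega> b (G v))"
      if "u \<in> K \<times> Z2" "v \<in> K \<times> Z2" for u v
      unfolding G_add DP(3)[OF G_E[OF that(1)] G_E[OF that(2)]] ..
    show "Def_class A \<omega> b (G (pair_scale r u)) = vs_scale (Def_space A \<omega> b) r (Def_class A \<omega> b (G u))"
      if "u \<in> K \<times> Z2" for r u
      unfolding G_scale DP(4)[OF G_E[OF that]] ..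
    show "(\<lambda>u. Def_class A \<omega> b (G u)) ` (K \<times> Z2) = vs_carrier (Def_space A \<omega> b)"
      unfolding DP(2)[symmetric]
    proof
      show "(\<lambda>u. Def_class A \<omega> b (G u)) ` (K \<times> Z2) \<subseteq> Def_class A \<omega> b ` E" using G_E by blast
      show "Def_class A \<omega> b ` E \<subseteq> (\<lambda>u. Def_class A \<omega> b (G u)) ` (K \<times> Z2)"
      proof
        fix X assume "X \<in> Def_class A \<omega> b ` E"
        then obtain \<delta> where X: "X = Def_class A \<omega> b \<delta>" and \<delta>: "\<delta> \<in> E" by blast
        have c: "snd \<delta> \<in> K" using \<delta> snd_E by blast
        obtain f where f: "f \<in> SF" "snd (\<sigma> (snd \<delta>)) - snd \<delta> = df f"
          using \<sigma>K[OF c] by (auto simp: B1_def)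
        \<comment> \<open>Correct \<open>\<delta>\<close> by a trivial deformation so that its second component becomes that of \<open>\<sigma> (snd \<delta>)\<close>.\<close>
        define t where "t = (form_mult f \<omega>, - df f)"
        have t: "t \<in> T" unfolding t_def by (rule T_exact[OF f(1)])
        define \<kappa> where "\<kappa> = fst (\<delta> - t - \<sigma> (snd \<delta>))"
        have "snd (\<delta> - t - \<sigma> (snd \<delta>)) = 0" using f(2) by (simp add: t_def algebra_simps)
        then have \<kappa>: "\<delta> - t - \<sigma> (snd \<delta>) = (\<kappa>, 0)" by (simp add: \<kappa>_def prod_eq_iff)
        have \<delta>t: "\<delta> - t \<in> E" using pair_vs.subspace_diff[OF subspace_E \<delta>] t T_sub by blast
        have "(\<kappa>, 0) \<in> E"
          unfolding \<kappa>[symmetric] using pair_vs.subspace_diff[OF subspace_E \<delta>t] \<sigma>K[OF c] by blast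
        then have \<kappa>Z: "\<kappa> \<in> Z2" by (simp add: E_Z2)
        have "G (snd \<delta>, \<kappa>) = \<delta> - t" by (simp add: G_def \<kappa>[symmetric])
        moreover have "Def_class A \<omega> b (\<delta> - t) = Def_class A \<omega> b \<delta>"
          using Def_class_eq[OF \<delta>t \<delta>] t by simp
        ultimately have "X = Def_class A \<omega> b (G (snd \<delta>, \<kappa>))" by (simp add: X)
        then show "X \<in> (\<lambda>u. Def_class A \<omega> b (G u)) ` (K \<times> Z2)" using c \<kappa>Z by blast
      qed
    qed
  qed
  moreover have "(case u of (c, \<kappa>) \<Rightarrow> (cls1 c, q \<kappa>)) = (case v of (c, \<kappa>) \<Rightarrow> (cls1 c, q \<kappa>)) \<longleftrightarrow>
      Def_class A \<omega> b (G u) = Def_class A \<omega> b (G v)" if uv: "u \<in> K \<times> Z2" "v \<in> K \<times> Z2" for u v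
  proof -
    obtain c \<kappa> c' \<kappa>' where u: "u = (c, \<kappa>)" and v: "v = (c', \<kappa>')" by (cases u; cases v)
    have m: "c \<in> K" "c' \<in> K" "\<kappa> \<in> Z2" "\<kappa>' \<in> Z2" using uv u v by auto
    have cc: "c' - c \<in> K" using form_vs.subspace_diff[OF subspace_K m(2,1)] .
    have diff: "G v - G u = \<sigma> (c' - c) + (\<kappa>' - \<kappa>, 0)"
      by (simp add: u v G_def \<sigma>.diff algebra_simps)
    have "G v - G u \<in> T \<longleftrightarrow> c' - c \<in> B1 \<and> \<kappa>' - \<kappa> \<in> S_image A \<omega> b"
    proof
      assume t: "G v - G u \<in> T"
      then have "snd (G v - G u) \<in> B1" using T_snd by blast
      then have "snd (\<sigma> (c' - c)) \<in> B1" by (simp add: diff)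
      then have "snd (\<sigma> (c' - c)) - (snd (\<sigma> (c' - c)) - (c' - c)) \<in> B1"
        using form_vs.subspace_diff[OF subspace_B1] \<sigma>K[OF cc] by blast
      then have "c' - c \<in> B1" by simp
      then show "c' - c \<in> B1 \<and> \<kappa>' - \<kappa> \<in> S_image A \<omega> b"
        using t by (simp add: diff \<sigma>0 T_fst)
    next
      assume "c' - c \<in> B1 \<and> \<kappa>' - \<kappa> \<in> S_image A \<omega> b"
      then show "G v - G u \<in> T" by (simp add: diff \<sigma>0 T_fst)
    qed
    moreover have "cls1 c = cls1 c' \<longleftrightarrow> c' - c \<in> B1" using cls1_eq m K_sub by blast
    moreover have "q \<kappa> = q \<kappa>' \<longleftrightarrow> \<kappa>' - \<kappa> \<in> S_image A \<omega> b" using q m by (simp add: presents_H_def)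
    ultimately show ?thesis using Def_class_eq[OF G_E[OF uv(1)] G_E[OF uv(2)]] by (simp add: u v)
  qed
  ultimately obtain \<Phi> where iso: "vs_iso (vs_sum (L_kernel A \<omega> b) V) (Def_space A \<omega> b) \<Phi>"
    and \<Phi>: "\<And>c \<kappa>. c \<in> K \<Longrightarrow> \<kappa> \<in> Z2 \<Longrightarrow> \<Phi> (cls1 c, q \<kappa>) = Def_class A \<omega> b (G (c, \<kappa>))"
    using pair_vs.presents_iso[OF sum_presented[OF q], of "\<lambda>u. Def_class A \<omega> b (G u)" "Def_space A \<omega> b"]
    by fastforce
  have "\<Phi> (vs_zero (L_kernel A \<omega> b), q \<kappa>) = Def_class A \<omega> b (\<kappa>, 0)" if "\<kappa> \<in> Z2" for \<kappa>
    using \<Phi>[OF form_vs.subspace_0[OF subspace_K] that] by (simp add: L_kernel_zero G_def \<sigma>.zero)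
  moreover have "e \<in> C"
    if CQ: "C \<in> vs_carrier (L_kernel A \<omega> b)" "Q \<in> vs_carrier V" and e: "(\<mu>, e) \<in> \<Phi> (C, Q)" for C Q \<mu> e
  proof -
    obtain c where c: "c \<in> K" "C = cls1 c" using CQ(1) form_vs.presentsD(2)[OF L_kernel_presented] by blast
    obtain \<kappa> where \<kappa>: "\<kappa> \<in> Z2" "Q = q \<kappa>"
      using CQ(2) q form_vs.presentsD(2) unfolding presents_H_def by blast
    have GE: "G (c, \<kappa>) \<in> E" by (rule G_E) (use c \<kappa> in simp)
    have m: "(\<mu>, e) \<in> E" "(\<mu>, e) - G (c, \<kappa>) \<in> T"
      using e unfolding c(2) \<kappa>(2) \<Phi>[OF c(1) \<kappa>(1)] Def_class_mem[OF GE] by blast+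
    then have "e - snd (\<sigma> c) \<in> B1" using T_snd by (force simp: G_def)
    then have "(e - snd (\<sigma> c)) + (snd (\<sigma> c) - c) \<in> B1"
      using form_vs.subspace_add[OF subspace_B1] \<sigma>K[OF c(1)] by blast
    moreover have "e \<in> Z1" using m(1) by (simp add: E_iff)
    ultimately show ?thesis using cls1_mem c K_sub by auto
  qed
  ultimately show ?thesis using iso by blast
qed

theorem closed_mod_S_iso_H2_mod:
  "\<exists>\<Psi>. vs_iso (closed_mod_S A \<omega> b) (H2_mod A D \<omega>) \<Psi> \<and>
    (\<forall>\<kappa>\<in>Z2. \<Psi> (closed_mod_S_class A \<omega> b \<kappa>) = H2_mod_class A D \<omega> \<kappa>)"
  using closed_mod_S_presented H2_mod_presented unfolding presents_H_def
  by (intro form_vs.presents_iso) auto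

theorem sum_closed_mod_S_iso_H2_mod:
  "\<exists>\<Psi>. vs_iso (vs_sum (L_kernel A \<omega> b) (closed_mod_S A \<omega> b)) (vs_sum (L_kernel A \<omega> b) (H2_mod A D \<omega>)) \<Psi> \<and>
    (\<forall>C\<in>vs_carrier (L_kernel A \<omega> b). \<forall>\<kappa>\<in>Z2.
       \<Psi> (C, closed_mod_S_class A \<omega> b \<kappa>) = (C, H2_mod_class A D \<omega> \<kappa>))"
proof -
  let ?q = "\<lambda>(c, \<kappa>). (cls1 c, closed_mod_S_class A \<omega> b \<kappa>)"
  let ?r = "\<lambda>(c, \<kappa>). (cls1 c, H2_mod_class A D \<omega> \<kappa>)"
  have "?q u = ?q v \<longleftrightarrow> ?r u = ?r v" if "u \<in> K \<times> Z2" "v \<in> K \<times> Z2" for u v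
  proof (cases u; cases v)
    fix c \<kappa> c' \<kappa>' assume uv: "u = (c, \<kappa>)" "v = (c', \<kappa>')"
    have "closed_mod_S_class A \<omega> b \<kappa> = closed_mod_S_class A \<omega> b \<kappa>' \<longleftrightarrow>
        H2_mod_class A D \<omega> \<kappa> = H2_mod_class A D \<omega> \<kappa>'"
      using that closed_mod_S_presented H2_mod_presented by (simp add: presents_H_def uv)
    then show ?thesis by (simp add: uv)
  qed
  then obtain \<Psi> where "vs_iso (vs_sum (L_kernel A \<omega> b) (closed_mod_S A \<omega> b)) (vs_sum (L_kernel A \<omega> b) (H2_mod A D \<omega>)) \<Psi>"
    and "\<forall>u\<in>K \<times> Z2. \<Psi> (?q u) = ?r u"
    using pair_vs.presents_iso[OF sum_presented[OF closed_mod_S_presented] sum_presented[OF H2_mod_presented]] by blast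
  then show ?thesis
    unfolding form_vs.presentsD(2)[OF L_kernel_presented, symmetric] by (intro exI[of _ \<Psi>]) auto
qed

lemma carrier_closed_forms: "vs_carrier (closed_forms A D 2) = Z2"
  using form_vs.presentsD(2)[OF Z2_presented] by simp

end

lemma twisted_deriv_0: "twisted_deriv A 0 = ext_deriv A"
  by (intro ext) (simp add: twisted_deriv_def wedge1_def)

theorem mainTheorem6:
  fixes A :: "('a::{t2_space,second_countable_topology}, 'e::euclidean_space) atlas"
    and \<omega> b :: "'a form"
  assumes "smooth_atlas A" and "connected (UNIV :: 'a set)" and "DIM('e) \<ge> 4"
    and "lcs_structure A \<omega> b"
  shows
    "(inj_on (L_map A \<omega> b) (vs_carrier (cohomology A (ext_deriv A) 1)) \<longrightarrow>
        (\<exists>\<Phi>. vs_iso (closed_mod_S A \<omega> b) (Def_space A \<omega> b) \<Phi> \<and>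
           (\<forall>\<kappa>\<in>vs_carrier (closed_forms A (twisted_deriv A b) 2).
              \<Phi> (closed_mod_S_class A \<omega> b \<kappa>) = Def_class A \<omega> b (\<kappa>, 0))) \<and>
        (\<exists>\<Psi>. vs_iso (closed_mod_S A \<omega> b) (H2_mod A (twisted_deriv A b) \<omega>) \<Psi> \<and>
           (\<forall>\<kappa>\<in>vs_carrier (closed_forms A (twisted_deriv A b) 2).
              \<Psi> (closed_mod_S_class A \<omega> b \<kappa>) = H2_mod_class A (twisted_deriv A b) \<omega> \<kappa>)) \<and>
        (b = 0 \<longrightarrow> symplectic_form A \<omega> \<and>
           (\<exists>\<Phi>. vs_iso (H2_mod A (ext_deriv A) \<omega>) (Def_space A \<omega> 0) \<Phi> \<and>
              (\<forall>\<kappa>\<in>vs_carrier (closed_forms A (ext_deriv A) 2).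
                 \<Phi> (H2_mod_class A (ext_deriv A) \<omega> \<kappa>) = Def_class A \<omega> 0 (\<kappa>, 0)))))
     \<and>
     (\<not> inj_on (L_map A \<omega> b) (vs_carrier (cohomology A (ext_deriv A) 1)) \<longrightarrow>
        (\<exists>\<Phi>. vs_iso (vs_sum (L_kernel A \<omega> b) (closed_mod_S A \<omega> b)) (Def_space A \<omega> b) \<Phi> \<and>
           (\<forall>\<kappa>\<in>vs_carrier (closed_forms A (twisted_deriv A b) 2).
              \<Phi> (vs_zero (L_kernel A \<omega> b), closed_mod_S_class A \<omega> b \<kappa>) = Def_class A \<omega> b (\<kappa>, 0)) \<and>
           (\<forall>C\<in>vs_carrier (L_kernel A \<omega> b). \<forall>Q\<in>vs_carrier (closed_mod_S A \<omega> b).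
              \<forall>(\<kappa>, c)\<in>\<Phi> (C, Q). c \<in> C)) \<and>
        (\<exists>\<Psi>. vs_iso (vs_sum (L_kernel A \<omega> b) (closed_mod_S A \<omega> b))
                (vs_sum (L_kernel A \<omega> b) (H2_mod A (twisted_deriv A b) \<omega>)) \<Psi> \<and>
           (\<forall>C\<in>vs_carrier (L_kernel A \<omega> b).
              \<forall>\<kappa>\<in>vs_carrier (closed_forms A (twisted_deriv A b) 2).
                \<Psi> (C, closed_mod_S_class A \<omega> b \<kappa>)
                  = (C, H2_mod_class A (twisted_deriv A b) \<omega> \<kappa>))) \<and>
        (b = 0 \<longrightarrow> symplectic_form A \<omega> \<and>
           (\<exists>\<Phi>. vs_iso (vs_sum (L_kernel A \<omega> 0) (H2_mod A (ext_deriv A) \<omega>)) (Def_space A \<omega> 0) \<Phi> \<and>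
              (\<forall>\<kappa>\<in>vs_carrier (closed_forms A (ext_deriv A) 2).
                 \<Phi> (vs_zero (L_kernel A \<omega> 0), H2_mod_class A (ext_deriv A) \<omega> \<kappa>)
                   = Def_class A \<omega> 0 (\<kappa>, 0)) \<and>
              (\<forall>C\<in>vs_carrier (L_kernel A \<omega> 0). \<forall>Q\<in>vs_carrier (H2_mod A (ext_deriv A) \<omega>).
                 \<forall>(\<kappa>, c)\<in>\<Phi> (C, Q). c \<in> C))))"
proof -
  interpret lcs_manifold A \<omega> b
    using assms by unfold_locales
  have b0: "twisted_deriv A b = ext_deriv A" "symplectic_form A \<omega>" if "b = 0"
    using twisted_deriv_0[of A] that \<omega> nondeg D\<omega> by (simp_all add: symplectic_form_def)
  note S = closed_mod_S_presented and H = H2_mod_presented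
  show ?thesis
    unfolding carrier_closed_forms
  proof (intro conjI impI)
    assume inj: "inj_on (L_map A \<omega> b) (vs_carrier H1)"
    show "\<exists>\<Phi>. vs_iso (closed_mod_S A \<omega> b) (Def_space A \<omega> b) \<Phi> \<and>
        (\<forall>\<kappa>\<in>Z2. \<Phi> (closed_mod_S_class A \<omega> b \<kappa>) = Def_class A \<omega> b (\<kappa>, 0))"
      by (rule Def_iso_injective[OF inj S])
    show "\<exists>\<Psi>. vs_iso (closed_mod_S A \<omega> b) (H2_mod A D \<omega>) \<Psi> \<and>
        (\<forall>\<kappa>\<in>Z2. \<Psi> (closed_mod_S_class A \<omega> b \<kappa>) = H2_mod_class A D \<omega> \<kappa>)"
      by (rule closed_mod_S_iso_H2_mod)
    assume "b = 0"
    then show "symplectic_form A \<omega>" by (rule b0)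
    show "\<exists>\<Phi>. vs_iso (H2_mod A (ext_deriv A) \<omega>) (Def_space A \<omega> 0) \<Phi> \<and>
        (\<forall>\<kappa>\<in>vs_carrier (closed_forms A (ext_deriv A) 2).
           \<Phi> (H2_mod_class A (ext_deriv A) \<omega> \<kappa>) = Def_class A \<omega> 0 (\<kappa>, 0))"
      using Def_iso_injective[OF inj H] carrier_closed_forms
      unfolding b0(1)[OF \<open>b = 0\<close>] unfolding \<open>b = 0\<close> by simp
  next
    show "\<exists>\<Phi>. vs_iso (vs_sum (L_kernel A \<omega> b) (closed_mod_S A \<omega> b)) (Def_space A \<omega> b) \<Phi> \<and>
        (\<forall>\<kappa>\<in>Z2. \<Phi> (vs_zero (L_kernel A \<omega> b), closed_mod_S_class A \<omega> b \<kappa>) = Def_class A \<omega> b (\<kappa>, 0)) \<and>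
        (\<forall>C\<in>vs_carrier (L_kernel A \<omega> b). \<forall>Q\<in>vs_carrier (closed_mod_S A \<omega> b). \<forall>(\<kappa>, c)\<in>\<Phi> (C, Q). c \<in> C)"
      by (rule Def_iso_splitting[OF S])
    show "\<exists>\<Psi>. vs_iso (vs_sum (L_kernel A \<omega> b) (closed_mod_S A \<omega> b)) (vs_sum (L_kernel A \<omega> b) (H2_mod A D \<omega>)) \<Psi> \<and>
        (\<forall>C\<in>vs_carrier (L_kernel A \<omega> b). \<forall>\<kappa>\<in>Z2.
           \<Psi> (C, closed_mod_S_class A \<omega> b \<kappa>) = (C, H2_mod_class A D \<omega> \<kappa>))"
      by (rule sum_closed_mod_S_iso_H2_mod)
    assume "b = 0"
    then show "symplectic_form A \<omega>" by (rule b0)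
    show "\<exists>\<Phi>. vs_iso (vs_sum (L_kernel A \<omega> 0) (H2_mod A (ext_deriv A) \<omega>)) (Def_space A \<omega> 0) \<Phi> \<and>
        (\<forall>\<kappa>\<in>vs_carrier (closed_forms A (ext_deriv A) 2).
           \<Phi> (vs_zero (L_kernel A \<omega> 0), H2_mod_class A (ext_deriv A) \<omega> \<kappa>) = Def_class A \<omega> 0 (\<kappa>, 0)) \<and>
        (\<forall>C\<in>vs_carrier (L_kernel A \<omega> 0). \<forall>Q\<in>vs_carrier (H2_mod A (ext_deriv A) \<omega>). \<forall>(\<kappa>, c)\<in>\<Phi> (C, Q). c \<in> C)"
      using Def_iso_splitting[OF H] carrier_closed_forms
      unfolding b0(1)[OF \<open>b = 0\<close>] unfolding \<open>b = 0\<close> by simp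
  qed
qed

end
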